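(* Let $X_1,\dots,X_n,Y$ be Banach spaces over the same field $\mathbb K$. The multilinear operator $T:X_1\times\dots\times X_n\to Y$ factors through a Hilbert space if and only if $$s:=\sup\Gamma\big(Q_L\circ T|_{E_1\times\dots\times E_n}\big)<\infty,$$ where the supremum is taken over all finite dimensional subspaces $E_i$ of $X_i$ ($1\le i\le n$) and all finite codimensional subspaces $L$ of $Y$. In this situation $\Gamma(T)=s$.
   Context: $\mathbb K$ is $\mathbb R$ or $\mathbb C$, and $n$ is a positive integer. Finite codimensional subspaces $L$ of $Y$ are closed, and $Q_L:Y\to Y/L$ is the natural quotient map; $Y/L$ has the quotient norm and each $E_i$ the norm of $X_i$. $Q_L\circ T|_{E_1\times\dots\times E_n}:E_1\times\dots\times E_n\to Y/L$ is the multilinear operator $(x^1,\dots,x^n)\mapsto Q_L(T(x^1,\dots,x^n))$. A multilinear operator $T:X_1\times\dots\times X_n\to Y$ between Banach spaces factors through a Hilbert space if there exist a Hilbert space $H$, a subset $M\subset H$, a bounded multilinear operator $A:X_1\times\dots\times X_n\to H$ with $A(X_1\times\dots\times X_n)\subset M$, and a Lipschitz function $B:M\to Y$ such that $T=B\circ A$. Then $\Gamma(T)=\inf\|A\|\,\mathrm{Lip}(B)$, the infimum over all such factorizations ($+\infty$ if there is none); here $\|A\|=\sup\{\|A(x^1,\dots,x^n)\|:\|x^i\|\le1\}$ and $\mathrm{Lip}(B)$ is the least Lipschitz constant of $B$. *)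

theory Defs
  imports "HOL-Analysis.Analysis" "HOL-Algebra.Module" "HOL-Algebra.AbelCoset"
begin

section \<open>Normed, Banach and Hilbert spaces with explicit carriers\<close>

text \<open>
  The spaces \<open>X\<^sub>1, \<dots>, X\<^sub>n\<close>, the subspaces \<open>E\<^sub>i\<close>, the quotients \<open>Y/L\<close> and the Hilbert spaces that are
  quantified over cannot all be types, so a normed space is a module record of \<open>HOL-Algebra\<close>
  together with a norm.  The \<open>X\<^sub>i\<close> are unrelated spaces whose carriers happen to lie in one type (for
  instance a disjoint sum).  Both scalar fields are subfields of the complex numbers: the set \<open>K\<close> of
  scalars is either \<open>\<real>\<close> or \<open>UNIV\<close>.  The fields \<open>mult\<close> and \<open>one\<close>, which module records inherit from ring
  records, play no role.
\<close>

record 'a normed = "(complex, 'a) module" +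
  nrm :: "'a \<Rightarrow> real"

definition scalar_ring :: "complex set \<Rightarrow> complex ring" where
  "scalar_ring K = \<lparr>carrier = K, mult = (*), one = 1, zero = 0, add = (+)\<rparr>"

locale normed_space = module "scalar_ring K" X
  for K :: "complex set" and X :: "'a normed" (structure) +
  assumes scalars: "K = \<real> \<or> K = UNIV"
    and nrm_eq_0_iff: "x \<in> carrier X \<Longrightarrow> nrm X x = 0 \<longleftrightarrow> x = \<zero>"
    and nrm_smult: "\<lbrakk>c \<in> K; x \<in> carrier X\<rbrakk> \<Longrightarrow> nrm X (c \<odot> x) = cmod c * nrm X x"
    and nrm_triangle: "\<lbrakk>x \<in> carrier X; y \<in> carrier X\<rbrakk> \<Longrightarrow> nrm X (x \<oplus> y) \<le> nrm X x + nrm X y"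

text \<open>
  The library requires distance functions to be nonnegative and symmetric off the carrier as well,
  hence the conditional.
\<close>

definition nmetric :: "'a normed \<Rightarrow> 'a metric" where
  "nmetric X = metric (carrier X,
     \<lambda>x y. if x \<in> carrier X \<and> y \<in> carrier X then nrm X (x \<ominus>\<^bsub>X\<^esub> y) else 0)"

definition banach_space :: "complex set \<Rightarrow> 'a normed \<Rightarrow> bool" where
  "banach_space K X \<longleftrightarrow> normed_space K X \<and> mcomplete_of (nmetric X)"

definition inner_product_on :: "complex set \<Rightarrow> 'a normed \<Rightarrow> ('a \<Rightarrow> 'a \<Rightarrow> complex) \<Rightarrow> bool" where
  "inner_product_on K H ip \<longleftrightarrow>
     (\<forall>u\<in>carrier H. \<forall>v\<in>carrier H. ip u v \<in> K \<and> ip v u = cnj (ip u v)) \<and>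
     (\<forall>u\<in>carrier H. \<forall>v\<in>carrier H. \<forall>w\<in>carrier H. ip (u \<oplus>\<^bsub>H\<^esub> v) w = ip u w + ip v w) \<and>
     (\<forall>c\<in>K. \<forall>u\<in>carrier H. \<forall>v\<in>carrier H. ip (c \<odot>\<^bsub>H\<^esub> u) v = c * ip u v) \<and>
     (\<forall>u\<in>carrier H. ip u u = complex_of_real ((nrm H u)\<^sup>2))"

definition hilbert_space :: "complex set \<Rightarrow> 'a normed \<Rightarrow> bool" where
  "hilbert_space K H \<longleftrightarrow> banach_space K H \<and> (\<exists>ip. inner_product_on K H ip)"


section \<open>Finite dimensional subspaces, finite codimensional subspaces, quotients\<close>

definition fin_dim :: "complex set \<Rightarrow> 'a normed \<Rightarrow> bool" where
  "fin_dim K X \<longleftrightarrow> (\<exists>S. finite S \<and> S \<subseteq> carrier X \<and>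
     (\<forall>x\<in>carrier X. \<exists>c\<in>S \<rightarrow> K. x = (\<Oplus>\<^bsub>X\<^esub>b\<in>S. c b \<odot>\<^bsub>X\<^esub> b)))"

abbreviation subspace_normed :: "'a normed \<Rightarrow> 'a set \<Rightarrow> 'a normed" where
  "subspace_normed X E \<equiv> X\<lparr>carrier := E\<rparr>"

definition fin_dim_subspace :: "complex set \<Rightarrow> 'a normed \<Rightarrow> 'a set \<Rightarrow> bool" where
  "fin_dim_subspace K X E \<longleftrightarrow>
     submodule E (scalar_ring K) X \<and> fin_dim K (subspace_normed X E)"

definition quotient_normed :: "'a normed \<Rightarrow> 'a set \<Rightarrow> 'a set normed" where
  "quotient_normed Y L =
     \<lparr>carrier = a_rcosets\<^bsub>Y\<^esub> L, mult = undefined, one = undefined,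
      zero = L, add = set_add Y, smult = (\<lambda>c S. \<Union>s\<in>S. L +>\<^bsub>Y\<^esub> (c \<odot>\<^bsub>Y\<^esub> s)),
      nrm = (\<lambda>S. Inf (nrm Y ` S))\<rparr>"

definition quotient_proj :: "'a normed \<Rightarrow> 'a set \<Rightarrow> 'a \<Rightarrow> 'a set" where
  "quotient_proj Y L y = L +>\<^bsub>Y\<^esub> y"

text \<open>
  By convention finite codimensional subspaces are closed; this is what makes the quotient
  seminorm a norm.
\<close>

definition fin_codim_subspace :: "complex set \<Rightarrow> 'a normed \<Rightarrow> 'a set \<Rightarrow> bool" where
  "fin_codim_subspace K Y L \<longleftrightarrow>
     submodule L (scalar_ring K) Y \<and> closedin (mtopology_of (nmetric Y)) L \<and>
     fin_dim K (quotient_normed Y L)"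


section \<open>Multilinear operators and factorizations\<close>

text \<open>Elements of \<open>X\<^sub>1 \<times> \<dots> \<times> X\<^sub>n\<close> are extensional functions on \<open>{1..n}\<close>.\<close>

definition tuples :: "nat \<Rightarrow> (nat \<Rightarrow> 'a normed) \<Rightarrow> (nat \<Rightarrow> 'a) set" where
  "tuples n X = (\<Pi>\<^sub>E i\<in>{1..n}. carrier (X i))"

definition multilinear ::
    "complex set \<Rightarrow> nat \<Rightarrow> (nat \<Rightarrow> 'a normed) \<Rightarrow> 'b normed \<Rightarrow> ((nat \<Rightarrow> 'a) \<Rightarrow> 'b) \<Rightarrow> bool" where
  "multilinear K n X Y T \<longleftrightarrow>
     T \<in> tuples n X \<rightarrow> carrier Y \<and>
     (\<forall>x\<in>tuples n X. \<forall>i\<in>{1..n}. \<forall>u\<in>carrier (X i). \<forall>v\<in>carrier (X i).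
        T (x(i := u \<oplus>\<^bsub>X i\<^esub> v)) = T (x(i := u)) \<oplus>\<^bsub>Y\<^esub> T (x(i := v))) \<and>
     (\<forall>x\<in>tuples n X. \<forall>i\<in>{1..n}. \<forall>c\<in>K. \<forall>u\<in>carrier (X i).
        T (x(i := c \<odot>\<^bsub>X i\<^esub> u)) = c \<odot>\<^bsub>Y\<^esub> T (x(i := u)))"

definition unit_values ::
    "nat \<Rightarrow> (nat \<Rightarrow> 'a normed) \<Rightarrow> 'b normed \<Rightarrow> ((nat \<Rightarrow> 'a) \<Rightarrow> 'b) \<Rightarrow> real set" where
  "unit_values n X Y A = {nrm Y (A x) |x. x \<in> tuples n X \<and> (\<forall>i\<in>{1..n}. nrm (X i) (x i) \<le> 1)}"

definition bounded_multilinear ::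
    "complex set \<Rightarrow> nat \<Rightarrow> (nat \<Rightarrow> 'a normed) \<Rightarrow> 'b normed \<Rightarrow> ((nat \<Rightarrow> 'a) \<Rightarrow> 'b) \<Rightarrow> bool" where
  "bounded_multilinear K n X Y A \<longleftrightarrow> multilinear K n X Y A \<and> bdd_above (unit_values n X Y A)"

definition multilinear_norm ::
    "nat \<Rightarrow> (nat \<Rightarrow> 'a normed) \<Rightarrow> 'b normed \<Rightarrow> ((nat \<Rightarrow> 'a) \<Rightarrow> 'b) \<Rightarrow> real" where
  "multilinear_norm n X Y A = Sup (unit_values n X Y A)"

definition Lip :: "'a metric \<Rightarrow> 'b metric \<Rightarrow> ('a \<Rightarrow> 'b) \<Rightarrow> real" where
  "Lip m1 m2 f = Inf {c. 0 \<le> c \<and>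
     (\<forall>x\<in>mspace m1. \<forall>y\<in>mspace m1. mdist m2 (f x) (f y) \<le> c * mdist m1 x y)}"

definition hilbert_factorization ::
    "complex set \<Rightarrow> nat \<Rightarrow> (nat \<Rightarrow> 'a normed) \<Rightarrow> 'b normed \<Rightarrow> ((nat \<Rightarrow> 'a) \<Rightarrow> 'b) \<Rightarrow>
     'h normed \<Rightarrow> 'h set \<Rightarrow> ((nat \<Rightarrow> 'a) \<Rightarrow> 'h) \<Rightarrow> ('h \<Rightarrow> 'b) \<Rightarrow> bool" where
  "hilbert_factorization K n X Y T H M A B \<longleftrightarrow>
     hilbert_space K H \<and> M \<subseteq> carrier H \<and>
     bounded_multilinear K n X H A \<and> A ` tuples n X \<subseteq> M \<and>
     Lipschitz_continuous_map (submetric (nmetric H) M) (nmetric Y) B \<and>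
     (\<forall>x\<in>tuples n X. T x = B (A x))"

text \<open>
  A definition cannot quantify over types, so the underlying set of the Hilbert space has to be
  taken from a fixed type.  The type \<open>(nat \<Rightarrow> 'a) \<Rightarrow> complex\<close> is large enough: by the lemmas
  \<open>factors_through_hilbertI\<close> and \<open>hilbert_gamma_le\<close> at the end of this theory, admitting Hilbert
  spaces over any other type changes neither of the following two notions.
\<close>

definition factors_through_hilbert ::
    "complex set \<Rightarrow> nat \<Rightarrow> (nat \<Rightarrow> 'a normed) \<Rightarrow> 'b normed \<Rightarrow> ((nat \<Rightarrow> 'a) \<Rightarrow> 'b) \<Rightarrow> bool" where
  "factors_through_hilbert K n X Y T \<longleftrightarrow>
     (\<exists>(H :: ((nat \<Rightarrow> 'a) \<Rightarrow> complex) normed) M A B. hilbert_factorization K n X Y T H M A B)"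

definition hilbert_gamma ::
    "complex set \<Rightarrow> nat \<Rightarrow> (nat \<Rightarrow> 'a normed) \<Rightarrow> 'b normed \<Rightarrow> ((nat \<Rightarrow> 'a) \<Rightarrow> 'b) \<Rightarrow> ennreal" where
  "hilbert_gamma K n X Y T =
     Inf {ennreal (multilinear_norm n X H A * Lip (submetric (nmetric H) M) (nmetric Y) B)
       |(H :: ((nat \<Rightarrow> 'a) \<Rightarrow> complex) normed) M A B. hilbert_factorization K n X Y T H M A B}"


section \<open>The metric of a normed space\<close>

context normed_space
begin

lemma scalar_closed [simp]:
  "0 \<in> K" "1 \<in> K" "a \<in> K \<Longrightarrow> - a \<in> K" "a \<in> K \<Longrightarrow> cnj a \<in> K" "complex_of_real r \<in> K"
  "a \<in> K \<Longrightarrow> b \<in> K \<Longrightarrow> a + b \<in> K" "a \<in> K \<Longrightarrow> b \<in> K \<Longrightarrow> a * b \<in> K"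
  "a \<in> K \<Longrightarrow> b \<in> K \<Longrightarrow> a / b \<in> K"
  using scalars by (auto simp: Reals_cnj_iff)

lemma smult_in [simp, intro]: "\<lbrakk>c \<in> K; x \<in> carrier X\<rbrakk> \<Longrightarrow> c \<odot> x \<in> carrier X"
  using smult_closed[of c x] by (simp add: scalar_ring_def)

lemma minus_one_smult: 
  assumes "x \<in> carrier X" shows "(-1) \<odot> x = \<ominus> x"
proof -
  have "(-1) \<odot> x \<oplus> x = (-1 + 1) \<odot> x"
    using smult_l_distr[of "-1" 1 x] smult_one[of x] assms by (simp add: scalar_ring_def)
  also have "\<dots> = \<zero>"
    using smult_l_null[of x] assms by (simp add: scalar_ring_def)
  finally show ?thesis
    using assms by (simp add: M.minus_equality)
qed

lemma nrm_a_inv: "x \<in> carrier X \<Longrightarrow> nrm X (\<ominus> x) = nrm X x"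
  using nrm_smult[of "-1" x] by (simp add: minus_one_smult)

lemma nrm_zero [simp]: "nrm X \<zero> = 0"
  by (simp add: nrm_eq_0_iff)

lemma nrm_nonneg [simp]: "x \<in> carrier X \<Longrightarrow> 0 \<le> nrm X x"
  using nrm_triangle[of x "\<ominus> x"] by (simp add: nrm_a_inv M.r_neg)

lemma nrm_minus_commute:
  "\<lbrakk>x \<in> carrier X; y \<in> carrier X\<rbrakk> \<Longrightarrow> nrm X (x \<ominus> y) = nrm X (y \<ominus> x)"
  using nrm_a_inv[of "x \<ominus> y"] by (simp add: M.minus_eq M.minus_add M.a_comm)

lemma minus_eq_0_iff:
  assumes "x \<in> carrier X" "y \<in> carrier X" shows "x \<ominus> y = \<zero> \<longleftrightarrow> x = y"
proof
  assume "x \<ominus> y = \<zero>"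
  then have "\<ominus> (\<ominus> y) = x"
    using assms by (intro M.minus_equality) (simp_all add: M.minus_eq)
  then show "x = y"
    using assms by simp
qed (use assms in \<open>simp add: M.minus_eq M.r_neg\<close>)

lemma minus_add_cancel:
  assumes "x \<in> carrier X" "y \<in> carrier X" "z \<in> carrier X"
  shows "(x \<ominus> y) \<oplus> (y \<ominus> z) = x \<ominus> z"
  using assms by (simp add: M.minus_eq M.a_ac M.r_neg1 M.r_neg2)

lemma Metric_space_nmetric:
  "Metric_space (carrier X)
     (\<lambda>x y. if x \<in> carrier X \<and> y \<in> carrier X then nrm X (x \<ominus> y) else 0)"
proof
  fix x y z assume "x \<in> carrier X" "y \<in> carrier X" "z \<in> carrier X"
  then show "(if x \<in> carrier X \<and> z \<in> carrier X then nrm X (x \<ominus> z) else 0)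
    \<le> (if x \<in> carrier X \<and> y \<in> carrier X then nrm X (x \<ominus> y) else 0) +
      (if y \<in> carrier X \<and> z \<in> carrier X then nrm X (y \<ominus> z) else 0)"
    using nrm_triangle[of "x \<ominus> y" "y \<ominus> z"] by (simp add: minus_add_cancel)
qed (auto simp: nrm_minus_commute nrm_eq_0_iff minus_eq_0_iff)

lemma mspace_nmetric [simp]: "mspace (nmetric X) = carrier X"
  using Metric_space.mspace_metric[OF Metric_space_nmetric] by (simp add: nmetric_def)

lemma mdist_nmetric:
  "\<lbrakk>x \<in> carrier X; y \<in> carrier X\<rbrakk> \<Longrightarrow> mdist (nmetric X) x y = nrm X (x \<ominus> y)"
  using Metric_space.mdist_metric[OF Metric_space_nmetric] by (simp add: nmetric_def)

lemma mcomplete_nmetric_iff: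
  "mcomplete_of (nmetric X) \<longleftrightarrow>
     (\<forall>\<sigma> :: nat \<Rightarrow> _. range \<sigma> \<subseteq> carrier X \<longrightarrow>
        (\<forall>e>0. \<exists>N. \<forall>k\<ge>N. \<forall>l\<ge>N. nrm X (\<sigma> k \<ominus> \<sigma> l) < e) \<longrightarrow>
        (\<exists>x\<in>carrier X. \<forall>e>0. \<exists>N. \<forall>k\<ge>N. nrm X (\<sigma> k \<ominus> x) < e))"
proof -
  interpret MS: Metric_space "mspace (nmetric X)" "mdist (nmetric X)"
    by (rule Metric_space_mspace_mdist)
  have cau: "MS.MCauchy \<sigma> \<longleftrightarrow> range \<sigma> \<subseteq> carrier X \<and>
      (\<forall>e>0. \<exists>N. \<forall>k\<ge>N. \<forall>l\<ge>N. nrm X (\<sigma> k \<ominus> \<sigma> l) < e)" for \<sigma>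
  proof (cases "range \<sigma> \<subseteq> carrier X")
    case True
    then have "\<sigma> k \<in> carrier X" for k by auto
    then have "mdist (nmetric X) (\<sigma> k) (\<sigma> l) = nrm X (\<sigma> k \<ominus> \<sigma> l)" for k l
      by (simp add: mdist_nmetric)
    with True show ?thesis unfolding MS.MCauchy_def by simp
  next
    case False
    then show ?thesis unfolding MS.MCauchy_def by simp
  qed
  have lim: "limitin MS.mtopology \<sigma> x sequentially \<longleftrightarrow> x \<in> carrier X \<and>
      (\<forall>e>0. \<exists>N. \<forall>k\<ge>N. nrm X (\<sigma> k \<ominus> x) < e)" if "range \<sigma> \<subseteq> carrier X" for \<sigma> x
  proof -
    have "\<sigma> k \<in> carrier X" for k using that by auto
    then show ?thesis
      unfolding MS.limit_metric_sequentially
      by (cases "x \<in> carrier X") (simp_all add: mdist_nmetric)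
  qed
  have "(MS.MCauchy \<sigma> \<longrightarrow> (\<exists>x. limitin MS.mtopology \<sigma> x sequentially)) \<longleftrightarrow>
      (range \<sigma> \<subseteq> carrier X \<longrightarrow>
        (\<forall>e>0. \<exists>N. \<forall>k\<ge>N. \<forall>l\<ge>N. nrm X (\<sigma> k \<ominus> \<sigma> l) < e) \<longrightarrow>
        (\<exists>x\<in>carrier X. \<forall>e>0. \<exists>N. \<forall>k\<ge>N. nrm X (\<sigma> k \<ominus> x) < e))" for \<sigma>
  proof (cases "range \<sigma> \<subseteq> carrier X")
    case True
    then show ?thesis unfolding cau lim[OF True] Bex_def by (simp only: simp_thms)
  next
    case False
    then show ?thesis unfolding cau by (simp only: simp_thms)
  qed
  then show ?thesis
    unfolding mcomplete_of_def MS.mcomplete_def by (simp only: simp_thms)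
qed

end


section \<open>Quotients by closed subspaces are normed spaces\<close>

lemma (in normed_space) normed_space_quotient:
  assumes L: "submodule L (scalar_ring K) X" and cl: "closedin (mtopology_of (nmetric X)) L"
  shows "normed_space K (quotient_normed X L)"
proof -
  let ?Q = "quotient_normed X L"
  have Lsub: "L \<subseteq> carrier X" and Linv: "\<And>a. a \<in> L \<Longrightarrow> \<ominus> a \<in> L"
    and Lsm: "\<And>c a. c \<in> K \<Longrightarrow> a \<in> L \<Longrightarrow> c \<odot> a \<in> L"
    and Ladd: "\<And>a b. a \<in> L \<Longrightarrow> b \<in> L \<Longrightarrow> a \<oplus> b \<in> L"
    using submoduleE[OF L] by (auto simp: scalar_ring_def)
  have L0: "\<zero> \<in> L"
    using subgroup.one_closed[OF submodule.axioms(1)[OF L]] by simp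
  have car: "l \<in> carrier X" if "l \<in> L" for l using that Lsub by auto
  define q where "q x = L +> x" for x
  have q: "q x = {l \<oplus> x |l. l \<in> L}" for x
    by (auto simp: q_def a_r_coset_def')
  have qself: "x \<in> q x" if "x \<in> carrier X" for x
    using that L0 q by force
  have qeq: "q x = q y \<longleftrightarrow> x \<ominus> y \<in> L" if xy: "x \<in> carrier X" "y \<in> carrier X" for x y
  proof
    assume "q x = q y"
    then obtain l where "l \<in> L" "x = l \<oplus> y" using qself[OF xy(1)] q by auto
    then show "x \<ominus> y \<in> L"
      using xy car by (simp add: M.minus_eq M.a_assoc M.r_neg)
  next
    have half: "q x \<subseteq> q y" if xy: "x \<in> carrier X" "y \<in> carrier X" and *: "x \<ominus> y \<in> L" for x y
    proof
      fix z assume "z \<in> q x"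
      then obtain l where l: "l \<in> L" "z = l \<oplus> x" using q by auto
      then have "z = (l \<oplus> (x \<ominus> y)) \<oplus> y"
        using xy car by (simp add: M.minus_eq M.a_assoc M.l_neg)
      then show "z \<in> q y" using Ladd[OF l(1) *] q by blast
    qed
    assume *: "x \<ominus> y \<in> L"
    then have "y \<ominus> x \<in> L"
      using Linv[OF *] xy by (simp add: M.minus_eq M.minus_add M.a_comm)
    with * show "q x = q y" using half xy by blast
  qed
  have qadd: "set_add X (q x) (q y) = q (x \<oplus> y)" if xy: "x \<in> carrier X" "y \<in> carrier X" for x y
  proof
    show "set_add X (q x) (q y) \<subseteq> q (x \<oplus> y)"
    proof
      fix z assume "z \<in> set_add X (q x) (q y)"
      then obtain l m where lm: "l \<in> L" "m \<in> L" "z = (l \<oplus> x) \<oplus> (m \<oplus> y)"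
        by (auto simp: set_add_def' q)
      then have "z = (l \<oplus> m) \<oplus> (x \<oplus> y)" using xy car by (simp add: M.a_ac)
      then show "z \<in> q (x \<oplus> y)" using Ladd lm q by blast
    qed
    show "q (x \<oplus> y) \<subseteq> set_add X (q x) (q y)"
    proof
      fix z assume "z \<in> q (x \<oplus> y)"
      then obtain l where l: "l \<in> L" "z = l \<oplus> (x \<oplus> y)" using q by auto
      then have "z = (l \<oplus> x) \<oplus> (\<zero> \<oplus> y)" using xy car by (simp add: M.a_ac)
      then show "z \<in> set_add X (q x) (q y)" using l L0 by (auto simp: set_add_def' q)
    qed
  qed
  have qsm: "(\<Union>s\<in>q x. q (c \<odot> s)) = q (c \<odot> x)" if c: "c \<in> K" and x: "x \<in> carrier X" for c x
  proof -
    have "q (c \<odot> s) = q (c \<odot> x)" if s: "s \<in> q x" for s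
    proof -
      obtain l where l: "l \<in> L" "s = l \<oplus> x" using s by (auto simp: q)
      have "c \<odot> s = c \<odot> l \<oplus> c \<odot> x"
        using l c x car smult_r_distr[of c l x] by (simp add: scalar_ring_def)
      then have "c \<odot> s \<ominus> c \<odot> x = c \<odot> l"
        using c x l car by (simp add: M.minus_eq M.a_assoc M.r_neg)
      then show ?thesis
        using qeq[of "c \<odot> s" "c \<odot> x"] c x l car Lsm by simp
    qed
    then have "(\<Union>s\<in>q x. q (c \<odot> s)) = (\<Union>s\<in>q x. q (c \<odot> x))"
      by (rule SUP_cong[OF refl])
    then show ?thesis using qself[OF x] by auto
  qed
  have Q: "carrier ?Q = q ` carrier X" "zero ?Q = L"
      "\<And>x y. \<lbrakk>x \<in> carrier X; y \<in> carrier X\<rbrakk> \<Longrightarrow> q x \<oplus>\<^bsub>?Q\<^esub> q y = q (x \<oplus> y)"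
      "\<And>c x. \<lbrakk>c \<in> K; x \<in> carrier X\<rbrakk> \<Longrightarrow> c \<odot>\<^bsub>?Q\<^esub> q x = q (c \<odot> x)"
      "\<And>x. nrm ?Q (q x) = Inf (nrm X ` q x)"
    using qsm qadd by (auto simp: quotient_normed_def A_RCOSETS_def' simp flip: q_def)
  have q0: "q \<zero> = L"
  proof -
    have "q \<zero> = (\<lambda>l. l) ` L" unfolding q using car by force
    then show ?thesis by simp
  qed
  have mod: "module (scalar_ring K) ?Q"
  proof (rule moduleI)
    show "cring (scalar_ring K)" by unfold_locales
    show "abelian_group ?Q"
    proof (rule abelian_groupI)
      show "zero ?Q \<in> carrier ?Q" using q0 by (auto simp: Q(1,2))
    next
      fix S assume "S \<in> carrier ?Q"
      then obtain x where x: "S = q x" "x \<in> carrier X" by (auto simp: Q(1))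
      show "zero ?Q \<oplus>\<^bsub>?Q\<^esub> S = S" using x Q(2) Q(3)[of \<zero> x] by (simp add: q0)
      show "\<exists>R\<in>carrier ?Q. R \<oplus>\<^bsub>?Q\<^esub> S = zero ?Q"
        using x Q(3)[of "\<ominus> x" x] by (auto simp: Q(1,2) q0 M.l_neg)
    qed (auto simp: Q(1,3) M.a_ac)
  qed (auto simp: Q(1,3,4) scalar_ring_def
        smult_l_distr[simplified scalar_ring_def, simplified]
        smult_r_distr[simplified scalar_ring_def, simplified]
        smult_assoc1[simplified scalar_ring_def, simplified]
        smult_one[simplified scalar_ring_def, simplified])
  have qcar: "z \<in> carrier X" if "z \<in> q x" "x \<in> carrier X" for z x
    using that car by (auto simp: q)
  have bdd: "bdd_below (nrm X ` q x)" if "x \<in> carrier X" for x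
    using qcar[OF _ that] by (auto intro!: bdd_belowI[of _ 0])
  have ne: "q x \<noteq> {}" if "x \<in> carrier X" for x using qself[OF that] by auto
  have Qnn: "0 \<le> nrm ?Q (q x)" if "x \<in> carrier X" for x
    using qcar[OF _ that] ne[OF that] by (auto simp: Q(5) intro!: cINF_greatest)
  have Qle: "nrm ?Q (q x) \<le> nrm X z" if "x \<in> carrier X" "z \<in> q x" for x z
    using bdd[OF that(1)] that(2) by (auto simp: Q(5) intro!: cINF_lower)
  have Qlt: "\<exists>z\<in>q x. nrm X z < nrm ?Q (q x) + e" if "x \<in> carrier X" "e > 0" for x e
  proof -
    have "Inf (nrm X ` q x) < nrm ?Q (q x) + e" using that by (simp add: Q(5))
    then show ?thesis using ne[OF that(1)] bdd[OF that(1)] by (auto simp: cInf_less_iff)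
  qed
  have sm_le: "nrm ?Q (q (c \<odot> x)) \<le> cmod c * nrm ?Q (q x)"
    if c: "c \<in> K" and x: "x \<in> carrier X" for c x
  proof (rule field_le_epsilon)
    fix e :: real assume "e > 0"
    define d where "d = e / (cmod c + 1)"
    have d: "d > 0" "cmod c * d \<le> e"
      using \<open>e > 0\<close> by (auto simp: d_def field_simps add_pos_nonneg)
    obtain z where z: "z \<in> q x" "nrm X z < nrm ?Q (q x) + d" using Qlt[OF x d(1)] by auto
    have zc: "z \<in> carrier X" using qcar z x by auto
    have "c \<odot> z \<in> q (c \<odot> x)"
    proof -
      have "q (c \<odot> z) = c \<odot>\<^bsub>?Q\<^esub> q z" using c zc by (simp add: Q(4))
      also have "q z = q x"
      proof -
        obtain l where "l \<in> L" "z = l \<oplus> x" using z q by auto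
        then have "z \<ominus> x \<in> L" using car x by (simp add: M.minus_eq M.a_assoc M.r_neg)
        then show ?thesis using qeq zc x by blast
      qed
      finally show ?thesis using c x qself[of "c \<odot> z"] zc by (simp add: Q(4))
    qed
    then have "nrm ?Q (q (c \<odot> x)) \<le> cmod c * nrm X z"
      using Qle[of "c \<odot> x" "c \<odot> z"] c x zc by (simp add: nrm_smult)
    also have "\<dots> \<le> cmod c * (nrm ?Q (q x) + d)"
      using z by (intro mult_left_mono) auto
    also have "\<dots> \<le> cmod c * nrm ?Q (q x) + e" using d by (simp add: distrib_left)
    finally show "nrm ?Q (q (c \<odot> x)) \<le> cmod c * nrm ?Q (q x) + e" .
  qed
  have qzero: "nrm ?Q L = 0"
    using Qle[of \<zero> \<zero>] Qnn[of \<zero>] qself[of \<zero>] by (simp add: q0)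
  have sm: "nrm ?Q (q (c \<odot> x)) = cmod c * nrm ?Q (q x)"
    if c: "c \<in> K" and x: "x \<in> carrier X" for c x
  proof (cases "c = 0")
    case True
    then have "c \<odot> x = \<zero>" using smult_l_null[of x] x by (simp add: scalar_ring_def)
    with True show ?thesis by (simp add: q0 qzero)
  next
    case False
    have ic: "inverse c \<in> K" using c scalar_closed(8)[of 1 c] by (simp add: inverse_eq_divide)
    have "inverse c \<odot> (c \<odot> x) = x"
      using smult_assoc1[of "inverse c" c x] smult_one[of x] ic c x False
      by (simp add: scalar_ring_def)
    then have "nrm ?Q (q x) \<le> cmod (inverse c) * nrm ?Q (q (c \<odot> x))"
      using sm_le[OF ic, of "c \<odot> x"] c x by simp
    then have "cmod c * nrm ?Q (q x) \<le> nrm ?Q (q (c \<odot> x))"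
      using False by (simp add: norm_inverse pos_le_divide_eq divide_inverse_commute[symmetric] mult.commute)
    with sm_le[OF c x] show ?thesis by simp
  qed
  have tri: "nrm ?Q (q (x \<oplus> y)) \<le> nrm ?Q (q x) + nrm ?Q (q y)"
    if xy: "x \<in> carrier X" "y \<in> carrier X" for x y
  proof (rule field_le_epsilon)
    fix e :: real assume "e > 0"
    then obtain z w where zw: "z \<in> q x" "nrm X z < nrm ?Q (q x) + e/2"
        "w \<in> q y" "nrm X w < nrm ?Q (q y) + e/2"
      using Qlt[OF xy(1), of "e/2"] Qlt[OF xy(2), of "e/2"] by auto
    have "z \<oplus> w \<in> q (x \<oplus> y)"
      using zw unfolding qadd[OF xy, symmetric] by (auto simp: set_add_def')
    then have "nrm ?Q (q (x \<oplus> y)) \<le> nrm X (z \<oplus> w)" using Qle xy by simp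
    also have "\<dots> \<le> nrm X z + nrm X w" using zw xy qcar by (intro nrm_triangle) auto
    finally show "nrm ?Q (q (x \<oplus> y)) \<le> nrm ?Q (q x) + nrm ?Q (q y) + e" using zw by simp
  qed
  have definite: "q x = L" if x: "x \<in> carrier X" and 0: "nrm ?Q (q x) = 0" for x
  proof (rule ccontr)
    interpret MS: Metric_space "mspace (nmetric X)" "mdist (nmetric X)"
      by (rule Metric_space_mspace_mdist)
    assume "q x \<noteq> L"
    moreover have "x \<ominus> \<zero> = x" using x M.minus_equality[of \<zero> \<zero>] by (simp add: M.minus_eq)
    ultimately have "x \<notin> L" using qeq[of x \<zero>] x by (simp add: q0)
    then obtain r where r: "r > 0" "disjnt L (MS.mball x r)"
      using cl x unfolding MS.closedin_metric mtopology_of_def by auto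
    obtain z where z: "z \<in> q x" "nrm X z < r" using Qlt[OF x r(1)] 0 by auto
    obtain l where l: "l \<in> L" "z = l \<oplus> x" using z q by auto
    have "\<ominus> l \<in> MS.mball x r"
    proof -
      have "x \<ominus> (\<ominus> l) = z" using l x car by (simp add: M.minus_eq M.a_comm)
      then show ?thesis unfolding MS.in_mball using z l x car by (simp add: mdist_nmetric)
    qed
    with r Linv[OF l(1)] show False by (auto simp: disjnt_def)
  qed
  interpret Q: module "scalar_ring K" ?Q by (rule mod)
  show ?thesis
  proof
    show "K = \<real> \<or> K = UNIV" by (rule scalars)
  next
    fix S assume "S \<in> carrier ?Q"
    then have "S \<in> q ` carrier X" by (simp only: Q(1))
    then obtain x where x: "S = q x" "x \<in> carrier X" by (rule imageE)
    have "nrm ?Q (q x) = 0 \<longleftrightarrow> q x = L"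
      using definite[OF x(2)] qzero by (intro iffI) simp_all
    then show "nrm ?Q S = 0 \<longleftrightarrow> S = \<zero>\<^bsub>?Q\<^esub>"
      by (simp only: x(1) Q(2))
    show "nrm ?Q (c \<odot>\<^bsub>?Q\<^esub> S) = cmod c * nrm ?Q S" if "c \<in> K" for c
      by (simp only: x(1) Q(4)[OF that x(2)] sm[OF that x(2)])
    fix R assume "R \<in> carrier ?Q"
    then have "R \<in> q ` carrier X" by (simp only: Q(1))
    then obtain y where y: "R = q y" "y \<in> carrier X" by (rule imageE)
    show "nrm ?Q (S \<oplus>\<^bsub>?Q\<^esub> R) \<le> nrm ?Q S + nrm ?Q R"
      unfolding x(1) y(1) Q(3)[OF x(2) y(2)] by (rule tri[OF x(2) y(2)])
  qed
qed


section \<open>Independence of the type underlying the Hilbert space\<close>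

context normed_space
begin

lemma
  assumes ip: "inner_product_on K X ip" and u: "u \<in> carrier X" and v: "v \<in> carrier X"
  shows ip_in: "ip u v \<in> K" and ip_commute: "ip v u = cnj (ip u v)"
    and ip_add_left: "w \<in> carrier X \<Longrightarrow> ip (u \<oplus> v) w = ip u w + ip v w"
    and ip_smult_left: "c \<in> K \<Longrightarrow> ip (c \<odot> u) v = c * ip u v"
    and ip_self: "ip u u = complex_of_real ((nrm X u)\<^sup>2)"
    and ip_minus_left: "w \<in> carrier X \<Longrightarrow> ip (u \<ominus> v) w = ip u w - ip v w"
proof -
  show "ip u v \<in> K" "ip v u = cnj (ip u v)" "ip u u = complex_of_real ((nrm X u)\<^sup>2)"
    using ip u v unfolding inner_product_on_def by blast+
  have add: "\<And>a b w. \<lbrakk>a \<in> carrier X; b \<in> carrier X; w \<in> carrier X\<rbrakk> \<Longrightarrow> ip (a \<oplus> b) w = ip a w + ip b w"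
    and sm: "\<And>c a w. \<lbrakk>c \<in> K; a \<in> carrier X; w \<in> carrier X\<rbrakk> \<Longrightarrow> ip (c \<odot> a) w = c * ip a w"
    using ip unfolding inner_product_on_def by blast+
  show "w \<in> carrier X \<Longrightarrow> ip (u \<oplus> v) w = ip u w + ip v w" using add u v .
  show "c \<in> K \<Longrightarrow> ip (c \<odot> u) v = c * ip u v" using sm u v by blast
  show "w \<in> carrier X \<Longrightarrow> ip (u \<ominus> v) w = ip u w - ip v w"
    using add[of u "\<ominus> v" w] sm[of "-1" v w] u v by (simp add: M.minus_eq minus_one_smult)
qed

lemma ip_zero_left:
  "\<lbrakk>inner_product_on K X ip; v \<in> carrier X\<rbrakk> \<Longrightarrow> ip \<zero> v = 0"
  using ip_add_left[of ip \<zero> \<zero> \<zero>] ip_add_left[of ip \<zero> \<zero> v] by simp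

lemma Cauchy_Schwarz:
  assumes ip: "inner_product_on K X ip" and u: "u \<in> carrier X" and v: "v \<in> carrier X"
  shows "cmod (ip u v) \<le> nrm X u * nrm X v"
proof (cases "nrm X v = 0")
  case True
  then have "v = \<zero>" using v by (simp add: nrm_eq_0_iff)
  then show ?thesis
    using ip_zero_left[OF ip u] ip_commute[OF ip v u] by simp
next
  case False
  define a where "a = ip u v"
  define c where "c = a / complex_of_real ((nrm X v)\<^sup>2)"
  define w where "w = u \<ominus> c \<odot> v"
  have a: "a \<in> K" using ip_in[OF ip u v] by (simp add: a_def)
  have c: "c \<in> K" using a unfolding c_def by (intro scalar_closed)
  have w: "w \<in> carrier X" using c u v by (simp add: w_def)
  have vw: "ip v w = 0"
  proof -
    have "ip w v = a - c * complex_of_real ((nrm X v)\<^sup>2)"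
      using c u v by (simp add: w_def ip_minus_left[OF ip] ip_smult_left[OF ip] ip_self[OF ip v v] a_def)
    also have "\<dots> = 0" using False by (simp add: c_def)
    finally show ?thesis using ip_commute[OF ip w v] by simp
  qed
  have "ip w w = ip u w"
    using c u v w vw ip_minus_left[OF ip u, of "c \<odot> v" w] by (simp add: ip_smult_left[OF ip] flip: w_def)
  also have "\<dots> = cnj (ip w u)" using ip_commute[OF ip w u] by simp
  also have "ip w u = complex_of_real ((nrm X u)\<^sup>2) - c * cnj a"
    using c u v ip_commute[OF ip u v]
    by (simp add: w_def ip_minus_left[OF ip] ip_smult_left[OF ip] ip_self[OF ip u u] a_def)
  also have "c * cnj a = complex_of_real ((cmod a)\<^sup>2 / (nrm X v)\<^sup>2)"
    by (simp add: c_def complex_norm_square[symmetric])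
  finally have "complex_of_real ((nrm X w)\<^sup>2) = complex_of_real ((nrm X u)\<^sup>2 - (cmod a)\<^sup>2 / (nrm X v)\<^sup>2)"
    using ip_self[OF ip w w] by simp
  then have "(nrm X w)\<^sup>2 = (nrm X u)\<^sup>2 - (cmod a)\<^sup>2 / (nrm X v)\<^sup>2"
    by (simp only: of_real_eq_iff)
  then have "(cmod a)\<^sup>2 / (nrm X v)\<^sup>2 \<le> (nrm X u)\<^sup>2"
    using zero_le_power2[of "nrm X w"] by linarith
  then have "(cmod a)\<^sup>2 \<le> (nrm X u * nrm X v)\<^sup>2"
    using False by (simp add: power_mult_distrib pos_divide_le_eq)
  then show ?thesis
    using u v by (simp add: a_def power2_le_iff_abs_le)
qed

end

lemma hilbert_factorization_transfer:
  fixes H :: "'h normed" and X :: "nat \<Rightarrow> 'a normed"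
  assumes F: "hilbert_factorization K n X Y T H M A B"
  obtains H' :: "((nat \<Rightarrow> 'a) \<Rightarrow> complex) normed" and M' A' B'
  where "hilbert_factorization K n X Y T H' M' A' B'"
    and "multilinear_norm n X H' A' = multilinear_norm n X H A"
    and "Lip (submetric (nmetric H') M') (nmetric Y) B' \<le> Lip (submetric (nmetric H) M) (nmetric Y) B"
proof -
  obtain ip where ns: "normed_space K H" and compl: "mcomplete_of (nmetric H)"
    and ip: "inner_product_on K H ip"
    using F unfolding hilbert_factorization_def hilbert_space_def banach_space_def by auto
  have MH: "M \<subseteq> carrier H" and AM: "A ` tuples n X \<subseteq> M" and Abm: "bounded_multilinear K n X H A"
    and BL: "Lipschitz_continuous_map (submetric (nmetric H) M) (nmetric Y) B"
    and TBA: "\<And>x. x \<in> tuples n X \<Longrightarrow> T x = B (A x)"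
    using F unfolding hilbert_factorization_def by auto
  interpret H: normed_space K H by (rule ns)
  note ipr = H.ip_add_left[OF ip] H.ip_smult_left[OF ip] H.ip_minus_left[OF ip] H.ip_zero_left[OF ip]
  have AH: "A x \<in> carrier H" if "x \<in> tuples n X" for x using that AM MH by auto
  \<comment> \<open>\<open>S\<close> is the closed linear span of the range of \<open>A\<close>; its elements are determined by their
    inner products with that range.\<close>
  define P where "P = {z \<in> carrier H. \<forall>x\<in>tuples n X. ip z (A x) = 0}"
  define S where "S = {h \<in> carrier H. \<forall>z\<in>P. ip h z = 0}"
  have PH: "z \<in> carrier H" if "z \<in> P" for z using that by (auto simp: P_def)
  have SH: "h \<in> carrier H" if "h \<in> S" for h using that by (auto simp: S_def)
  have SA: "A x \<in> S" if "x \<in> tuples n X" for x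
    using that AH[OF that] H.ip_commute[OF ip _ AH[OF that]] by (auto simp: S_def P_def)
  have Sadd: "u \<oplus>\<^bsub>H\<^esub> v \<in> S" and Sminus: "u \<ominus>\<^bsub>H\<^esub> v \<in> S" if "u \<in> S" "v \<in> S" for u v
    using that by (auto simp: S_def PH ipr)
  have Ssm: "c \<odot>\<^bsub>H\<^esub> u \<in> S" if "c \<in> K" "u \<in> S" for c u
    using that by (auto simp: S_def PH ipr)
  have S0: "\<zero>\<^bsub>H\<^esub> \<in> S" by (auto simp: S_def PH ipr)
  define \<phi> where "\<phi> h = (\<lambda>x. if x \<in> tuples n X then ip h (A x) else 0)" for h
  have \<phi>add: "\<phi> (u \<oplus>\<^bsub>H\<^esub> v) = (\<lambda>x. \<phi> u x + \<phi> v x)" if "u \<in> S" "v \<in> S" for u v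
    using that by (auto simp: \<phi>_def fun_eq_iff SH AH ipr)
  have \<phi>minus: "\<phi> (u \<ominus>\<^bsub>H\<^esub> v) = (\<lambda>x. \<phi> u x - \<phi> v x)" if "u \<in> S" "v \<in> S" for u v
    using that by (auto simp: \<phi>_def fun_eq_iff SH AH ipr)
  have \<phi>sm: "\<phi> (c \<odot>\<^bsub>H\<^esub> u) = (\<lambda>x. c * \<phi> u x)" if "c \<in> K" "u \<in> S" for c u
    using that by (auto simp: \<phi>_def fun_eq_iff SH AH ipr)
  have \<phi>0: "\<phi> \<zero>\<^bsub>H\<^esub> = (\<lambda>x. 0)" by (auto simp: \<phi>_def fun_eq_iff AH ipr)
  have \<phi>ker: "u = \<zero>\<^bsub>H\<^esub>" if u: "u \<in> S" and 0: "\<phi> u = (\<lambda>x. 0)" for u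
  proof -
    have "ip u (A x) = 0" if "x \<in> tuples n X" for x using fun_cong[OF 0, of x] that by (simp add: \<phi>_def)
    then have "u \<in> P" using SH[OF u] by (simp add: P_def)
    then have "ip u u = 0" using u by (auto simp: S_def)
    then show ?thesis using H.ip_self[OF ip SH[OF u] SH[OF u]] SH[OF u] by (simp add: H.nrm_eq_0_iff)
  qed
  have inj: "inj_on \<phi> S"
  proof (rule inj_onI)
    fix u v assume uv: "u \<in> S" "v \<in> S" "\<phi> u = \<phi> v"
    then have "u \<ominus>\<^bsub>H\<^esub> v = \<zero>\<^bsub>H\<^esub>" by (intro \<phi>ker Sminus) (simp_all add: \<phi>minus)
    then show "u = v" using uv by (simp add: H.minus_eq_0_iff SH)
  qed
  define \<psi> where "\<psi> = inv_into S \<phi>"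
  have \<psi>\<phi>[simp]: "\<psi> (\<phi> u) = u" if "u \<in> S" for u
    using that inj by (simp add: \<psi>_def)
  define H' :: "((nat \<Rightarrow> 'a) \<Rightarrow> complex) normed" where
    "H' = \<lparr>carrier = \<phi> ` S, mult = undefined, one = undefined, zero = (\<lambda>x. 0),
           add = (\<lambda>f g x. f x + g x), smult = (\<lambda>c f x. c * f x), nrm = (\<lambda>f. nrm H (\<psi> f))\<rparr>"
  have car': "carrier H' = \<phi> ` S" and zero': "\<zero>\<^bsub>H'\<^esub> = \<phi> \<zero>\<^bsub>H\<^esub>"
    and add': "\<And>u v. \<lbrakk>u \<in> S; v \<in> S\<rbrakk> \<Longrightarrow> \<phi> u \<oplus>\<^bsub>H'\<^esub> \<phi> v = \<phi> (u \<oplus>\<^bsub>H\<^esub> v)"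
    and sm': "\<And>c u. \<lbrakk>c \<in> K; u \<in> S\<rbrakk> \<Longrightarrow> c \<odot>\<^bsub>H'\<^esub> \<phi> u = \<phi> (c \<odot>\<^bsub>H\<^esub> u)"
    and nrm': "\<And>u. u \<in> S \<Longrightarrow> nrm H' (\<phi> u) = nrm H u"
    by (auto simp: H'_def \<phi>add \<phi>sm \<phi>0)
  have mod: "module (scalar_ring K) H'"
  proof (rule moduleI)
    show "cring (scalar_ring K)" by unfold_locales
    show "abelian_group H'"
    proof (rule abelian_groupI)
      fix f assume "f \<in> carrier H'"
      then obtain u where u: "f = \<phi> u" "u \<in> S" by (auto simp: car')
      show "\<exists>g\<in>carrier H'. g \<oplus>\<^bsub>H'\<^esub> f = \<zero>\<^bsub>H'\<^esub>"
        using u Ssm[of "-1" u] add'[of "(-1) \<odot>\<^bsub>H\<^esub> u" u] SH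
        by (intro bexI[of _ "\<phi> ((-1) \<odot>\<^bsub>H\<^esub> u)"])
           (auto simp: car' zero' H.minus_one_smult H.M.l_neg)
    qed (auto simp: car' zero' add' Sadd S0 SH H.M.a_ac)
  qed (auto simp: car' add' sm' Sadd Ssm SH scalar_ring_def
        H.smult_l_distr[simplified scalar_ring_def, simplified]
        H.smult_r_distr[simplified scalar_ring_def, simplified]
        H.smult_assoc1[simplified scalar_ring_def, simplified]
        H.smult_one[simplified scalar_ring_def, simplified])
  interpret H'm: module "scalar_ring K" H' by (rule mod)
  interpret H': normed_space K H'
  proof
    show "K = \<real> \<or> K = UNIV" by (rule H.scalars)
    show "nrm H' f = 0 \<longleftrightarrow> f = \<zero>\<^bsub>H'\<^esub>" if f: "f \<in> carrier H'" for f
    proof -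
      obtain u where u: "f = \<phi> u" "u \<in> S" using f by (auto simp: car')
      show ?thesis
        using u inj_on_eq_iff[OF inj u(2) S0] by (simp add: nrm' zero' H.nrm_eq_0_iff SH)
    qed
  qed (auto simp: car' add' sm' nrm' Sadd Ssm SH H.nrm_smult H.nrm_triangle)
  have minus': "\<phi> u \<ominus>\<^bsub>H'\<^esub> \<phi> v = \<phi> (u \<ominus>\<^bsub>H\<^esub> v)" if "u \<in> S" "v \<in> S" for u v
  proof -
    have "\<ominus>\<^bsub>H'\<^esub> \<phi> v = \<phi> ((-1) \<odot>\<^bsub>H\<^esub> v)"
      using that H'.minus_one_smult[of "\<phi> v"] by (simp add: car' sm')
    then show ?thesis
      using that by (simp add: H'm.M.minus_eq H.M.minus_eq add' Ssm H.minus_one_smult[symmetric] SH)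
  qed
  have dist': "mdist (nmetric H') (\<phi> u) (\<phi> v) = mdist (nmetric H) u v" if "u \<in> S" "v \<in> S" for u v
    using that by (simp add: H'.mdist_nmetric H.mdist_nmetric car' SH minus' nrm' Sminus)
  have compl': "mcomplete_of (nmetric H')"

  proof (rule iffD2[OF H'.mcomplete_nmetric_iff], intro allI impI)
    fix \<sigma> :: "nat \<Rightarrow> (nat \<Rightarrow> 'a) \<Rightarrow> complex"
    assume ran: "range \<sigma> \<subseteq> carrier H'"
      and cau: "\<forall>e>0. \<exists>N. \<forall>k\<ge>N. \<forall>l\<ge>N. nrm H' (\<sigma> k \<ominus>\<^bsub>H'\<^esub> \<sigma> l) < e"
    have "\<exists>u. u \<in> S \<and> \<sigma> k = \<phi> u" for k using ran by (auto simp: car')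
    then obtain \<tau> where \<tau>: "\<And>k. \<tau> k \<in> S" "\<And>k. \<sigma> k = \<phi> (\<tau> k)" by metis
    have "\<forall>e>0. \<exists>N. \<forall>k\<ge>N. \<forall>l\<ge>N. nrm H (\<tau> k \<ominus>\<^bsub>H\<^esub> \<tau> l) < e"
      using cau by (simp add: \<tau> minus' nrm' Sminus)
    moreover have "range \<tau> \<subseteq> carrier H" using \<tau> SH by auto
    ultimately have "\<exists>h\<in>carrier H. \<forall>e>0. \<exists>N. \<forall>k\<ge>N. nrm H (\<tau> k \<ominus>\<^bsub>H\<^esub> h) < e"
      using iffD1[OF H.mcomplete_nmetric_iff compl, THEN spec, of \<tau>] by simp
    then obtain h where h: "h \<in> carrier H"
      and lim: "\<And>e. e > 0 \<Longrightarrow> \<exists>N. \<forall>k\<ge>N. nrm H (\<tau> k \<ominus>\<^bsub>H\<^esub> h) < e"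
      by auto
    have "h \<in> S"
    proof -
      have "ip h z = 0" if z: "z \<in> P" for z
      proof (rule ccontr)
        assume n0: "ip h z \<noteq> 0"
        define e where "e = cmod (ip h z) / (nrm H z + 1)"
        have zn: "nrm H z + 1 > 0" using PH[OF z] by (simp add: add_nonneg_pos)
        have "e > 0" using n0 zn by (simp add: e_def)
        then obtain k where k: "nrm H (\<tau> k \<ominus>\<^bsub>H\<^esub> h) < e" using lim by blast
        have "ip (\<tau> k \<ominus>\<^bsub>H\<^esub> h) z = - ip h z"
          using \<tau>(1)[of k] z h PH[OF z] SH[OF \<tau>(1)] by (simp add: ipr) (simp add: S_def)
        then have "cmod (ip h z) \<le> nrm H (\<tau> k \<ominus>\<^bsub>H\<^esub> h) * nrm H z"
          using H.Cauchy_Schwarz[OF ip, of "\<tau> k \<ominus>\<^bsub>H\<^esub> h" z] h PH[OF z] SH[OF \<tau>(1)] by simp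
        also have "\<dots> \<le> e * nrm H z" using k PH[OF z] by (intro mult_right_mono) auto
        also have "\<dots> < e * (nrm H z + 1)" using \<open>e > 0\<close> by simp
        also have "\<dots> = cmod (ip h z)" using zn by (simp add: e_def)
        finally show False by simp
      qed
      then show ?thesis using h by (simp add: S_def)
    qed
    then show "\<exists>f\<in>carrier H'. \<forall>e>0. \<exists>N. \<forall>k\<ge>N. nrm H' (\<sigma> k \<ominus>\<^bsub>H'\<^esub> f) < e"
      using lim by (intro bexI[of _ "\<phi> h"]) (auto simp: car' \<tau> minus' nrm' Sminus)
  qed
  have ip': "inner_product_on K H' (\<lambda>f g. ip (\<psi> f) (\<psi> g))"
    unfolding inner_product_on_def
  proof (intro conjI ballI)
    fix f g assume "f \<in> carrier H'" "g \<in> carrier H'"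
    then obtain u v where "f = \<phi> u" "u \<in> S" "g = \<phi> v" "v \<in> S" by (auto simp: car')
    then show "ip (\<psi> f) (\<psi> g) \<in> K" "ip (\<psi> g) (\<psi> f) = cnj (ip (\<psi> f) (\<psi> g))"
      using H.ip_in[OF ip, of u v] H.ip_commute[OF ip, of u v] SH by simp_all
  next
    fix f assume "f \<in> carrier H'"
    then obtain u where u: "f = \<phi> u" "u \<in> S" by (auto simp: car')
    then show "ip (\<psi> f) (\<psi> f) = complex_of_real ((nrm H' f)\<^sup>2)"
      using H.ip_self[OF ip SH[OF u(2)] SH[OF u(2)]] by (simp add: nrm')
  qed (auto simp: car' add' sm' Sadd Ssm SH ipr)
  have hil': "hilbert_space K H'"
    unfolding hilbert_space_def banach_space_def using compl' ip' H'.normed_space_axioms by blast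
  define M' where "M' = \<phi> ` (M \<inter> S)"
  define A' where "A' = \<phi> \<circ> A"
  define B' where "B' = B \<circ> \<psi>"
  have uv: "unit_values n X H' A' = unit_values n X H A"
    unfolding unit_values_def A'_def using nrm' SA by (auto; metis)
  have upd: "x(i := u) \<in> tuples n X" if "x \<in> tuples n X" "i \<in> {1..n}" "u \<in> carrier (X i)" for x i u
    using that unfolding tuples_def by (auto simp: PiE_iff extensional_def)
  have ml: "multilinear K n X H A" and bd: "bdd_above (unit_values n X H A)"
    using Abm by (auto simp: bounded_multilinear_def)
  have ml1: "A (x(i := u \<oplus>\<^bsub>X i\<^esub> v)) = A (x(i := u)) \<oplus>\<^bsub>H\<^esub> A (x(i := v))"
    if "x \<in> tuples n X" "i \<in> {1..n}" "u \<in> carrier (X i)" "v \<in> carrier (X i)" for x i u v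
    using ml that unfolding multilinear_def by blast
  have ml2: "A (x(i := c \<odot>\<^bsub>X i\<^esub> u)) = c \<odot>\<^bsub>H\<^esub> A (x(i := u))"
    if "x \<in> tuples n X" "i \<in> {1..n}" "c \<in> K" "u \<in> carrier (X i)" for x i u c
    using ml that unfolding multilinear_def by blast
  have "multilinear K n X H' A'"
    unfolding multilinear_def A'_def by (simp add: car' add' sm' upd SA ml1 ml2)
  then have Abm': "bounded_multilinear K n X H' A'"
    using bd by (simp add: bounded_multilinear_def uv)
  have ms: "mspace (submetric (nmetric H') M') = M'" "mspace (submetric (nmetric H) M) = M"
    using MH by (auto simp: M'_def car')
  have Lip_iff: "(\<forall>f\<in>M'. \<forall>g\<in>M'. mdist (nmetric Y) (B' f) (B' g) \<le> c * mdist (nmetric H') f g) \<longleftrightarrow>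
      (\<forall>u\<in>M \<inter> S. \<forall>v\<in>M \<inter> S. mdist (nmetric Y) (B u) (B v) \<le> c * mdist (nmetric H) u v)" for c
    by (simp add: M'_def B'_def dist')
  obtain C where C: "C > 0"
      "\<And>u v. \<lbrakk>u \<in> M; v \<in> M\<rbrakk> \<Longrightarrow> mdist (nmetric Y) (B u) (B v) \<le> C * mdist (nmetric H) u v"
    using BL unfolding Lipschitz_continuous_map_pos ms by auto
  have BY: "B \<in> M \<rightarrow> mspace (nmetric Y)"
    using BL unfolding Lipschitz_continuous_map_def ms by auto
  have BL': "Lipschitz_continuous_map (submetric (nmetric H') M') (nmetric Y) B'"
  proof -
    have "B' \<in> M' \<rightarrow> mspace (nmetric Y)" using BY by (auto simp: M'_def B'_def)
    moreover have "\<forall>f\<in>M'. \<forall>g\<in>M'. mdist (nmetric Y) (B' f) (B' g) \<le> C * mdist (nmetric H') f g"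
      unfolding Lip_iff using C by auto
    ultimately show ?thesis
      unfolding Lipschitz_continuous_map_def ms mdist_submetric by blast
  qed
  have "hilbert_factorization K n X Y T H' M' A' B'"
    unfolding hilbert_factorization_def
    using hil' Abm' BL' AM SA by (auto simp: car' M'_def A'_def B'_def TBA)
  moreover have "multilinear_norm n X H' A' = multilinear_norm n X H A"
    by (simp add: multilinear_norm_def uv)
  moreover have "Lip (submetric (nmetric H') M') (nmetric Y) B' \<le> Lip (submetric (nmetric H) M) (nmetric Y) B"
    unfolding Lip_def ms mdist_submetric Lip_iff
  proof (rule cInf_superset_mono)
    show "{c. 0 \<le> c \<and> (\<forall>x\<in>M. \<forall>y\<in>M. mdist (nmetric Y) (B x) (B y) \<le> c * mdist (nmetric H) x y)} \<noteq> {}"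
      using C by (auto intro!: exI[of _ C])
  qed (auto intro!: bdd_belowI[of _ 0])
  ultimately show thesis by (rule that)
qed

lemma factors_through_hilbertI:
  assumes "hilbert_factorization K n X Y T H M A B"
  shows "factors_through_hilbert K n X Y T"
proof -
  obtain H' :: "((nat \<Rightarrow> 'a) \<Rightarrow> complex) normed" and M' A' B'
    where "hilbert_factorization K n X Y T H' M' A' B'"
    using hilbert_factorization_transfer[OF assms] .
  then show ?thesis unfolding factors_through_hilbert_def by (intro exI)
qed

lemma hilbert_gamma_le:
  assumes F: "hilbert_factorization K n X Y T H M A B"
  shows "hilbert_gamma K n X Y T
    \<le> ennreal (multilinear_norm n X H A * Lip (submetric (nmetric H) M) (nmetric Y) B)"
proof -
  obtain H' :: "((nat \<Rightarrow> 'a) \<Rightarrow> complex) normed" and M' A' B'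
    where F': "hilbert_factorization K n X Y T H' M' A' B'"
      and N: "multilinear_norm n X H' A' = multilinear_norm n X H A"
      and L: "Lip (submetric (nmetric H') M') (nmetric Y) B' \<le> Lip (submetric (nmetric H) M) (nmetric Y) B"
    using hilbert_factorization_transfer[OF F] .
  have "Lipschitz_continuous_map (submetric (nmetric H') M') (nmetric Y) B'"
    using F' by (simp add: hilbert_factorization_def)
  then have L0: "0 \<le> Lip (submetric (nmetric H') M') (nmetric Y) B'"
    unfolding Lipschitz_continuous_map_pos Lip_def
    by (intro cInf_greatest) (auto intro: less_imp_le)
  have "hilbert_gamma K n X Y T
    \<le> ennreal (multilinear_norm n X H' A' * Lip (submetric (nmetric H') M') (nmetric Y) B')"
    unfolding hilbert_gamma_def using F' by (intro Inf_lower) blast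
  also have "\<dots> \<le> ennreal (multilinear_norm n X H A * Lip (submetric (nmetric H) M) (nmetric Y) B)"
  proof (cases "multilinear_norm n X H A \<ge> 0")
    case True
    then show ?thesis unfolding N by (intro ennreal_leI mult_left_mono L)
  next
    case False
    then show ?thesis using L0 L by (simp add: N ennreal_neg mult_nonpos_nonneg)
  qed
  finally show ?thesis .
qed

end

theory Submission
  imports Defs
begin

text \<open>
  Restricting \<open>A\<close> and composing \<open>B\<close> with \<open>Q\<^sub>L\<close> shows that compressions do not increase \<open>\<Gamma>\<close>.
  Conversely, for a finite set \<open>F\<close> of tuples let \<open>E\<^sub>i\<close> be the span of the \<open>i\<close>-th components and let \<open>L\<close>
  be an intersection of kernels of norming functionals, so that \<open>Q\<^sub>L\<close> preserves the norm of
  \<open>T x - T y\<close> for \<open>x, y \<in> F\<close>.  Factor this compression through \<open>H\<^sub>F\<^sub>,\<^sub>m\<close> with constant at most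
  \<open>s + 1/(m+1)\<close> and an operator \<open>A\<^sub>F\<^sub>,\<^sub>m\<close> of norm at most one.  Along an ultrafilter refining
  \<open>F \<up>\<close>, \<open>m \<rightarrow> \<infinity>\<close>, the \<open>A\<^sub>F\<^sub>,\<^sub>m\<close> define a multilinear operator \<open>A\<close> of norm at most one into the
  ultraproduct of the \<open>H\<^sub>F\<^sub>,\<^sub>m\<close>, and in the limit \<open>\<parallel>T x - T y\<parallel> \<le> s \<parallel>A x - A y\<parallel>\<close>: thus \<open>T x\<close> is a
  function of \<open>A x\<close> with Lipschitz constant at most \<open>s\<close>.
\<close>


section \<open>Ultrafilters\<close>

text \<open>The local Hilbert spaces are unrelated, and a weak limit of the vectors
  \<open>A_j x\<close> could lose length; an ultraproduct keeps every distance as the limit of the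
  local distances. Three features of the local data shape it. An operator with index
  \<open>(F, m)\<close> lives only on the spans generated by \<open>F\<close>, so for given tuples
  its additivity and homogeneity become available only from some \<open>F\<close> on; therefore
  identities in the ultraproduct have to be usable when they hold for almost all indices. A bound on
  the infimum \<Gamma> gives actual factorizations only for strictly larger constants, whence the
  slack 1/(m+1); the same \<open>m\<close>, tending to infinity along the ultrafilter, also supplies
  the diagonal argument for completeness. Finally, a bound on the product of norm and Lipschitz
  constant controls neither factor alone; moving the norm of \<open>A\<close> into the Lipschitz
  constant makes the values at a fixed tuple a bounded family. The local Lipschitz maps are never
  combined: only their inequalities on \<open>F\<close> pass to the limit.\<close>

definition ultrafilter :: "'a filter \<Rightarrow> bool" where
  "ultrafilter U \<longleftrightarrow> U \<noteq> bot \<and> (\<forall>P. eventually P U \<or> eventually (\<lambda>x. \<not> P x) U)"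

text \<open>Zorn's lemma is applied to the proper filters below \<open>F\<close>, finer filters
  counting as larger. A finest proper filter decides every predicate, since it has no proper
  refinement.\<close>

lemma ultrafilter_exists:
  fixes F :: "'a filter"
  assumes "F \<noteq> bot"
  obtains U where "U \<le> F" and "ultrafilter U"
proof -
  let ?A = "{G. G \<le> F \<and> G \<noteq> bot}"
  let ?P = "\<lambda>G G'. G' \<le> (G :: 'a filter)"
  have "\<exists>m\<in>?A. \<forall>a\<in>?A. ?P m a \<longrightarrow> a = m"
  proof (rule predicate_Zorn)
    show "partial_order_on ?A (relation_of ?P ?A)"
      by (rule partial_order_on_relation_ofI) auto
    fix C assume C: "C \<in> Chains (relation_of ?P ?A)"
    show "\<exists>u\<in>?A. \<forall>a\<in>C. ?P a u"
    proof (cases "C = {}")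
      case True
      then show ?thesis using assms by auto
    next
      case False
      have CA: "C \<subseteq> ?A" and lin: "\<And>G G'. G \<in> C \<Longrightarrow> G' \<in> C \<Longrightarrow> G \<le> G' \<or> G' \<le> G"
        using C by (auto simp: Chains_def relation_of_def)
      \<comment> \<open>A chain is directed downwards, so what holds eventually for its infimum
        already does so for one member; in particular \<open>False\<close> does not.\<close>
      have ev: "eventually P (Inf C) \<longleftrightarrow> (\<exists>b\<in>C. eventually P b)" for P
      proof (rule eventually_Inf_base[OF False])
        show "\<exists>x\<in>C. x \<le> inf G G'" if "G \<in> C" "G' \<in> C" for G G'
          using lin[OF that] that by (metis inf.absorb1 inf.absorb2 order_refl)
      qed
      have "Inf C \<noteq> bot"
        using CA by (auto simp: trivial_limit_def ev)
      moreover have "Inf C \<le> F" using False CA by (auto intro: Inf_lower2)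
      ultimately show ?thesis by (auto intro: Inf_lower)
    qed
  qed
  then obtain U where U: "U \<le> F" "U \<noteq> bot" and min: "\<And>G. G \<le> U \<Longrightarrow> G \<noteq> bot \<Longrightarrow> G = U"
    by (auto dest: order_trans)
  have "eventually P U \<or> eventually (\<lambda>x. \<not> P x) U" for P
  \<comment> \<open>Refining \<open>U\<close> by the set where \<open>P\<close> holds is trivial
    only if \<open>P\<close> eventually fails; otherwise minimality makes the refinement equal to
    \<open>U\<close>.\<close>
  proof (cases "inf U (principal {x. P x}) = bot")
    case True
    then show ?thesis by (simp add: trivial_limit_def eventually_inf_principal)
  next
    case False
    then have "inf U (principal {x. P x}) = U" by (intro min) auto
    moreover have "eventually P (inf U (principal {x. P x}))"
      by (simp add: eventually_inf_principal)
    ultimately show ?thesis by simp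
  qed
  with U show thesis by (intro that) (auto simp: ultrafilter_def)
qed

text \<open>Compactness gives a cluster point of the image filter. A neighbourhood that does not
  eventually contain \<open>f\<close> is, for an ultrafilter, eventually avoided, which no
  neighbourhood of a cluster point is.\<close>

lemma ultrafilter_tendsto:
  fixes f :: "'a \<Rightarrow> 'b :: topological_space"
  assumes U: "ultrafilter U" and C: "compact C" and f: "eventually (\<lambda>x. f x \<in> C) U"
  obtains l where "l \<in> C" and "(f \<longlongrightarrow> l) U"
proof -
  have "filtermap f U \<noteq> bot" using U by (simp add: ultrafilter_def filtermap_bot_iff)
  moreover have "eventually (\<lambda>y. y \<in> C) (filtermap f U)" using f by (simp add: eventually_filtermap)
  ultimately obtain l where l: "l \<in> C" "inf (nhds l) (filtermap f U) \<noteq> bot"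
    using C unfolding compact_filter by blast
  have "(f \<longlongrightarrow> l) U"
  proof (rule topological_tendstoI, rule ccontr)
    fix S assume S: "open S" "l \<in> S" and "\<not> (\<forall>\<^sub>F x in U. f x \<in> S)"
    then have "\<forall>\<^sub>F x in U. f x \<notin> S" using U by (auto simp: ultrafilter_def)
    then have "eventually (\<lambda>y. y \<notin> S) (filtermap f U)" by (simp add: eventually_filtermap)
    moreover have "eventually (\<lambda>y. y \<in> S) (nhds l)" using S by (auto simp: eventually_nhds)
    ultimately have "eventually (\<lambda>y. False) (inf (nhds l) (filtermap f U))"
      unfolding eventually_inf by blast
    with l(2) show False by (simp add: trivial_limit_def)
  qed
  with l(1) show thesis by (rule that)
qed


section \<open>Norming functionals\<close>

context normed_space
begin

section \<open>Scalar arithmetic and sublinear functions\<close>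

lemma scale_simps:
  "\<lbrakk>c \<in> K; x \<in> carrier X; y \<in> carrier X\<rbrakk> \<Longrightarrow> c \<odot> (x \<oplus> y) = c \<odot> x \<oplus> c \<odot> y"
  "\<lbrakk>a \<in> K; b \<in> K; x \<in> carrier X\<rbrakk> \<Longrightarrow> (a + b) \<odot> x = a \<odot> x \<oplus> b \<odot> x"
  "\<lbrakk>a \<in> K; b \<in> K; x \<in> carrier X\<rbrakk> \<Longrightarrow> a \<odot> (b \<odot> x) = (a * b) \<odot> x"
  "x \<in> carrier X \<Longrightarrow> 1 \<odot> x = x"
  "x \<in> carrier X \<Longrightarrow> 0 \<odot> x = \<zero>"
  "c \<in> K \<Longrightarrow> c \<odot> \<zero> = \<zero>"
  using smult_r_distr[of c x y] smult_l_distr[of a b x] smult_assoc1[of a b x] smult_one[of x]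
    smult_l_null[of x] smult_r_null[of c]
  by (simp_all add: scalar_ring_def)

text \<open>Positive homogeneity is asked for as an inequality, a form that passes easily to infima;
  applying it to \<open>inverse r\<close> recovers equality.\<close>

definition sublinear :: "('a \<Rightarrow> real) \<Rightarrow> bool" where
  "sublinear p \<longleftrightarrow>
     (\<forall>u\<in>carrier X. \<forall>v\<in>carrier X. p (u \<oplus> v) \<le> p u + p v) \<and>
     (\<forall>r>0. \<forall>u\<in>carrier X. p (complex_of_real r \<odot> u) \<le> r * p u)"

lemma sublinear_zero:
  assumes "sublinear p" shows "p \<zero> = 0"
proof -
  have "p (\<zero> \<oplus> \<zero>) \<le> p \<zero> + p \<zero>"
    using assms M.zero_closed unfolding sublinear_def by blast
  \<comment> \<open>Halving fixes \<zero>, so \<open>p \<zero>\<close> is at most half of itself and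
    hence at most 0; subadditivity gives the other sign.\<close>
  moreover have "p (complex_of_real (1/2) \<odot> \<zero>) \<le> 1/2 * p \<zero>"
    using assms M.zero_closed unfolding sublinear_def by (metis half_gt_zero zero_less_one)
  moreover have "complex_of_real (1/2) \<odot> \<zero> = \<zero>" by (intro scale_simps scalar_closed)
  ultimately show ?thesis by simp
qed

lemma sublinear_neg:
  assumes p: "sublinear p" and x: "x \<in> carrier X"
  shows "- p (\<ominus> x) \<le> p x"
proof -
  have "p (x \<oplus> \<ominus> x) \<le> p x + p (\<ominus> x)" using p x unfolding sublinear_def by blast
  then show ?thesis using sublinear_zero[OF p] x by (simp add: M.r_neg)
qed

lemma sublinear_scale:
  assumes p: "sublinear p" and x: "x \<in> carrier X" and r: "r \<ge> 0"
  shows "p (complex_of_real r \<odot> x) = r * p x"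
proof (cases "r = 0")
  case True
  then show ?thesis using sublinear_zero[OF p] x by (simp add: scale_simps)
next
  case False
  then have r: "r > 0" "inverse r > 0" using r by auto
  have hom: "p (complex_of_real r \<odot> x) \<le> r * p x" if "r > 0" "x \<in> carrier X" for r x
    using p that unfolding sublinear_def by blast
  have "p (complex_of_real (inverse r) \<odot> (complex_of_real r \<odot> x))
      \<le> inverse r * p (complex_of_real r \<odot> x)"
    using r x by (intro hom) auto
  also have "complex_of_real (inverse r) \<odot> (complex_of_real r \<odot> x) = x"
    using r x False scale_simps(3)[of "complex_of_real (inverse r)" "complex_of_real r" x]
    by (simp add: scale_simps(4) del: of_real_inverse flip: of_real_mult)
  finally have "r * p x \<le> p (complex_of_real r \<odot> x)"
    using r by (simp add: field_simps)
  with hom[OF r(1) x] show ?thesis by simp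
qed

lemma sublinear_nrm: "sublinear (nrm X)"
  unfolding sublinear_def by (simp add: nrm_triangle nrm_smult)

text \<open>
  Lowering a sublinear function \<open>p\<close> along the ray through \<open>z\<close> makes it additive in the
  direction \<open>z\<close>; hence a minimal sublinear function is linear.
\<close>

definition lower_along :: "('a \<Rightarrow> real) \<Rightarrow> 'a \<Rightarrow> 'a \<Rightarrow> real" where
  "lower_along p z x = (if x \<in> carrier X then
     INF t\<in>{0..}. p (x \<oplus> complex_of_real t \<odot> z) - t * p z else 0)"

text \<open>The infimum is finite: t * p z = p (t z) \<le> p (-x) + p (x + t z) bounds it below by -
  p (-x). Sublinearity comes from the rays: points with parameters s and t on the rays of x and y
  add up to the point with parameter s + t on the ray of x + y, and scaling by r takes t to r *
  t.\<close>

lemma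
  assumes p: "sublinear p" and z: "z \<in> carrier X"
  shows lower_along_le:
      "\<lbrakk>x \<in> carrier X; t \<ge> 0\<rbrakk> \<Longrightarrow> lower_along p z x \<le> p (x \<oplus> complex_of_real t \<odot> z) - t * p z"
    and lower_along_le_self: "x \<in> carrier X \<Longrightarrow> lower_along p z x \<le> p x"
    and sublinear_lower_along: "sublinear (lower_along p z)"
proof -
  have sub: "p (x \<oplus> y) \<le> p x + p y" if "x \<in> carrier X" "y \<in> carrier X" for x y
    using p that unfolding sublinear_def by blast
  define g where "g t x = p (x \<oplus> complex_of_real t \<odot> z) - t * p z" for t x
  have bdd: "bdd_below ((\<lambda>t. g t x) ` {0..})" if x: "x \<in> carrier X" for x
  proof (rule bdd_belowI2)
    fix t :: real assume "t \<in> {0..}"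
    then have "t * p z = p (complex_of_real t \<odot> z)" using z p by (simp add: sublinear_scale)
    also have "\<dots> = p (\<ominus> x \<oplus> (x \<oplus> complex_of_real t \<odot> z))"
      using x z by (simp add: M.r_neg1)
    also have "\<dots> \<le> p (\<ominus> x) + p (x \<oplus> complex_of_real t \<odot> z)"
      using x z by (intro sub) auto
    finally show "- p (\<ominus> x) \<le> g t x" by (simp add: g_def)
  qed
  have L: "lower_along p z x = (INF t\<in>{0..}. g t x)" if "x \<in> carrier X" for x
    using that by (simp add: lower_along_def g_def)
  have le: "lower_along p z x \<le> g t x" if "x \<in> carrier X" "t \<ge> 0" for x t
    unfolding L[OF that(1)] using that by (intro cINF_lower bdd) auto
  then show "\<lbrakk>x \<in> carrier X; t \<ge> 0\<rbrakk> \<Longrightarrow> lower_along p z x \<le> p (x \<oplus> complex_of_real t \<odot> z) - t * p z"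
    for x t by (simp add: g_def)
  show "lower_along p z x \<le> p x" if "x \<in> carrier X" for x
    using le[OF that, of 0] that z by (simp add: g_def scale_simps)
  have geI: "c \<le> lower_along p z x" if "x \<in> carrier X" "\<And>t. t \<ge> 0 \<Longrightarrow> c \<le> g t x" for x c
    unfolding L[OF that(1)] using that by (intro cINF_greatest) auto
  have add: "g (s + t) (x \<oplus> y) \<le> g s x + g t y" if "x \<in> carrier X" "y \<in> carrier X" for s t x y
  proof -
    have "(x \<oplus> y) \<oplus> complex_of_real (s + t) \<odot> z
        = (x \<oplus> complex_of_real s \<odot> z) \<oplus> (y \<oplus> complex_of_real t \<odot> z)"
      using that z by (simp add: scale_simps M.a_ac)
    then show ?thesis
      using sub[of "x \<oplus> complex_of_real s \<odot> z" "y \<oplus> complex_of_real t \<odot> z"] that z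
      by (simp add: g_def algebra_simps)
  qed
  have hom: "g (r * t) (complex_of_real r \<odot> x) = r * g t x" if "x \<in> carrier X" "r > 0" for r t x
  proof -
    have "complex_of_real r \<odot> x \<oplus> complex_of_real (r * t) \<odot> z
        = complex_of_real r \<odot> (x \<oplus> complex_of_real t \<odot> z)"
      using that z by (simp add: scale_simps)
    then show ?thesis using that z p by (simp add: g_def sublinear_scale algebra_simps)
  qed
  show "sublinear (lower_along p z)"
    unfolding sublinear_def
  proof (intro conjI ballI allI impI)
    fix x y assume xy: "x \<in> carrier X" "y \<in> carrier X"
    have "lower_along p z (x \<oplus> y) - g s x \<le> lower_along p z y" if s: "s \<ge> 0" for s
    proof (rule geI[OF xy(2)])
      fix t :: real assume "t \<ge> 0"
      then show "lower_along p z (x \<oplus> y) - g s x \<le> g t y"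
        using le[of "x \<oplus> y" "s + t"] add[OF xy, of s t] xy s by simp
    qed
    then have "lower_along p z (x \<oplus> y) - lower_along p z y \<le> lower_along p z x"
      by (intro geI[OF xy(1)]) (simp add: algebra_simps)
    then show "lower_along p z (x \<oplus> y) \<le> lower_along p z x + lower_along p z y" by simp
  next
    fix r :: real and x assume r: "r > 0" and x: "x \<in> carrier X"
    have "lower_along p z (complex_of_real r \<odot> x) / r \<le> lower_along p z x"
    proof (rule geI[OF x])
      fix t :: real assume "t \<ge> 0"
      then have "lower_along p z (complex_of_real r \<odot> x) \<le> r * g t x"
        using le[of "complex_of_real r \<odot> x" "r * t"] hom[OF x r, of t] x r by simp
      then show "lower_along p z (complex_of_real r \<odot> x) / r \<le> g t x"
        using r by (simp add: field_simps)
    qed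
    then show "lower_along p z (complex_of_real r \<odot> x) \<le> r * lower_along p z x"
      using r by (simp add: field_simps)
  qed
qed

text \<open>The Hahn-Banach theorem by minimality instead of extension from subspaces. The condition
  p (-y) \<le> - nrm y survives lowering and forces the value at \<open>y\<close>; the norm lowered
  along \<open>y\<close> meets it, by parameter t = 1. The value 0 off the carrier matches
  \<open>lower_along\<close>, so that total functions can be compared pointwise.\<close>

lemma norming_real_functional:
  assumes y: "y \<in> carrier X"
  obtains f :: "'a \<Rightarrow> real" where
    "\<And>u v. \<lbrakk>u \<in> carrier X; v \<in> carrier X\<rbrakk> \<Longrightarrow> f (u \<oplus> v) = f u + f v"
    and "\<And>r u. u \<in> carrier X \<Longrightarrow> f (complex_of_real r \<odot> u) = r * f u"
    and "\<And>u. u \<in> carrier X \<Longrightarrow> f u \<le> nrm X u"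
    and "f y = nrm X y"
proof -
  let ?A = "{p. sublinear p \<and> (\<forall>x\<in>carrier X. p x \<le> nrm X x) \<and> p (\<ominus> y) \<le> - nrm X y \<and>
    (\<forall>x. x \<notin> carrier X \<longrightarrow> p x = 0)}"
  let ?P = "\<lambda>p q. q \<le> (p :: 'a \<Rightarrow> real)"
  have ne: "lower_along (nrm X) y \<in> ?A"
    using sublinear_lower_along[OF sublinear_nrm y] lower_along_le_self[OF sublinear_nrm y]
      lower_along_le[OF sublinear_nrm y, of "\<ominus> y" 1] y
    by (auto simp: scale_simps M.l_neg lower_along_def)
  have "\<exists>m\<in>?A. \<forall>a\<in>?A. ?P m a \<longrightarrow> a = m"
  proof (rule predicate_Zorn)
    show "partial_order_on ?A (relation_of ?P ?A)"
      by (rule partial_order_on_relation_ofI) auto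
    fix C assume C: "C \<in> Chains (relation_of ?P ?A)"
    show "\<exists>u\<in>?A. \<forall>a\<in>C. ?P a u"
    proof (cases "C = {}")
      case True
      then show ?thesis using ne by blast
    next
      case False
      have CA: "C \<subseteq> ?A" and lin: "\<And>p q. p \<in> C \<Longrightarrow> q \<in> C \<Longrightarrow> p \<le> q \<or> q \<le> p"
        using C by (auto simp: Chains_def relation_of_def)
      \<comment> \<open>A lower bound common to the chain, so that its pointwise infimum is
        finite.\<close>
      have lb: "- nrm X x \<le> q x" if "q \<in> C" "x \<in> carrier X" for q x
      proof -
        have "sublinear q" "q (\<ominus> x) \<le> nrm X (\<ominus> x)" using that CA by auto
        then show ?thesis using sublinear_neg[of q x] that by (simp add: nrm_a_inv)
      qed
      define p where "p x = (INF q\<in>C. q x)" for x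
      have off: "p x = 0" if "x \<notin> carrier X" for x
      proof -
        have "(\<lambda>q. q x) ` C = {0}" using False CA that by force
        then show ?thesis by (simp add: p_def)
      qed
      have le: "p x \<le> q x" if "q \<in> C" for q x
      proof (cases "x \<in> carrier X")
        case True
        have "bdd_below ((\<lambda>q. q x) ` C)" using lb True by (intro bdd_belowI2)
        then show ?thesis unfolding p_def using that by (intro cINF_lower)
      next
        case False
        then show ?thesis using off that CA by auto
      qed
      have ge: "c \<le> p x" if "\<And>q. q \<in> C \<Longrightarrow> c \<le> q x" for c x
        unfolding p_def using that False by (intro cINF_greatest)
      have subl: "sublinear p"
        unfolding sublinear_def
      proof (intro conjI ballI allI impI)
        fix u v assume uv: "u \<in> carrier X" "v \<in> carrier X"
        have "p (u \<oplus> v) \<le> q u + q' v" if q: "q \<in> C" "q' \<in> C" for q q'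
        proof -
          \<comment> \<open>Here the chain property enters: the smaller of \<open>q\<close> and
            \<open>q'\<close> lies below both.\<close>
          obtain q'' where q'': "q'' \<in> C" "q'' \<le> q" "q'' \<le> q'" using lin[OF q] q by blast
          then have "sublinear q''" using CA by auto
          then have "q'' (u \<oplus> v) \<le> q'' u + q'' v" using uv by (simp add: sublinear_def)
          also have "\<dots> \<le> q u + q' v" using q'' by (intro add_mono) (auto simp: le_fun_def)
          finally show ?thesis using le[OF q''(1), of "u \<oplus> v"] by simp
        qed
        then have "p (u \<oplus> v) - q u \<le> p v" if "q \<in> C" for q
          using that by (intro ge) (metis add.commute diff_le_eq)
        then have "p (u \<oplus> v) - p v \<le> p u"
          by (intro ge) (simp add: algebra_simps)
        then show "p (u \<oplus> v) \<le> p u + p v" by simp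
      next
        fix r :: real and u assume r: "r > 0" and u: "u \<in> carrier X"
        have "p (complex_of_real r \<odot> u) / r \<le> p u"
        proof (rule ge)
          fix q assume q: "q \<in> C"
          then have "sublinear q" using CA by auto
          then have "p (complex_of_real r \<odot> u) \<le> r * q u"
            using le[OF q, of "complex_of_real r \<odot> u"] r u
            unfolding sublinear_def by (meson order_trans)
          then show "p (complex_of_real r \<odot> u) / r \<le> q u" using r by (simp add: field_simps)
        qed
        then show "p (complex_of_real r \<odot> u) \<le> r * p u" using r by (simp add: field_simps)
      qed
      obtain q where q: "q \<in> C" using False by blast
      then have "q (\<ominus> y) \<le> - nrm X y" "\<And>x. x \<in> carrier X \<Longrightarrow> q x \<le> nrm X x" using CA by auto
      then have "p \<in> ?A" using subl off le[OF q] by (auto intro: order_trans)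
      then show ?thesis using le by (auto simp: le_fun_def intro!: bexI[of _ p])
    qed
  qed
  then obtain f where f: "f \<in> ?A" and min: "\<And>p. p \<in> ?A \<Longrightarrow> p \<le> f \<Longrightarrow> p = f" by blast
  have fs: "sublinear f" and fn: "\<And>x. x \<in> carrier X \<Longrightarrow> f x \<le> nrm X x"
    and fy: "f (\<ominus> y) \<le> - nrm X y" using f by auto
  \<comment> \<open>Lowering stays inside the admissible set, so minimality leaves \<open>f\<close>
    unchanged in every direction.\<close>
  have low: "lower_along f z = f" if z: "z \<in> carrier X" for z
  proof (rule min)
    have le: "lower_along f z x \<le> f x" for x
      using lower_along_le_self[OF fs z, of x] f by (cases "x \<in> carrier X") (auto simp: lower_along_def)
    then show "lower_along f z \<le> f" by (simp add: le_fun_def)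
    show "lower_along f z \<in> ?A"
      using sublinear_lower_along[OF fs z] order_trans[OF le fn] order_trans[OF le fy]
      by (auto simp: lower_along_def)
  qed
  have add: "f (u \<oplus> v) = f u + f v" if "u \<in> carrier X" "v \<in> carrier X" for u v
  proof (rule antisym)
    show "f (u \<oplus> v) \<le> f u + f v" using fs that unfolding sublinear_def by blast
    \<comment> \<open>With parameter 1, \<open>lower_along f v u\<close> is at most f (u + v) - f v,
      and it equals \<open>f u\<close>.\<close>
    show "f u + f v \<le> f (u \<oplus> v)"
      using lower_along_le[OF fs that(2) that(1), of 1] low[OF that(2)] that by (simp add: scale_simps)
  qed
  have neg: "f (\<ominus> u) = - f u" if "u \<in> carrier X" for u
    using add[of u "\<ominus> u"] that sublinear_zero[OF fs] by (simp add: M.r_neg)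
  show thesis
  proof (rule that)
    show "f (complex_of_real r \<odot> u) = r * f u" if u: "u \<in> carrier X" for r u
    proof (cases "r \<ge> 0")
      case True
      then show ?thesis by (simp add: sublinear_scale[OF fs u])
    next
      case False
      have "complex_of_real r \<odot> u = \<ominus> (complex_of_real (-r) \<odot> u)"
        using u by (simp add: scale_simps flip: minus_one_smult)
      then show ?thesis using u False by (simp add: neg sublinear_scale[OF fs] del: of_real_minus)
    qed
    show "f y = nrm X y" using fy fn[OF y] by (simp add: neg y)
  qed (use add fn in auto)
qed

end


section \<open>Finite dimensional subspaces and norming quotients\<close>

text \<open>Linear combinations are built one term at a time, with repetitions of \<open>b\<close>
  allowed, so that membership can be used by induction; indexed sums appear only when
  \<open>fin_dim\<close> is established.\<close>

inductive_set lspan :: "complex set \<Rightarrow> 'a normed \<Rightarrow> 'a set \<Rightarrow> 'a set"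
  for K :: "complex set" and X :: "'a normed" and S :: "'a set" where
  lspan_zero: "\<zero>\<^bsub>X\<^esub> \<in> lspan K X S"
| lspan_step: "\<lbrakk>x \<in> lspan K X S; c \<in> K; b \<in> S\<rbrakk> \<Longrightarrow> x \<oplus>\<^bsub>X\<^esub> c \<odot>\<^bsub>X\<^esub> b \<in> lspan K X S"

lemma lspan_mono: "S \<subseteq> S' \<Longrightarrow> lspan K X S \<subseteq> lspan K X S'"
proof
  fix x assume "S \<subseteq> S'" "x \<in> lspan K X S"
  from this(2,1) show "x \<in> lspan K X S'"
    by induction (auto intro: lspan.intros)
qed

text \<open>Shrinking the carrier leaves zero, addition and scaling alone. This lets a span be
  recognised as finite dimensional when regarded as a space of its own.\<close>

lemma lspan_subspace: "lspan K (subspace_normed X E) S = lspan K X S"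
proof -
  have "x \<in> lspan K X S" if "x \<in> lspan K (subspace_normed X E) S" for x
    using that by induction (auto intro: lspan.intros)
  moreover have "x \<in> lspan K (subspace_normed X E) S" if "x \<in> lspan K X S" for x
    using that
  proof induction
    case lspan_zero
    then show ?case using lspan.lspan_zero[of "subspace_normed X E" K S] by simp
  next
    case (lspan_step x c b)
    then show ?case using lspan.lspan_step[of x K "subspace_normed X E" S c b] by simp
  qed
  ultimately show ?thesis by blast
qed

context normed_space
begin

lemma submodule_lspan:
  assumes S: "S \<subseteq> carrier X"
  shows "submodule (lspan K X S) (scalar_ring K) X"
proof -
  have car: "x \<in> carrier X" if "x \<in> lspan K X S" for x
    using that S by induction auto
  have smult: "c \<odot> x \<in> lspan K X S" if "x \<in> lspan K X S" "c \<in> K" for c x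
    using that
  proof induction
    case (lspan_step x a b)
    then have "c \<odot> (x \<oplus> a \<odot> b) = c \<odot> x \<oplus> (c * a) \<odot> b"
      using S car by (simp add: scale_simps subset_iff)
    with lspan_step show ?case by (simp add: lspan.lspan_step)
  qed (simp add: scale_simps lspan.lspan_zero)
  have add: "x \<oplus> y \<in> lspan K X S" if "y \<in> lspan K X S" "x \<in> lspan K X S" for x y
    using that
  proof induction
    case (lspan_step y a b)
    then have "x \<oplus> (y \<oplus> a \<odot> b) = (x \<oplus> y) \<oplus> a \<odot> b"
      using S car by (simp add: M.a_assoc subset_iff)
    with lspan_step show ?case by (simp add: lspan.lspan_step)
  qed (simp add: car)
  show ?thesis
  proof (rule submoduleI)
    show "\<ominus> a \<in> lspan K X S" if "a \<in> lspan K X S" for a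
      using smult[OF that, of "-1"] car[OF that] by (simp add: minus_one_smult)
  qed (auto simp: lspan.lspan_zero car smult add scalar_ring_def)
qed

lemma lspan_superset:
  assumes S: "S \<subseteq> carrier X" shows "S \<subseteq> lspan K X S"
proof
  fix x assume "x \<in> S"
  then show "x \<in> lspan K X S"
    using lspan_step[OF lspan_zero, of 1 K x S X] S by (auto simp: scale_simps subset_iff)
qed

lemma normed_space_subspace:
  assumes E: "submodule E (scalar_ring K) X"
  shows "normed_space K (subspace_normed X E)"
proof -
  have sub: "E \<subseteq> carrier X" using submoduleE(1)[OF E] .
  interpret E: module "scalar_ring K" "subspace_normed X E"
    by (rule submodule.submodule_is_module[OF E]) unfold_locales
  show ?thesis
    by unfold_locales (use sub scalars in \<open>auto simp: nrm_eq_0_iff nrm_smult nrm_triangle subset_iff\<close>)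
qed

lemma fin_dimI:
  assumes fin: "finite S" and S: "S \<subseteq> carrier X" and span: "carrier X \<subseteq> lspan K X S"
  shows "fin_dim K X"
proof -
  have "\<exists>c\<in>S \<rightarrow> K. x = (\<Oplus>b\<in>S. c b \<odot> b)" if "x \<in> lspan K X S" for x
    using that
  proof induction
    case lspan_zero
    have "(\<Oplus>b\<in>S. 0 \<odot> b) = (\<Oplus>b\<in>S. \<zero>)"
      by (rule M.finsum_cong') (use S in \<open>auto simp: scale_simps subset_iff\<close>)
    then show ?case by (intro bexI[of _ "\<lambda>_. 0"]) auto
  next
    case (lspan_step x a b)
    then obtain c where c: "c \<in> S \<rightarrow> K" "x = (\<Oplus>b\<in>S. c b \<odot> b)" by blast
    \<comment> \<open>Since \<open>b\<close> may already carry a coefficient, \<open>a\<close> is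
      added to it; only the summand of \<open>b\<close> changes.\<close>
    let ?c = "c(b := c b + a)"
    have cK: "c d \<in> K" "d \<in> carrier X" if "d \<in> S" for d using c S that by auto
    have split: "(\<Oplus>d\<in>S. f d) = f b \<oplus> (\<Oplus>d\<in>S - {b}. f d)" if "f \<in> S \<rightarrow> carrier X" for f
    proof -
      have "(\<Oplus>d\<in>insert b (S - {b}). f d) = f b \<oplus> (\<Oplus>d\<in>S - {b}. f d)"
        by (rule M.finsum_insert) (use fin that lspan_step(3) in auto)
      then show ?thesis using lspan_step(3) by (simp add: insert_absorb)
    qed
    have rest: "(\<Oplus>d\<in>S - {b}. ?c d \<odot> d) = (\<Oplus>d\<in>S - {b}. c d \<odot> d)"
      by (rule M.finsum_cong') (auto simp: cK)
    have restc: "(\<Oplus>d\<in>S - {b}. c d \<odot> d) \<in> carrier X"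
      by (rule M.finsum_closed) (auto simp: cK)
    have "(\<Oplus>d\<in>S. ?c d \<odot> d) = (c b + a) \<odot> b \<oplus> (\<Oplus>d\<in>S - {b}. c d \<odot> d)"
      by (subst split) (use lspan_step rest in \<open>auto simp: cK\<close>)
    also have "\<dots> = (c b \<odot> b \<oplus> (\<Oplus>d\<in>S - {b}. c d \<odot> d)) \<oplus> a \<odot> b"
      using lspan_step restc by (simp add: cK scale_simps M.a_ac)
    also have "c b \<odot> b \<oplus> (\<Oplus>d\<in>S - {b}. c d \<odot> d) = x"
      unfolding c(2) by (rule split[symmetric]) (auto simp: cK)
    finally show ?case
      using lspan_step cK by (intro bexI[of _ ?c]) auto
  qed
  then show ?thesis using fin S span unfolding fin_dim_def by blast
qed

lemma fin_dim_subspace_lspan: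
  assumes fin: "finite S" and S: "S \<subseteq> carrier X"
  shows "fin_dim_subspace K X (lspan K X S)"
proof -
  interpret E: normed_space K "subspace_normed X (lspan K X S)"
    by (rule normed_space_subspace[OF submodule_lspan[OF S]])
  have "fin_dim K (subspace_normed X (lspan K X S))"
    by (rule E.fin_dimI[OF fin]) (use lspan_superset[OF S] in \<open>auto simp: lspan_subspace\<close>)
  then show ?thesis by (simp add: fin_dim_subspace_def submodule_lspan[OF S])
qed

text \<open>A complex functional is recovered from its real part \<open>f\<close> as \<open>f x - \<i> f (\<i> x)\<close>.\<close>

lemma norming_functional:
  assumes y: "y \<in> carrier X"
  obtains g :: "'a \<Rightarrow> complex" where
    "\<And>u. u \<in> carrier X \<Longrightarrow> g u \<in> K"
    and "\<And>u v. \<lbrakk>u \<in> carrier X; v \<in> carrier X\<rbrakk> \<Longrightarrow> g (u \<oplus> v) = g u + g v"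
    and "\<And>c u. \<lbrakk>c \<in> K; u \<in> carrier X\<rbrakk> \<Longrightarrow> g (c \<odot> u) = c * g u"
    and "\<And>u. u \<in> carrier X \<Longrightarrow> Re (g u) \<le> nrm X u"
    and "Re (g y) = nrm X y"
proof -
  obtain f :: "'a \<Rightarrow> real" where
    f: "\<And>u v. \<lbrakk>u \<in> carrier X; v \<in> carrier X\<rbrakk> \<Longrightarrow> f (u \<oplus> v) = f u + f v"
      "\<And>r u. u \<in> carrier X \<Longrightarrow> f (complex_of_real r \<odot> u) = r * f u"
      "\<And>u. u \<in> carrier X \<Longrightarrow> f u \<le> nrm X u"
      "f y = nrm X y"
    using norming_real_functional[OF y] by blast
  show thesis
  proof (cases "K = UNIV")
    case False
    then have K: "K = \<real>" using scalars by blast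
    show thesis
      by (rule that[of "\<lambda>u. complex_of_real (f u)"]) (use f in \<open>auto simp: K elim!: Reals_cases\<close>)
  next
    case True
    define g where "g u = Complex (f u) (- f (\<i> \<odot> u))" for u
    have add: "g (u \<oplus> v) = g u + g v" if "u \<in> carrier X" "v \<in> carrier X" for u v
      using that True by (simp add: g_def complex_eq_iff f scale_simps)
    have re: "g (complex_of_real r \<odot> u) = complex_of_real r * g u" if "u \<in> carrier X" for r u
    proof -
      have "\<i> \<odot> (complex_of_real r \<odot> u) = complex_of_real r \<odot> (\<i> \<odot> u)"
        using that True by (simp add: scale_simps mult.commute)
      then show ?thesis using that True by (simp add: g_def complex_eq_iff f)
    qed
    have im: "g (\<i> \<odot> u) = \<i> * g u" if "u \<in> carrier X" for u
    proof -
      have "\<i> \<odot> (\<i> \<odot> u) = complex_of_real (-1) \<odot> u" using that True by (simp add: scale_simps)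
      then show ?thesis using that True f(2)[of u "-1"] by (simp add: g_def complex_eq_iff)
    qed
    show thesis
    proof (rule that[of g])
      show "g (c \<odot> u) = c * g u" if "c \<in> K" "u \<in> carrier X" for c u
      proof -
        have c: "c = complex_of_real (Re c) + complex_of_real (Im c) * \<i>"
          by (simp add: complex_eq_iff)
        then have "c \<odot> u = (complex_of_real (Re c) + complex_of_real (Im c) * \<i>) \<odot> u"
          by simp
        also have "\<dots> = complex_of_real (Re c) \<odot> u \<oplus> complex_of_real (Im c) \<odot> (\<i> \<odot> u)"
          using that True by (simp add: scale_simps)
        finally have "g (c \<odot> u) = (complex_of_real (Re c) + complex_of_real (Im c) * \<i>) * g u"
          using that True by (simp add: add re im algebra_simps)
        then show ?thesis by (simp only: c[symmetric])
      qed
    qed (use True f y in \<open>simp_all add: add, simp_all add: g_def\<close>)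
  qed
qed

section \<open>The quotient map and the quotient norm\<close>

lemma quotient_proj_iff:
  "z \<in> quotient_proj X L x \<longleftrightarrow> (\<exists>l\<in>L. z = l \<oplus> x)"
  unfolding quotient_proj_def a_r_coset_def' by auto

lemma quotient_carrier: "carrier (quotient_normed X L) = quotient_proj X L ` carrier X"
  by (auto simp: quotient_normed_def A_RCOSETS_def' quotient_proj_def)

text \<open>The quotient norm is an infimum over the coset: every representative bounds it above,
  and a common lower bound of the coset bounds it below. Norming functionals will supply such lower
  bounds.\<close>

lemma
  assumes L: "submodule L (scalar_ring K) X"
  shows quotient_proj_add: "\<lbrakk>x \<in> carrier X; y \<in> carrier X\<rbrakk> \<Longrightarrow>
      quotient_proj X L x \<oplus>\<^bsub>quotient_normed X L\<^esub> quotient_proj X L y = quotient_proj X L (x \<oplus> y)"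
    and quotient_proj_smult: "\<lbrakk>c \<in> K; x \<in> carrier X\<rbrakk> \<Longrightarrow>
      c \<odot>\<^bsub>quotient_normed X L\<^esub> quotient_proj X L x = quotient_proj X L (c \<odot> x)"
    and quotient_proj_eq: "\<lbrakk>x \<in> carrier X; y \<in> carrier X; x \<ominus> y \<in> L\<rbrakk> \<Longrightarrow>
      quotient_proj X L x = quotient_proj X L y"
    and quotient_proj_zero: "quotient_proj X L \<zero> = \<zero>\<^bsub>quotient_normed X L\<^esub>"
    and nrm_quotient_proj_le: "x \<in> carrier X \<Longrightarrow>
      nrm (quotient_normed X L) (quotient_proj X L x) \<le> nrm X x"
    and nrm_quotient_proj_ge: "\<lbrakk>x \<in> carrier X; \<And>l. l \<in> L \<Longrightarrow> r \<le> nrm X (l \<oplus> x)\<rbrakk> \<Longrightarrow>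
      r \<le> nrm (quotient_normed X L) (quotient_proj X L x)"
proof -
  have Lc: "l \<in> carrier X" if "l \<in> L" for l using submoduleE(1)[OF L] that by blast
  have Ladd: "a \<oplus> b \<in> L" if "a \<in> L" "b \<in> L" for a b using submoduleE(5)[OF L] that by blast
  have Lneg: "\<ominus> a \<in> L" if "a \<in> L" for a using submoduleE(3)[OF L] that by blast
  have L0: "\<zero> \<in> L" using subgroup.one_closed[OF submodule.axioms(1)[OF L]] by simp
  interpret L: abelian_subgroup L X
    by (intro abelian_subgroupI3 additive_subgroupI submodule.axioms(1)[OF L]) unfold_locales
  show eq: "quotient_proj X L x = quotient_proj X L y"
    if "x \<in> carrier X" "y \<in> carrier X" "x \<ominus> y \<in> L" for x y
  proof -
    have "x = (x \<ominus> y) \<oplus> y" using that by (simp add: M.minus_eq M.a_assoc M.l_neg)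
    then have "x \<in> L +> y" using that unfolding a_r_coset_def' by blast
    then show ?thesis unfolding quotient_proj_def
      using M.a_repr_independence[OF _ that(2) submodule.axioms(1)[OF L]] by simp
  qed
  show "quotient_proj X L x \<oplus>\<^bsub>quotient_normed X L\<^esub> quotient_proj X L y = quotient_proj X L (x \<oplus> y)"
    if "x \<in> carrier X" "y \<in> carrier X" for x y
    using that by (simp add: quotient_normed_def quotient_proj_def L.a_rcos_sum)
  show "quotient_proj X L \<zero> = \<zero>\<^bsub>quotient_normed X L\<^esub>"
    using M.a_coset_add_zero[of L] Lc by (simp add: quotient_normed_def quotient_proj_def subset_iff)
  have self: "x \<in> quotient_proj X L x" if "x \<in> carrier X" for x
    using that L0 by (force simp: quotient_proj_iff)
  show "c \<odot>\<^bsub>quotient_normed X L\<^esub> quotient_proj X L x = quotient_proj X L (c \<odot> x)"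
    if c: "c \<in> K" and x: "x \<in> carrier X" for c x
  proof -
    have "quotient_proj X L (c \<odot> s) = quotient_proj X L (c \<odot> x)"
      if s: "s \<in> quotient_proj X L x" for s
    proof -
      obtain l where l: "l \<in> L" "s = l \<oplus> x" using s x by (auto simp: quotient_proj_iff)
      have "c \<odot> s \<ominus> c \<odot> x = c \<odot> l"
        using c x l Lc by (simp add: scale_simps M.minus_eq M.a_assoc M.r_neg)
      moreover have "c \<odot> l \<in> L" using submoduleE(4)[OF L] c l by (simp add: scalar_ring_def)
      ultimately show ?thesis using c x l Lc by (intro eq) auto
    qed
    then have "(\<Union>s\<in>quotient_proj X L x. quotient_proj X L (c \<odot> s)) = quotient_proj X L (c \<odot> x)"
      using self[OF x] by blast
    then show ?thesis by (simp add: quotient_normed_def quotient_proj_def)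
  qed
  have car: "z \<in> carrier X" if "z \<in> quotient_proj X L x" "x \<in> carrier X" for z x
    using that Lc by (auto simp: quotient_proj_iff)
  show "nrm (quotient_normed X L) (quotient_proj X L x) \<le> nrm X x" if "x \<in> carrier X" for x
    using self[OF that] car[OF _ that]
    by (auto simp: quotient_normed_def intro!: cINF_lower bdd_belowI2[of _ 0])
  show "r \<le> nrm (quotient_normed X L) (quotient_proj X L x)"
    if "x \<in> carrier X" "\<And>l. l \<in> L \<Longrightarrow> r \<le> nrm X (l \<oplus> x)" for x r
  proof -
    have "quotient_proj X L x \<noteq> {}" using self[OF that(1)] by blast
    then show ?thesis
      using that by (auto simp: quotient_normed_def quotient_proj_iff intro!: cINF_greatest)
  qed
qed

lemma quotient_proj_minus:
  assumes L: "submodule L (scalar_ring K) X" and x: "x \<in> carrier X" and y: "y \<in> carrier X"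
    and cl: "closedin (mtopology_of (nmetric X)) L"
  shows "quotient_proj X L x \<ominus>\<^bsub>quotient_normed X L\<^esub> quotient_proj X L y = quotient_proj X L (x \<ominus> y)"
proof -
  interpret Q: normed_space K "quotient_normed X L" by (rule normed_space_quotient[OF L cl])
  have "\<ominus>\<^bsub>quotient_normed X L\<^esub> quotient_proj X L y = quotient_proj X L (\<ominus> y)"
    using quotient_proj_smult[OF L _ y, of "-1"] y Q.minus_one_smult[of "quotient_proj X L y"]
    by (simp add: quotient_carrier minus_one_smult)
  then show ?thesis
    using x y by (simp add: M.minus_eq Q.M.minus_eq quotient_proj_add[OF L])
qed

text \<open>
  For a finite set \<open>D\<close>, the subspace \<open>L\<close> is the intersection of the kernels of norming functionals;
  \<open>S\<close> spans a complement.
\<close>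

lemma norming_subspace:
  assumes "finite D" "D \<subseteq> carrier X"
  obtains L where "fin_codim_subspace K X L"
    and "\<And>d. d \<in> D \<Longrightarrow> nrm X d \<le> nrm (quotient_normed X L) (quotient_proj X L d)"
proof -
  \<comment> \<open>Finite codimension is carried through the induction by \<open>S\<close>, whose
    span meets every coset of \<open>L\<close>.\<close>
  define P where "P D L S \<longleftrightarrow> submodule L (scalar_ring K) X \<and>
    closedin (mtopology_of (nmetric X)) L \<and> finite S \<and> S \<subseteq> carrier X \<and>
    (\<forall>y\<in>carrier X. \<exists>z\<in>lspan K X S. y \<ominus> z \<in> L) \<and>
    (\<forall>d\<in>D. \<forall>l\<in>L. nrm X d \<le> nrm X (l \<oplus> d))" for D L S
  have "\<exists>L S. P D L S"
    using assms
  proof (induction D)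
    case empty
    have "closedin (mtopology_of (nmetric X)) (carrier X)"
      using closedin_topspace[of "mtopology_of (nmetric X)"] by simp
    then have "P {} (carrier X) {}"
      using carrier_is_submodule by (auto simp: P_def intro: lspan_zero)
    then show ?case by blast
  next
    case (insert d D)
    have d: "d \<in> carrier X" using insert.prems by simp
    obtain L S where "P D L S" using insert.IH insert.prems by auto
    then have L: "submodule L (scalar_ring K) X" "closedin (mtopology_of (nmetric X)) L"
      and S: "finite S" "S \<subseteq> carrier X" "\<And>y. y \<in> carrier X \<Longrightarrow> \<exists>z\<in>lspan K X S. y \<ominus> z \<in> L"
      and D: "\<And>d l. d \<in> D \<Longrightarrow> l \<in> L \<Longrightarrow> nrm X d \<le> nrm X (l \<oplus> d)"
      unfolding P_def by simp_all
    obtain g :: "'a \<Rightarrow> complex" where gK: "\<And>u. u \<in> carrier X \<Longrightarrow> g u \<in> K"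
      and gadd: "\<And>u v. \<lbrakk>u \<in> carrier X; v \<in> carrier X\<rbrakk> \<Longrightarrow> g (u \<oplus> v) = g u + g v"
      and gsm: "\<And>c u. \<lbrakk>c \<in> K; u \<in> carrier X\<rbrakk> \<Longrightarrow> g (c \<odot> u) = c * g u"
      and gle: "\<And>u. u \<in> carrier X \<Longrightarrow> Re (g u) \<le> nrm X u"
      and gd: "Re (g d) = nrm X d"
      using norming_functional[OF d] by blast
    have gneg: "g (\<ominus> u) = - g u" if "u \<in> carrier X" for u
      using gsm[of "-1" u] that by (simp add: minus_one_smult)
    have gminus: "g (u \<ominus> v) = g u - g v" if "u \<in> carrier X" "v \<in> carrier X" for u v
      using that by (simp add: M.minus_eq gadd gneg)
    have absre: "\<bar>Re (g u)\<bar> \<le> nrm X u" if "u \<in> carrier X" for u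
      using gle[OF that] gle[of "\<ominus> u"] that by (simp add: gneg nrm_a_inv)
    \<comment> \<open>Only real parts are controlled so far; for complex scalars the imaginary part
      of \<open>g u\<close> is minus the real part of \<open>g (\<i> \<odot> u)\<close>. The crude
      factor 2 suffices for the kernel to be closed.\<close>
    have bound: "cmod (g u) \<le> 2 * nrm X u" if "u \<in> carrier X" for u
    proof -
      have "\<bar>Im (g u)\<bar> \<le> nrm X u"
      proof (cases "K = UNIV")
        case True
        then show ?thesis using absre[of "\<i> \<odot> u"] that by (simp add: gsm nrm_smult)
      next
        case False
        then have "Im (g u) = 0" using scalars gK[OF that] by (auto simp: complex_is_Real_iff)
        then show ?thesis using that by simp
      qed
      then show ?thesis using absre[OF that] cmod_le[of "g u"] by simp
    qed
    have g0: "g \<zero> = 0" using gadd[of \<zero> \<zero>] by simp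
    define Z where "Z = {x \<in> carrier X. g x = 0}"
    have Zclosed: "closedin (mtopology_of (nmetric X)) Z"
    proof -
      interpret MS: Metric_space "mspace (nmetric X)" "mdist (nmetric X)"
        by (rule Metric_space_mspace_mdist)
      \<comment> \<open>For \<open>z\<close> in the kernel, \<open>g\<close> takes the value
        \<open>g x\<close> at x - z, so \<open>z\<close> has distance at least cmod (g x) / 2 from
        \<open>x\<close>.\<close>
      have "\<exists>r>0. disjnt Z (MS.mball x r)" if x: "x \<in> carrier X" "x \<notin> Z" for x
      proof (intro exI[of _ "cmod (g x) / 2"] conjI)
        show "cmod (g x) / 2 > 0" using x by (simp add: Z_def)
        have "z \<notin> MS.mball x (cmod (g x) / 2)" if z: "z \<in> Z" for z
        proof -
          have "cmod (g x) / 2 \<le> nrm X (x \<ominus> z)"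
            using bound[of "x \<ominus> z"] z x by (simp add: Z_def gminus)
          then show ?thesis unfolding MS.in_mball using z x(1) by (simp add: mdist_nmetric Z_def)
        qed
        then show "disjnt Z (MS.mball x (cmod (g x) / 2))" by (auto simp: disjnt_iff)
      qed
      then show ?thesis unfolding mtopology_of_def MS.closedin_metric by (auto simp: Z_def)
    qed
    have Lc: "l \<in> carrier X" if "l \<in> L" for l using submoduleE(1)[OF L(1)] that by blast
    have L0: "\<zero> \<in> L" using subgroup.one_closed[OF submodule.axioms(1)[OF L(1)]] by simp
    have sub: "submodule (L \<inter> Z) (scalar_ring K) X"
      by (rule submoduleI)
        (use submoduleE[OF L(1)] L0 Lc in \<open>auto simp: Z_def gneg gadd gsm g0 scalar_ring_def\<close>)
    \<comment> \<open>Intersecting with a kernel raises the codimension by at most one: either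
      \<open>L\<close> lies in the kernel or one vector \<open>l0\<close> of \<open>L\<close>
      outside it is added to \<open>S\<close>.\<close>
    have "\<exists>S'. finite S' \<and> S' \<subseteq> carrier X \<and> (\<forall>y\<in>carrier X. \<exists>z\<in>lspan K X S'. y \<ominus> z \<in> L \<inter> Z)"
    proof (cases "L \<subseteq> Z")
      case True
      then show ?thesis using S by (intro exI[of _ S]) blast
    next
      case False
      then obtain l0 where l0: "l0 \<in> L" "g l0 \<noteq> 0" using Lc by (auto simp: Z_def)
      have "\<exists>z\<in>lspan K X (insert l0 S). y \<ominus> z \<in> L \<inter> Z" if y: "y \<in> carrier X" for y
      proof -
        obtain z where z: "z \<in> lspan K X S" "y \<ominus> z \<in> L" using S(3)[OF y] by blast
        have zc: "z \<in> carrier X" using submoduleE(1)[OF submodule_lspan[OF S(2)]] z by blast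
        \<comment> \<open>Chosen so that \<open>g\<close> vanishes at (y - z) - a l0, which stays in
          \<open>L\<close>.\<close>
        define a where "a = g (y \<ominus> z) / g l0"
        have a: "a \<in> K" unfolding a_def using y zc l0 Lc by (intro scalar_closed gK) auto
        have "z \<oplus> a \<odot> l0 \<in> lspan K X (insert l0 S)"
          using z(1) lspan_mono[of S "insert l0 S"] a by (blast intro: lspan_step)
        moreover have eq: "y \<ominus> (z \<oplus> a \<odot> l0) = (y \<ominus> z) \<ominus> a \<odot> l0"
          using y zc a l0 Lc by (simp add: M.minus_eq M.minus_add M.a_ac)
        have "(y \<ominus> z) \<ominus> a \<odot> l0 \<in> L"
          using z(2) a l0(1) submoduleE(3-5)[OF L(1)] by (simp add: M.minus_eq scalar_ring_def)
        moreover have "g ((y \<ominus> z) \<ominus> a \<odot> l0) = 0"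
          using y zc a l0 Lc by (simp add: gminus[of "y \<ominus> z"] gsm) (simp add: a_def)
        ultimately show ?thesis using Lc eq by (intro bexI[of _ "z \<oplus> a \<odot> l0"]) (simp_all add: Z_def)
      qed
      then show ?thesis using S l0 Lc by (intro exI[of _ "insert l0 S"]) auto
    qed
    then obtain S' where S': "finite S'" "S' \<subseteq> carrier X"
        "\<forall>y\<in>carrier X. \<exists>z\<in>lspan K X S'. y \<ominus> z \<in> L \<inter> Z" by blast
    \<comment> \<open>Adding an element of the kernel does not change \<open>g d\<close>: nrm d = Re
      (g d) = Re (g (l + d)) \<le> nrm (l + d).\<close>
    have "nrm X d \<le> nrm X (l \<oplus> d)" if "l \<in> Z" for l
      using gle[of "l \<oplus> d"] that gd d by (simp add: Z_def gadd)
    then have "P (insert d D) (L \<inter> Z) S'"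
      unfolding P_def using sub closedin_Int[OF L(2) Zclosed] S' D by auto
    then show ?case by blast
  qed
  then obtain L S where "P D L S" by blast
  then have L: "submodule L (scalar_ring K) X" "closedin (mtopology_of (nmetric X)) L"
    and S: "finite S" "S \<subseteq> carrier X" "\<And>y. y \<in> carrier X \<Longrightarrow> \<exists>z\<in>lspan K X S. y \<ominus> z \<in> L"
    and D: "\<And>d l. d \<in> D \<Longrightarrow> l \<in> L \<Longrightarrow> nrm X d \<le> nrm X (l \<oplus> d)"
    unfolding P_def by simp_all
  let ?Q = "quotient_normed X L" and ?q = "quotient_proj X L"
  interpret Q: normed_space K ?Q by (rule normed_space_quotient[OF L])
  have q: "?q z \<in> lspan K ?Q (?q ` S) \<and> z \<in> carrier X" if "z \<in> lspan K X S" for z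
    using that
  proof induction
    case lspan_zero
    show ?case using lspan.lspan_zero[of ?Q K "?q ` S"] by (simp add: quotient_proj_zero[OF L(1)])
  next
    case (lspan_step x c b)
    then have "?q (x \<oplus> c \<odot> b) = ?q x \<oplus>\<^bsub>?Q\<^esub> c \<odot>\<^bsub>?Q\<^esub> ?q b"
      using S by (simp add: quotient_proj_add[OF L(1)] quotient_proj_smult[OF L(1)] subset_iff)
    then show ?case
      using lspan_step S lspan.lspan_step[of "?q x" K ?Q "?q ` S" c "?q b"] by (auto simp: subset_iff)
  qed
  have "fin_dim K ?Q"
  proof (rule Q.fin_dimI)
    show "carrier ?Q \<subseteq> lspan K ?Q (?q ` S)"
    proof
      fix c assume "c \<in> carrier ?Q"
      then obtain y where y: "y \<in> carrier X" "c = ?q y" by (auto simp: quotient_carrier)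
      then obtain z where z: "z \<in> lspan K X S" "y \<ominus> z \<in> L" using S(3) by blast
      then have "?q y = ?q z" using q[OF z(1)] y by (intro quotient_proj_eq[OF L(1)]) auto
      then show "c \<in> lspan K ?Q (?q ` S)" using q[OF z(1)] y by simp
    qed
  qed (use S in \<open>auto simp: quotient_carrier\<close>)
  then show thesis
    using L assms D by (intro that[of L] nrm_quotient_proj_ge) (auto simp: fin_codim_subspace_def)
qed

end

text \<open>For use where a module is built from scratch, before any \<open>normed_space\<close>
  provides the ring laws.\<close>

lemma cring_scalar_ring:
  assumes "K = \<real> \<or> K = UNIV"
  shows "cring (scalar_ring K)"
proof (rule cringI)
  have K: "0 \<in> K" "1 \<in> K" "\<And>a. a \<in> K \<Longrightarrow> - a \<in> K" "\<And>a b. a \<in> K \<Longrightarrow> b \<in> K \<Longrightarrow> a + b \<in> K"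
      "\<And>a b. a \<in> K \<Longrightarrow> b \<in> K \<Longrightarrow> a * b \<in> K"
    using assms by auto
  show "abelian_group (scalar_ring K)"
    by (rule abelian_groupI) (use K in \<open>auto simp: scalar_ring_def intro: bexI[of _ "- x" for x]\<close>)
  show "Group.comm_monoid (scalar_ring K)"
    by (rule comm_monoidI) (use K in \<open>auto simp: scalar_ring_def\<close>)
qed (auto simp: scalar_ring_def algebra_simps)


section \<open>The Hilbert space of a complete semi-inner product space\<close>

text \<open>
  A vector \<open>u\<close> of the semi-inner product space is represented by the functional \<open>p u\<close>, which
  identifies vectors at distance zero.
\<close>

lemma hilbert_space_of_semi_inner:
  fixes S :: "'u set" and plus :: "'u \<Rightarrow> 'u \<Rightarrow> 'u" and sm :: "complex \<Rightarrow> 'u \<Rightarrow> 'u"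
    and p :: "'u \<Rightarrow> 'u \<Rightarrow> complex" and q :: "'u \<Rightarrow> real"
  assumes K: "K = \<real> \<or> K = UNIV" and ne: "S \<noteq> {}"
    and plus: "\<And>u v. \<lbrakk>u \<in> S; v \<in> S\<rbrakk> \<Longrightarrow> plus u v \<in> S"
    and sm: "\<And>c u. \<lbrakk>c \<in> K; u \<in> S\<rbrakk> \<Longrightarrow> sm c u \<in> S"
    and pK: "\<And>u v. \<lbrakk>u \<in> S; v \<in> S\<rbrakk> \<Longrightarrow> p u v \<in> K"
    and sym: "\<And>u v. \<lbrakk>u \<in> S; v \<in> S\<rbrakk> \<Longrightarrow> p v u = cnj (p u v)"
    and padd: "\<And>u v w. \<lbrakk>u \<in> S; v \<in> S; w \<in> S\<rbrakk> \<Longrightarrow> p (plus u v) w = p u w + p v w"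
    and psm: "\<And>c u w. \<lbrakk>c \<in> K; u \<in> S; w \<in> S\<rbrakk> \<Longrightarrow> p (sm c u) w = c * p u w"
    and pq: "\<And>u. u \<in> S \<Longrightarrow> p u u = complex_of_real ((q u)\<^sup>2)"
    and q0: "\<And>u. u \<in> S \<Longrightarrow> 0 \<le> q u"
    and CS: "\<And>u v. \<lbrakk>u \<in> S; v \<in> S\<rbrakk> \<Longrightarrow> cmod (p u v) \<le> q u * q v"
    and complete: "\<And>\<sigma> :: nat \<Rightarrow> 'u. \<lbrakk>\<And>k. \<sigma> k \<in> S;
        \<And>e. e > 0 \<Longrightarrow> \<exists>N. \<forall>k\<ge>N. \<forall>l\<ge>N. q (plus (\<sigma> k) (sm (- 1) (\<sigma> l))) < e\<rbrakk> \<Longrightarrow>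
        \<exists>x\<in>S. \<forall>e>0. \<exists>N. \<forall>k\<ge>N. q (plus (\<sigma> k) (sm (- 1) x)) < e"
  obtains H :: "('u \<Rightarrow> complex) normed" and \<phi> :: "'u \<Rightarrow> 'u \<Rightarrow> complex"
  where "hilbert_space K H" and "carrier H = \<phi> ` S"
    and "\<And>u v. \<lbrakk>u \<in> S; v \<in> S; \<And>w. w \<in> S \<Longrightarrow> p u w = p v w\<rbrakk> \<Longrightarrow> \<phi> u = \<phi> v"
    and "\<And>u v. \<lbrakk>u \<in> S; v \<in> S\<rbrakk> \<Longrightarrow> \<phi> (plus u v) = \<phi> u \<oplus>\<^bsub>H\<^esub> \<phi> v"
    and "\<And>c u. \<lbrakk>c \<in> K; u \<in> S\<rbrakk> \<Longrightarrow> \<phi> (sm c u) = c \<odot>\<^bsub>H\<^esub> \<phi> u"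
    and "\<And>u. u \<in> S \<Longrightarrow> nrm H (\<phi> u) = q u"
proof -
  have K': "0 \<in> K" "1 \<in> K" "- 1 \<in> K" "\<And>a b. \<lbrakk>a \<in> K; b \<in> K\<rbrakk> \<Longrightarrow> a + b \<in> K"
      "\<And>a b. \<lbrakk>a \<in> K; b \<in> K\<rbrakk> \<Longrightarrow> a * b \<in> K"
    using K by auto
  define \<phi> where "\<phi> u = (\<lambda>w. if w \<in> S then p u w else 0)" for u
  define \<psi> where "\<psi> = inv_into S \<phi>"
  have \<psi>: "\<psi> (\<phi> u) \<in> S" "\<phi> (\<psi> (\<phi> u)) = \<phi> u" if "u \<in> S" for u
    using that by (auto simp: \<psi>_def inv_into_into f_inv_into_f)
  have \<phi>D: "p u w = p v w" if "\<phi> u = \<phi> v" "w \<in> S" for u v w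
    using fun_cong[OF that(1), of w] that(2) by (simp add: \<phi>_def)
  have \<phi>I: "\<phi> u = \<phi> v" if "\<And>w. w \<in> S \<Longrightarrow> p u w = p v w" for u v
    using that by (auto simp: \<phi>_def)
  \<comment> \<open>Independence of the chosen representatives: equal functionals allow a change in
    the first argument of \<open>p\<close>, and symmetry brings the second argument there.\<close>
  have p\<psi>: "p (\<psi> (\<phi> u)) (\<psi> (\<phi> v)) = p u v" if "u \<in> S" "v \<in> S" for u v
  proof -
    have "p (\<psi> (\<phi> u)) (\<psi> (\<phi> v)) = p u (\<psi> (\<phi> v))" using that \<psi> by (intro \<phi>D) auto
    also have "\<dots> = cnj (p (\<psi> (\<phi> v)) u)" using that \<psi> by (intro sym) auto
    also have "p (\<psi> (\<phi> v)) u = p v u" using that \<psi> by (intro \<phi>D) auto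
    finally show ?thesis using sym[OF that(2,1)] by simp
  qed
  have q\<psi>: "q (\<psi> (\<phi> u)) = q u" if "u \<in> S" for u
  proof -
    have "complex_of_real ((q (\<psi> (\<phi> u)))\<^sup>2) = complex_of_real ((q u)\<^sup>2)"
      using p\<psi>[OF that that] pq[OF that] pq[OF \<psi>(1)[OF that]] by simp
    then show ?thesis
      using q0[OF that] q0[OF \<psi>(1)[OF that]] by (simp only: of_real_eq_iff power2_eq_iff_nonneg)
  qed
  define H :: "('u \<Rightarrow> complex) normed" where
    "H = \<lparr>carrier = \<phi> ` S, mult = undefined, one = undefined, zero = (\<lambda>_. 0),
          add = (\<lambda>f g x. f x + g x), smult = (\<lambda>c f x. c * f x), nrm = (\<lambda>f. q (\<psi> f))\<rparr>"
  have car: "carrier H = \<phi> ` S" and zero: "\<zero>\<^bsub>H\<^esub> = (\<lambda>_. 0)"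
    and add: "\<And>f g. f \<oplus>\<^bsub>H\<^esub> g = (\<lambda>x. f x + g x)"
    and smult: "\<And>c f. c \<odot>\<^bsub>H\<^esub> f = (\<lambda>x. c * f x)"
    and nrm: "\<And>u. u \<in> S \<Longrightarrow> nrm H (\<phi> u) = q u"
    by (simp_all add: H_def q\<psi>)
  have \<phi>add: "\<phi> u \<oplus>\<^bsub>H\<^esub> \<phi> v = \<phi> (plus u v)" if "u \<in> S" "v \<in> S" for u v
    using that by (auto simp: \<phi>_def add padd)
  have \<phi>sm: "c \<odot>\<^bsub>H\<^esub> \<phi> u = \<phi> (sm c u)" if "u \<in> S" "c \<in> K" for u c
    using that by (auto simp: \<phi>_def smult psm)
  \<comment> \<open>The data name no zero vector of \<open>S\<close>; any vector scaled by 0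
    represents the zero functional.\<close>
  have \<phi>0: "\<phi> (sm 0 u) = \<zero>\<^bsub>H\<^esub>" if "u \<in> S" for u
    using that K' by (auto simp: \<phi>_def zero psm)
  obtain u0 where u0: "u0 \<in> S" using ne by blast
  have mod: "module (scalar_ring K) H"
  proof (rule moduleI)
    show "cring (scalar_ring K)" by (rule cring_scalar_ring[OF K])
    show "abelian_group H"
    proof (rule abelian_groupI)
      show "\<zero>\<^bsub>H\<^esub> \<in> carrier H" using \<phi>0[OF u0] sm[OF K'(1) u0] car by force
      fix f assume "f \<in> carrier H"
      then obtain u where u: "f = \<phi> u" "u \<in> S" by (auto simp: car)
      have "\<phi> (sm (- 1) u) \<oplus>\<^bsub>H\<^esub> f = \<zero>\<^bsub>H\<^esub>"
        using u K' by (auto simp: add zero \<phi>_def psm)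
      then show "\<exists>g\<in>carrier H. g \<oplus>\<^bsub>H\<^esub> f = \<zero>\<^bsub>H\<^esub>"
        using sm[OF K'(3) u(2)] car by blast
    qed (auto simp: car \<phi>add plus, auto simp: add zero padd plus algebra_simps intro!: \<phi>I)
  qed (auto simp: car \<phi>add \<phi>sm plus sm K' scalar_ring_def,
      auto simp: padd psm plus sm K' algebra_simps intro!: \<phi>I)
  interpret Hm: module "scalar_ring K" H by (rule mod)
  \<comment> \<open>By Cauchy-Schwarz a vector of length zero has vanishing product with all of
    \<open>S\<close>; hence exactly the null vectors are identified with zero.\<close>
  have nz: "q u = 0 \<longleftrightarrow> \<phi> u = \<zero>\<^bsub>H\<^esub>" if u: "u \<in> S" for u
  proof
    assume "q u = 0"
    then have "p u w = 0" if "w \<in> S" for w using CS[OF u that] by simp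
    then show "\<phi> u = \<zero>\<^bsub>H\<^esub>" by (auto simp: \<phi>_def zero)
  next
    assume "\<phi> u = \<zero>\<^bsub>H\<^esub>"
    then have "p u u = 0" using u by (auto simp: \<phi>_def zero fun_eq_iff split: if_splits)
    then show "q u = 0" using pq[OF u] by simp
  qed
  have qsm: "q (sm c u) = cmod c * q u" if c: "c \<in> K" and u: "u \<in> S" for c u
  proof -
    have "p (sm c u) (sm c u) = c * cnj (p (sm c u) u)"
      using c u sm sym[of "sm c u" u] by (simp add: psm)
    also have "\<dots> = c * cnj c * p u u"
      using c u sym[of u u] by (simp add: psm)
    finally have "complex_of_real ((q (sm c u))\<^sup>2) = complex_of_real ((cmod c * q u)\<^sup>2)"
      using pq[OF sm[OF c u]] pq[OF u]
      by (simp add: power_mult_distrib flip: complex_norm_square)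
    then have "(q (sm c u))\<^sup>2 = (cmod c * q u)\<^sup>2" by (simp only: of_real_eq_iff)
    then show ?thesis using q0[OF sm[OF c u]] q0[OF u] by simp
  qed
  have qtri: "q (plus u v) \<le> q u + q v" if u: "u \<in> S" and v: "v \<in> S" for u v
  proof -
    have uv: "plus u v \<in> S" using plus u v .
    have "p (plus u v) (plus u v) = cnj (p (plus u v) u) + cnj (p (plus u v) v)"
      using u v uv sym[of "plus u v" u] sym[of "plus u v" v] by (simp add: padd)
    also have "\<dots> = p u u + p v v + (p u v + cnj (p u v))"
      using u v sym[of u u] sym[of v v] sym[of u v] by (simp add: padd)
    also have "p u v + cnj (p u v) = complex_of_real (2 * Re (p u v))"
      by (simp add: complex_add_cnj)
    finally have "complex_of_real ((q (plus u v))\<^sup>2)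
        = complex_of_real ((q u)\<^sup>2 + (q v)\<^sup>2 + 2 * Re (p u v))"
      using pq u v uv by simp
    then have "(q (plus u v))\<^sup>2 = (q u)\<^sup>2 + (q v)\<^sup>2 + 2 * Re (p u v)"
      by (simp only: of_real_eq_iff)
    also have "\<dots> \<le> (q u)\<^sup>2 + (q v)\<^sup>2 + 2 * (q u * q v)"
      using CS[OF u v] complex_Re_le_cmod[of "p u v"] by simp
    also have "\<dots> = (q u + q v)\<^sup>2" by (simp add: power2_sum)
    finally show ?thesis by (rule power2_le_imp_le) (simp add: q0 u v)
  qed
  interpret H: normed_space K H
  proof
    show "K = \<real> \<or> K = UNIV" by (rule K)
    show "nrm H f = 0 \<longleftrightarrow> f = \<zero>\<^bsub>H\<^esub>" if f: "f \<in> carrier H" for f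
    proof -
      obtain u where u: "f = \<phi> u" "u \<in> S" using f by (auto simp: car)
      then show ?thesis using nz[OF u(2)] nrm[OF u(2)] by simp
    qed
  qed (auto simp: car nrm \<phi>add \<phi>sm sm plus nz qsm qtri)
  have minus: "\<phi> u \<ominus>\<^bsub>H\<^esub> \<phi> v = \<phi> (plus u (sm (- 1) v))" if "u \<in> S" "v \<in> S" for u v
    using that K' \<phi>add[of u "sm (- 1) v"] H.minus_one_smult[of "\<phi> v"]
    by (simp add: car Hm.M.minus_eq \<phi>sm sm)
  have "mcomplete_of (nmetric H)"
  proof (rule iffD2[OF H.mcomplete_nmetric_iff], intro allI impI)
    fix \<sigma> :: "nat \<Rightarrow> 'u \<Rightarrow> complex"
    assume ran: "range \<sigma> \<subseteq> carrier H"
      and cau: "\<forall>e>0. \<exists>N. \<forall>k\<ge>N. \<forall>l\<ge>N. nrm H (\<sigma> k \<ominus>\<^bsub>H\<^esub> \<sigma> l) < e"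
    have "\<exists>u. u \<in> S \<and> \<sigma> k = \<phi> u" for k using ran by (auto simp: car)
    then obtain \<tau> where \<tau>: "\<And>k. \<tau> k \<in> S" "\<And>k. \<sigma> k = \<phi> (\<tau> k)" by metis
    have "\<exists>x\<in>S. \<forall>e>0. \<exists>N. \<forall>k\<ge>N. q (plus (\<tau> k) (sm (- 1) x)) < e"
      by (rule complete) (use cau in \<open>auto simp: \<tau> minus nrm plus sm K'\<close>)
    then show "\<exists>x\<in>carrier H. \<forall>e>0. \<exists>N. \<forall>k\<ge>N. nrm H (\<sigma> k \<ominus>\<^bsub>H\<^esub> x) < e"
      by (auto simp: car \<tau> minus nrm plus sm K')
  qed
  moreover have "inner_product_on K H (\<lambda>f g. p (\<psi> f) (\<psi> g))"
    unfolding inner_product_on_def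
    by (auto simp: car \<phi>add \<phi>sm p\<psi> nrm pK padd psm pq plus sm intro: sym)
  ultimately have "hilbert_space K H"
    unfolding hilbert_space_def banach_space_def using H.normed_space_axioms by blast
  then show thesis
  proof (rule that[OF _ car])
    show "\<phi> u = \<phi> v" if "\<And>w. w \<in> S \<Longrightarrow> p u w = p v w" for u v
      using that by (rule \<phi>I)
  qed (simp_all add: \<phi>add \<phi>sm nrm)
qed


section \<open>Ultraproducts of inner product spaces\<close>

text \<open>
  The depth \<open>d\<close> makes the ultrafilter countably incomplete; this is what makes the ultraproduct
  complete even if the factors are not.
\<close>

locale ultraproduct =
  fixes K :: "complex set" and U :: "'j filter" and H :: "'j \<Rightarrow> 'h normed"
    and ip :: "'j \<Rightarrow> 'h \<Rightarrow> 'h \<Rightarrow> complex" and d :: "'j \<Rightarrow> nat"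
  assumes ultra: "ultrafilter U"
    and normed: "\<And>j. normed_space K (H j)"
    and inner: "\<And>j. inner_product_on K (H j) (ip j)"
    and depth: "filterlim d sequentially U"
begin

sublocale H: normed_space K "H j" for j
  by (rule normed)

section \<open>Bounded families and their limits along the ultrafilter\<close>

definition fam :: "('j \<Rightarrow> 'h) set" where
  "fam = {h. (\<forall>j. h j \<in> carrier (H j)) \<and> (\<exists>B. \<forall>j. nrm (H j) (h j) \<le> B)}"

definition uplus :: "('j \<Rightarrow> 'h) \<Rightarrow> ('j \<Rightarrow> 'h) \<Rightarrow> 'j \<Rightarrow> 'h" where
  "uplus u v = (\<lambda>j. u j \<oplus>\<^bsub>H j\<^esub> v j)"

definition usmult :: "complex \<Rightarrow> ('j \<Rightarrow> 'h) \<Rightarrow> 'j \<Rightarrow> 'h" where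
  "usmult c u = (\<lambda>j. c \<odot>\<^bsub>H j\<^esub> u j)"

definition uip :: "('j \<Rightarrow> 'h) \<Rightarrow> ('j \<Rightarrow> 'h) \<Rightarrow> complex" where
  "uip u v = Lim U (\<lambda>j. ip j (u j) (v j))"

definition unrm :: "('j \<Rightarrow> 'h) \<Rightarrow> real" where
  "unrm u = Lim U (\<lambda>j. nrm (H j) (u j))"

lemma nontrivial: "U \<noteq> bot"
  using ultra by (simp add: ultrafilter_def)

lemma fam_carrier: "u \<in> fam \<Longrightarrow> u j \<in> carrier (H j)"
  by (simp add: fam_def)

lemma fam_bound:
  assumes "u \<in> fam" obtains B where "\<And>j. nrm (H j) (u j) \<le> B" and "B \<ge> 0"
proof -
  obtain B where B: "\<And>j. nrm (H j) (u j) \<le> B" using assms by (auto simp: fam_def)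
  moreover have "0 \<le> B" using B[of undefined] H.nrm_nonneg[OF fam_carrier[OF assms]] order_trans by blast
  ultimately show thesis using that by blast
qed

lemma uplus_fam:
  assumes u: "u \<in> fam" and v: "v \<in> fam" shows "uplus u v \<in> fam"
proof -
  obtain B C where B: "\<And>j. nrm (H j) (u j) \<le> B" and C: "\<And>j. nrm (H j) (v j) \<le> C"
    using fam_bound u v by metis
  have "nrm (H j) (u j \<oplus>\<^bsub>H j\<^esub> v j) \<le> B + C" for j
    using H.nrm_triangle[OF fam_carrier[OF u] fam_carrier[OF v], of j] B[of j] C[of j] by linarith
  then show ?thesis using u v by (auto simp: fam_def uplus_def)
qed

lemma usmult_fam:
  assumes c: "c \<in> K" and u: "u \<in> fam" shows "usmult c u \<in> fam"
proof -
  obtain B where B: "\<And>j. nrm (H j) (u j) \<le> B" using fam_bound u by metis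
  have "nrm (H j) (c \<odot>\<^bsub>H j\<^esub> u j) \<le> cmod c * B" for j
    using B[of j] H.nrm_smult[OF c fam_carrier[OF u]] by (simp add: mult_left_mono)
  then show ?thesis using c u by (auto simp: fam_def usmult_def)
qed

lemma uplus_neg: "v \<in> fam \<Longrightarrow> uplus u (usmult (- 1) v) j = u j \<ominus>\<^bsub>H j\<^esub> v j"
  by (simp add: uplus_def usmult_def H.minus_one_smult fam_carrier H.M.minus_eq)

lemma tendsto_unrm:
  assumes u: "u \<in> fam" shows "((\<lambda>j. nrm (H j) (u j)) \<longlongrightarrow> unrm u) U"
proof -
  obtain B where B: "\<And>j. nrm (H j) (u j) \<le> B" using fam_bound u by metis
  have "\<forall>\<^sub>F j in U. nrm (H j) (u j) \<in> {0..B}"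
    using B fam_carrier[OF u] by simp
  then obtain l where "((\<lambda>j. nrm (H j) (u j)) \<longlongrightarrow> l) U"
    using ultrafilter_tendsto[OF ultra compact_Icc] by metis
  then show ?thesis unfolding unrm_def using tendsto_Lim[OF nontrivial] by metis
qed

text \<open>Boundedness and Cauchy-Schwarz confine the products to a closed ball, where an
  ultrafilter must converge; thus the \<open>Lim\<close> in \<open>uip\<close> is a genuine
  limit.\<close>

lemma tendsto_uip:
  assumes u: "u \<in> fam" and v: "v \<in> fam"
  shows "((\<lambda>j. ip j (u j) (v j)) \<longlongrightarrow> uip u v) U"
proof -
  obtain B C where B: "\<And>j. nrm (H j) (u j) \<le> B" "B \<ge> 0" and C: "\<And>j. nrm (H j) (v j) \<le> C"
    using fam_bound u v by metis
  have "cmod (ip j (u j) (v j)) \<le> B * C" for j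
  proof -
    have "cmod (ip j (u j) (v j)) \<le> nrm (H j) (u j) * nrm (H j) (v j)"
      by (rule H.Cauchy_Schwarz[OF inner fam_carrier[OF u] fam_carrier[OF v]])
    also have "\<dots> \<le> B * C" using B C fam_carrier[OF v] by (intro mult_mono) auto
    finally show ?thesis .
  qed
  then have "\<forall>\<^sub>F j in U. ip j (u j) (v j) \<in> cball 0 (B * C)" by simp
  then obtain l where "((\<lambda>j. ip j (u j) (v j)) \<longlongrightarrow> l) U"
    using ultrafilter_tendsto[OF ultra compact_cball] by metis
  then show ?thesis unfolding uip_def using tendsto_Lim[OF nontrivial] by metis
qed

lemma uip_eqI:
  "\<lbrakk>u \<in> fam; v \<in> fam; ((\<lambda>j. ip j (u j) (v j)) \<longlongrightarrow> l) U\<rbrakk> \<Longrightarrow> uip u v = l"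
  using tendsto_unique[OF nontrivial tendsto_uip] by blast

lemma unrm_leI:
  assumes "u \<in> fam" "\<forall>\<^sub>F j in U. nrm (H j) (u j) \<le> r" shows "unrm u \<le> r"
  using tendsto_upperbound[OF tendsto_unrm] assms nontrivial by blast

text \<open>A diagonal argument. For each \<open>p\<close>, a fast Cauchy subsequence
  \<open>\<tau>\<close> satisfies its finitely many estimates up to stage \<open>p\<close> at almost
  every index. At \<open>j\<close> the limit takes the value of \<open>\<tau>\<close> at the largest
  stage good for \<open>j\<close>; as the depth tends to infinity along \<open>U\<close>, that stage
  is eventually at least any given \<open>p\<close>.\<close>

lemma fam_complete:
  fixes \<sigma> :: "nat \<Rightarrow> 'j \<Rightarrow> 'h"
  assumes \<sigma>: "\<And>k. \<sigma> k \<in> fam"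
    and cau: "\<And>e. e > 0 \<Longrightarrow> \<exists>N. \<forall>k\<ge>N. \<forall>l\<ge>N. unrm (uplus (\<sigma> k) (usmult (- 1) (\<sigma> l))) < e"
  shows "\<exists>x\<in>fam. \<forall>e>0. \<exists>N. \<forall>k\<ge>N. unrm (uplus (\<sigma> k) (usmult (- 1) x)) < e"
proof -
  have K1: "- 1 \<in> K" using H.scalars by auto
  have dfam: "uplus u (usmult (- 1) v) \<in> fam" if "u \<in> fam" "v \<in> fam" for u v
    using that K1 by (intro uplus_fam usmult_fam)
  have "\<forall>p. \<exists>N. \<forall>k\<ge>N. \<forall>l\<ge>N. unrm (uplus (\<sigma> k) (usmult (- 1) (\<sigma> l))) < (1/2) ^ p"
    using cau by simp
  then obtain N where N: "\<And>p k l. \<lbrakk>k \<ge> N p; l \<ge> N p\<rbrakk> \<Longrightarrow>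
      unrm (uplus (\<sigma> k) (usmult (- 1) (\<sigma> l))) < (1/2) ^ p"
    by metis
  \<comment> \<open>The maximum ensures that \<open>r a\<close> and \<open>r b\<close> are both at
    least \<open>N a\<close> when a \<le> b, so \<open>\<tau> a\<close> and \<open>\<tau> b\<close>
    are within (1/2) ^ a.\<close>
  define r where "r p = Max (N ` {..p})" for p
  have rN: "r p \<ge> N a" if "a \<le> p" for a p
    using that by (auto simp: r_def intro!: Max_ge)
  define \<tau> where "\<tau> p = \<sigma> (r p)" for p
  have \<tau>: "\<tau> p \<in> fam" for p by (simp add: \<tau>_def \<sigma>)
  \<comment> \<open>The bound by \<open>d j\<close> leaves finitely many good stages, so a largest
    one exists; including all pairs up to \<open>p\<close> makes the chosen stage close to every
    earlier one.\<close>
  define good where "good j p \<longleftrightarrow> p \<le> d j \<and>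
      (\<forall>b\<le>p. \<forall>a\<le>b. nrm (H j) (\<tau> a j \<ominus>\<^bsub>H j\<^esub> \<tau> b j) \<le> (1/2) ^ a)" for j p
  have ev: "\<forall>\<^sub>F j in U. good j p" for p
    unfolding good_def
  proof (intro eventually_conj)
    show "\<forall>\<^sub>F j in U. p \<le> d j"
      using depth by (simp add: filterlim_at_top)
    have "\<forall>\<^sub>F j in U. nrm (H j) (\<tau> a j \<ominus>\<^bsub>H j\<^esub> \<tau> b j) \<le> (1/2) ^ a" if "a \<le> b" for a b
    proof -
      have "unrm (uplus (\<tau> a) (usmult (- 1) (\<tau> b))) < (1/2) ^ a"
        unfolding \<tau>_def using that by (intro N rN) auto
      then have "\<forall>\<^sub>F j in U. nrm (H j) (uplus (\<tau> a) (usmult (- 1) (\<tau> b)) j) < (1/2) ^ a"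
        by (intro order_tendstoD(2)[OF tendsto_unrm] dfam \<tau>)
      then show ?thesis by eventually_elim (simp add: uplus_neg \<tau>)
    qed
    then have "\<forall>\<^sub>F j in U. \<forall>b\<in>{..p}. \<forall>a\<in>{..b}.
        nrm (H j) (\<tau> a j \<ominus>\<^bsub>H j\<^esub> \<tau> b j) \<le> (1/2) ^ a"
      by (intro eventually_ball_finite ballI) auto
    then show "\<forall>\<^sub>F j in U. \<forall>b\<le>p. \<forall>a\<le>b. nrm (H j) (\<tau> a j \<ominus>\<^bsub>H j\<^esub> \<tau> b j) \<le> (1/2) ^ a"
      by (simp add: Ball_def)
  qed
  define \<nu> where "\<nu> j = Max {p. good j p}" for j
  have fin: "finite {p. good j p}" for j
    by (rule finite_subset[of _ "{..d j}"]) (auto simp: good_def)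
  \<comment> \<open>Stage 0 compares \<open>\<tau> 0\<close> only with itself. Being good at every
    index, it makes \<open>\<nu>\<close> well defined and keeps \<open>x\<close> within 1 of
    \<open>\<tau> 0\<close>, hence bounded.\<close>
  have "good j 0" for j by (simp add: good_def H.M.minus_eq H.M.r_neg fam_carrier[OF \<tau>])
  then have \<nu>: "good j (\<nu> j)" for j
    using Max_in[OF fin] by (force simp: \<nu>_def)
  have \<nu>ge: "p \<le> \<nu> j" if "good j p" for j p
    unfolding \<nu>_def using fin that by (intro Max_ge) auto
  define x where "x j = \<tau> (\<nu> j) j" for j
  have near: "nrm (H j) (\<tau> p j \<ominus>\<^bsub>H j\<^esub> x j) \<le> (1/2) ^ p" if "p \<le> \<nu> j" for p j
    using \<nu>[of j] that by (simp add: good_def x_def)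
  have xc: "x j \<in> carrier (H j)" for j by (simp add: x_def fam_carrier \<tau>)
  have xfam: "x \<in> fam"
  proof -
    obtain B where B: "\<And>j. nrm (H j) (\<tau> 0 j) \<le> B" using fam_bound[OF \<tau>] by metis
    have "nrm (H j) (x j) \<le> 1 + B" for j
    proof -
      have "nrm (H j) (x j) = nrm (H j) ((x j \<ominus>\<^bsub>H j\<^esub> \<tau> 0 j) \<oplus>\<^bsub>H j\<^esub> \<tau> 0 j)"
        using xc fam_carrier[OF \<tau>] by (simp add: H.M.minus_eq H.M.a_assoc H.M.l_neg)
      also have "\<dots> \<le> nrm (H j) (x j \<ominus>\<^bsub>H j\<^esub> \<tau> 0 j) + nrm (H j) (\<tau> 0 j)"
        using xc fam_carrier[OF \<tau>] by (intro H.nrm_triangle) auto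
      also have "\<dots> \<le> 1 + B"
        using near[of 0 j] B[of j] H.nrm_minus_commute[OF xc fam_carrier[OF \<tau>], of j 0] by simp
      finally show ?thesis .
    qed
    then show ?thesis using xc by (auto simp: fam_def)
  qed
  have "\<exists>N. \<forall>k\<ge>N. unrm (uplus (\<sigma> k) (usmult (- 1) x)) < e" if "e > 0" for e
  proof -
    have "e / 2 > 0" using that by simp
    then obtain p where p: "(1/2 :: real) ^ p < e / 2"
      using real_arch_pow_inv[of "e / 2" "1 / 2"] by auto
    \<comment> \<open>One error leads from \<open>\<sigma> k\<close> to \<open>\<tau> p\<close>, the
      other from \<open>\<tau> p\<close> to \<open>x\<close>; each is at most (1/2) ^ p, which is
      below e / 2.\<close>
    have "unrm (uplus (\<sigma> k) (usmult (- 1) x)) \<le> (1/2) ^ p + (1/2) ^ p" if k: "k \<ge> r p" for k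
    proof (rule unrm_leI[OF dfam[OF \<sigma> xfam]])
      have "unrm (uplus (\<sigma> k) (usmult (- 1) (\<tau> p))) < (1/2) ^ p"
        unfolding \<tau>_def using k rN[of p p] by (intro N) auto
      then have "\<forall>\<^sub>F j in U. nrm (H j) (uplus (\<sigma> k) (usmult (- 1) (\<tau> p)) j) < (1/2) ^ p"
        by (intro order_tendstoD(2)[OF tendsto_unrm] dfam \<tau> \<sigma>)
      then show "\<forall>\<^sub>F j in U. nrm (H j) (uplus (\<sigma> k) (usmult (- 1) x) j) \<le> (1/2) ^ p + (1/2) ^ p"
        using ev[of p]
      proof eventually_elim
        case (elim j)
        have c: "\<sigma> k j \<in> carrier (H j)" "\<tau> p j \<in> carrier (H j)"
          by (simp_all add: fam_carrier \<sigma> \<tau>)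
        have "nrm (H j) (\<sigma> k j \<ominus>\<^bsub>H j\<^esub> x j)
            \<le> nrm (H j) (\<sigma> k j \<ominus>\<^bsub>H j\<^esub> \<tau> p j) + nrm (H j) (\<tau> p j \<ominus>\<^bsub>H j\<^esub> x j)"
          using H.nrm_triangle[of "\<sigma> k j \<ominus>\<^bsub>H j\<^esub> \<tau> p j" j "\<tau> p j \<ominus>\<^bsub>H j\<^esub> x j"] c xc
          by (simp add: H.minus_add_cancel)
        then show ?case
          using elim(1) near[OF \<nu>ge[OF elim(2)]] by (simp add: uplus_neg \<tau> xfam)
      qed
    qed
    then show ?thesis using p by (intro exI[of _ "r p"]) force
  qed
  then show ?thesis using xfam by blast
qed

text \<open>The algebraic identities are assumed for almost all \<open>j\<close> only, because the
  local operators are additive and homogeneous only at indices whose finite set generates the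
  entries concerned.\<close>

theorem ultraproduct_hilbert_space:
  obtains Hu :: "(('j \<Rightarrow> 'h) \<Rightarrow> complex) normed" and \<phi>
  where "hilbert_space K Hu"
    and "\<And>u. u \<in> fam \<Longrightarrow> \<phi> u \<in> carrier Hu"
    and "\<And>u v w. \<lbrakk>u \<in> fam; v \<in> fam; w \<in> fam; \<forall>\<^sub>F j in U. w j = u j \<oplus>\<^bsub>H j\<^esub> v j\<rbrakk> \<Longrightarrow>
        \<phi> w = \<phi> u \<oplus>\<^bsub>Hu\<^esub> \<phi> v"
    and "\<And>c u w. \<lbrakk>c \<in> K; u \<in> fam; w \<in> fam; \<forall>\<^sub>F j in U. w j = c \<odot>\<^bsub>H j\<^esub> u j\<rbrakk> \<Longrightarrow>
        \<phi> w = c \<odot>\<^bsub>Hu\<^esub> \<phi> u"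
    and "\<And>u. u \<in> fam \<Longrightarrow> ((\<lambda>j. nrm (H j) (u j)) \<longlongrightarrow> nrm Hu (\<phi> u)) U"
    and "\<And>u v. \<lbrakk>u \<in> fam; v \<in> fam\<rbrakk> \<Longrightarrow>
        ((\<lambda>j. nrm (H j) (u j \<ominus>\<^bsub>H j\<^esub> v j)) \<longlongrightarrow> nrm Hu (\<phi> u \<ominus>\<^bsub>Hu\<^esub> \<phi> v)) U"
proof -
  have K1: "- 1 \<in> K" using H.scalars by auto
  have ne: "fam \<noteq> {}"
  proof -
    have "(\<lambda>j. \<zero>\<^bsub>H j\<^esub>) \<in> fam" by (auto simp: fam_def)
    then show ?thesis by blast
  qed
  \<comment> \<open>For real scalars the limits of inner products must again be real.\<close>
  have Kc: "closed K" using H.scalars closed_complex_Reals by auto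
  have pK: "uip u v \<in> K" if "u \<in> fam" "v \<in> fam" for u v
    using Lim_in_closed_set[OF Kc _ nontrivial tendsto_uip[OF that]] H.ip_in[OF inner] that
    by (simp add: fam_carrier)
  have sym: "uip v u = cnj (uip u v)" if "u \<in> fam" "v \<in> fam" for u v
  proof (rule uip_eqI[OF that(2,1)])
    have "(\<lambda>j. ip j (v j) (u j)) = (\<lambda>j. cnj (ip j (u j) (v j)))"
      by (intro ext H.ip_commute[OF inner] fam_carrier that)
    then show "((\<lambda>j. ip j (v j) (u j)) \<longlongrightarrow> cnj (uip u v)) U"
      using tendsto_cnj[OF tendsto_uip[OF that]] by (simp only:)
  qed
  have padd: "uip (uplus u v) w = uip u w + uip v w" if "u \<in> fam" "v \<in> fam" "w \<in> fam" for u v w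
    using tendsto_add[OF tendsto_uip[OF that(1,3)] tendsto_uip[OF that(2,3)]] that
    by (intro uip_eqI uplus_fam) (simp_all add: uplus_def H.ip_add_left[OF inner] fam_carrier)
  have psm: "uip (usmult c u) w = c * uip u w" if "c \<in> K" "u \<in> fam" "w \<in> fam" for c u w
    using tendsto_mult_left[OF tendsto_uip[OF that(2,3)], of c] that
    by (intro uip_eqI usmult_fam) (simp_all add: usmult_def H.ip_smult_left[OF inner] fam_carrier)
  have pq: "uip u u = complex_of_real ((unrm u)\<^sup>2)" if "u \<in> fam" for u
    using tendsto_of_real[OF tendsto_power[OF tendsto_unrm[OF that], of 2]] that
    by (intro uip_eqI) (simp_all add: H.ip_self[OF inner fam_carrier fam_carrier])
  have q0: "0 \<le> unrm u" if "u \<in> fam" for u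
    using tendsto_lowerbound[OF tendsto_unrm[OF that] _ nontrivial] that by (simp add: fam_carrier)
  have CS: "cmod (uip u v) \<le> unrm u * unrm v" if "u \<in> fam" "v \<in> fam" for u v
    by (rule tendsto_le[OF nontrivial tendsto_mult[OF tendsto_unrm tendsto_unrm]
          tendsto_norm[OF tendsto_uip]])
      (use that H.Cauchy_Schwarz[OF inner] in \<open>simp_all add: fam_carrier\<close>)
  show thesis
  proof (rule hilbert_space_of_semi_inner[of K fam uplus usmult uip unrm])
    fix Hu :: "(('j \<Rightarrow> 'h) \<Rightarrow> complex) normed" and \<phi>
    assume hs: "hilbert_space K Hu" and car: "carrier Hu = \<phi> ` fam"
      and eqI: "\<And>u v. \<lbrakk>u \<in> fam; v \<in> fam; \<And>w. w \<in> fam \<Longrightarrow> uip u w = uip v w\<rbrakk> \<Longrightarrow> \<phi> u = \<phi> v"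
      and add: "\<And>u v. \<lbrakk>u \<in> fam; v \<in> fam\<rbrakk> \<Longrightarrow> \<phi> (uplus u v) = \<phi> u \<oplus>\<^bsub>Hu\<^esub> \<phi> v"
      and smult: "\<And>c u. \<lbrakk>c \<in> K; u \<in> fam\<rbrakk> \<Longrightarrow> \<phi> (usmult c u) = c \<odot>\<^bsub>Hu\<^esub> \<phi> u"
      and nrm: "\<And>u. u \<in> fam \<Longrightarrow> nrm Hu (\<phi> u) = unrm u"
    interpret Hu: normed_space K Hu using hs by (simp add: hilbert_space_def banach_space_def)
    \<comment> \<open>Families that agree almost everywhere have the same limit products with every
      family, hence represent the same vector.\<close>
    have ev: "\<phi> u = \<phi> v" if "u \<in> fam" "v \<in> fam" "\<forall>\<^sub>F j in U. u j = v j" for u v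
    proof (rule eqI[OF that(1,2)])
      fix w assume w: "w \<in> fam"
      show "uip u w = uip v w"
      proof (rule uip_eqI[OF that(1) w])
        show "((\<lambda>j. ip j (u j) (w j)) \<longlongrightarrow> uip v w) U"
          by (rule Lim_transform_eventually[OF tendsto_uip[OF that(2) w]])
            (use that(3) in \<open>eventually_elim, simp\<close>)
      qed
    qed
    show thesis
    proof (rule that[OF hs])
      show "\<phi> w = \<phi> u \<oplus>\<^bsub>Hu\<^esub> \<phi> v"
        if "u \<in> fam" "v \<in> fam" "w \<in> fam" "\<forall>\<^sub>F j in U. w j = u j \<oplus>\<^bsub>H j\<^esub> v j" for u v w
        using ev[OF that(3) uplus_fam[OF that(1,2)]] that by (simp add: uplus_def flip: add)
      show "\<phi> w = c \<odot>\<^bsub>Hu\<^esub> \<phi> u"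
        if "c \<in> K" "u \<in> fam" "w \<in> fam" "\<forall>\<^sub>F j in U. w j = c \<odot>\<^bsub>H j\<^esub> u j" for c u w
        using ev[OF that(3) usmult_fam[OF that(1,2)]] that by (simp add: usmult_def flip: smult)
      show "((\<lambda>j. nrm (H j) (u j \<ominus>\<^bsub>H j\<^esub> v j)) \<longlongrightarrow> nrm Hu (\<phi> u \<ominus>\<^bsub>Hu\<^esub> \<phi> v)) U"
        if uv: "u \<in> fam" "v \<in> fam" for u v
      proof -
        have "\<phi> u \<ominus>\<^bsub>Hu\<^esub> \<phi> v = \<phi> (uplus u (usmult (- 1) v))"
          using uv K1 Hu.minus_one_smult[of "\<phi> v"]
          by (simp add: add smult usmult_fam car Hu.M.minus_eq)
        then show ?thesis
          using tendsto_unrm[OF uplus_fam[OF uv(1) usmult_fam[OF K1 uv(2)]]] uv K1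
          by (simp add: nrm uplus_neg uplus_fam usmult_fam)
      qed
    qed (auto simp: car nrm tendsto_unrm)
  next
    fix \<sigma> :: "nat \<Rightarrow> 'j \<Rightarrow> 'h"
    assume "\<And>k. \<sigma> k \<in> fam"
      and "\<And>e. e > 0 \<Longrightarrow> \<exists>N. \<forall>k\<ge>N. \<forall>l\<ge>N. unrm (uplus (\<sigma> k) (usmult (- 1) (\<sigma> l))) < e"
    then show "\<exists>x\<in>fam. \<forall>e>0. \<exists>N. \<forall>k\<ge>N. unrm (uplus (\<sigma> k) (usmult (- 1) x)) < e"
      by (rule fam_complete)
  qed (rule H.scalars ne uplus_fam usmult_fam pK sym padd psm pq q0 CS; assumption)+
qed

end


section \<open>Lipschitz constants and multilinear operators\<close>

text \<open>The infimum defining \<open>Lip\<close> is attained: at positive distance the quotient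
  of the distances is a lower bound for all admissible constants, and at distance zero any one of
  them shows that the images have distance zero too.\<close>

lemma
  assumes f: "Lipschitz_continuous_map m1 m2 f"
  shows Lip_nonneg: "0 \<le> Lip m1 m2 f"
    and mdist_le_Lip: "\<lbrakk>x \<in> mspace m1; y \<in> mspace m1\<rbrakk> \<Longrightarrow>
      mdist m2 (f x) (f y) \<le> Lip m1 m2 f * mdist m1 x y"
proof -
  let ?S = "{c. 0 \<le> c \<and> (\<forall>x\<in>mspace m1. \<forall>y\<in>mspace m1. mdist m2 (f x) (f y) \<le> c * mdist m1 x y)}"
  obtain C where "C \<in> ?S"
    using f unfolding Lipschitz_continuous_map_pos by (auto intro: less_imp_le)
  then have ne: "?S \<noteq> {}" by blast
  show "0 \<le> Lip m1 m2 f" unfolding Lip_def using ne by (intro cInf_greatest) auto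
  show "mdist m2 (f x) (f y) \<le> Lip m1 m2 f * mdist m1 x y" if xy: "x \<in> mspace m1" "y \<in> mspace m1"
  proof (cases "mdist m1 x y = 0")
    case True
    have "mdist m2 (f x) (f y) \<le> C * mdist m1 x y" using \<open>C \<in> ?S\<close> xy by blast
    then show ?thesis by (simp add: True)
  next
    case False
    then have pos: "mdist m1 x y > 0" using mdist_nonneg[of m1 x y] by linarith
    have "mdist m2 (f x) (f y) / mdist m1 x y \<le> Lip m1 m2 f"
      unfolding Lip_def using ne
    proof (rule cInf_greatest)
      fix c assume "c \<in> ?S"
      then show "mdist m2 (f x) (f y) / mdist m1 x y \<le> c" using xy pos by (simp add: pos_divide_le_eq)
    qed
    then show ?thesis using pos by (simp add: pos_divide_le_eq)
  qed
qed

lemma Lip_leI: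
  assumes "0 \<le> c"
    and "\<And>x y. \<lbrakk>x \<in> mspace m1; y \<in> mspace m1\<rbrakk> \<Longrightarrow> mdist m2 (f x) (f y) \<le> c * mdist m1 x y"
  shows "Lip m1 m2 f \<le> c"
  unfolding Lip_def using assms by (intro cInf_lower) (auto intro!: bdd_belowI[of _ 0])

section \<open>Multilinear operators on tuples\<close>

lemma tuples_upd:
  "\<lbrakk>x \<in> tuples n X; i \<in> {1..n}; u \<in> carrier (X i)\<rbrakk> \<Longrightarrow> x(i := u) \<in> tuples n X"
  unfolding tuples_def by (auto simp: PiE_iff extensional_def)

lemma tuples_carrier: "\<lbrakk>x \<in> tuples n X; i \<in> {1..n}\<rbrakk> \<Longrightarrow> x i \<in> carrier (X i)"
  unfolding tuples_def by (rule PiE_mem)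

lemma
  assumes "multilinear K n X Y T"
  shows multilinear_carrier: "x \<in> tuples n X \<Longrightarrow> T x \<in> carrier Y"
    and multilinear_add: "\<lbrakk>x \<in> tuples n X; i \<in> {1..n}; u \<in> carrier (X i); v \<in> carrier (X i)\<rbrakk> \<Longrightarrow>
      T (x(i := u \<oplus>\<^bsub>X i\<^esub> v)) = T (x(i := u)) \<oplus>\<^bsub>Y\<^esub> T (x(i := v))"
    and multilinear_smult: "\<lbrakk>x \<in> tuples n X; i \<in> {1..n}; c \<in> K; u \<in> carrier (X i)\<rbrakk> \<Longrightarrow>
      T (x(i := c \<odot>\<^bsub>X i\<^esub> u)) = c \<odot>\<^bsub>Y\<^esub> T (x(i := u))"
  using assms unfolding multilinear_def by blast+

lemma multilinear_scale:
  assumes T: "multilinear K n X Y T" and Y: "normed_space K Y"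
    and X: "\<And>i. i \<in> {1..n} \<Longrightarrow> normed_space K (X i)"
    and x: "x \<in> tuples n X" and c: "c \<in> K"
  shows "T (\<lambda>i\<in>{1..n}. c \<odot>\<^bsub>X i\<^esub> x i) = c ^ n \<odot>\<^bsub>Y\<^esub> T x"
proof -
  interpret Y: normed_space K Y by (rule Y)
  have cx: "c \<odot>\<^bsub>X i\<^esub> x i \<in> carrier (X i)" if "i \<in> {1..n}" for i
    using normed_space.smult_in[OF X[OF that] c tuples_carrier[OF x that]] .
  have cK: "c ^ k \<in> K" for k using c by (induction k) auto
  \<comment> \<open>The first \<open>k\<close> slots are scaled and the rest are not, so that
    induction on \<open>k\<close> uses homogeneity in one slot at a time.\<close>
  let ?x = "\<lambda>k. \<lambda>i\<in>{1..n}. if i \<le> k then c \<odot>\<^bsub>X i\<^esub> x i else x i"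
  have xk: "?x k \<in> tuples n X" for k
    using cx tuples_carrier[OF x] by (auto simp: tuples_def)
  have "T (?x k) = c ^ k \<odot>\<^bsub>Y\<^esub> T x" if "k \<le> n" for k
    using that
  proof (induction k)
    case 0
    have "?x 0 = x" using x by (auto simp: tuples_def PiE_iff extensional_def fun_eq_iff)
    then show ?case using multilinear_carrier[OF T x] by (simp add: Y.scale_simps)
  next
    case (Suc k)
    have k: "Suc k \<in> {1..n}" using Suc.prems by simp
    have "T (?x (Suc k)) = T ((?x k)(Suc k := c \<odot>\<^bsub>X (Suc k)\<^esub> x (Suc k)))"
      using k by (intro arg_cong[of _ _ T]) (auto simp: fun_eq_iff le_Suc_eq)
    also have "\<dots> = c \<odot>\<^bsub>Y\<^esub> T ((?x k)(Suc k := x (Suc k)))"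
      by (intro multilinear_smult[OF T xk k c] tuples_carrier[OF x k])
    also have "(?x k)(Suc k := x (Suc k)) = ?x k" using k by (auto simp: fun_eq_iff)
    finally show ?case
      using Suc multilinear_carrier[OF T x] c cK by (simp add: Y.scale_simps)
  qed
  from this[of n] have "T (?x n) = c ^ n \<odot>\<^bsub>Y\<^esub> T x" by simp
  moreover have "?x n = (\<lambda>i\<in>{1..n}. c \<odot>\<^bsub>X i\<^esub> x i)" by (auto simp: fun_eq_iff)
  ultimately show ?thesis by simp
qed

text \<open>Scaling all slots by 1/t moves the tuple into the unit balls and multiplies the value by
  (1/t) ^ n. The summand 1 keeps t positive when all components vanish. Coarser than a product of
  norms, the bound still depends only on \<open>x\<close> and \<open>C\<close>, which gives
  uniformity over the indices of the ultraproduct.\<close>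

lemma multilinear_bound:
  assumes T: "multilinear K n X Y T" and Y: "normed_space K Y"
    and X: "\<And>i. i \<in> {1..n} \<Longrightarrow> normed_space K (X i)"
    and C: "\<And>x. \<lbrakk>x \<in> tuples n X; \<And>i. i \<in> {1..n} \<Longrightarrow> nrm (X i) (x i) \<le> 1\<rbrakk> \<Longrightarrow> nrm Y (T x) \<le> C"
    and x: "x \<in> tuples n X"
  shows "nrm Y (T x) \<le> C * (1 + (\<Sum>i=1..n. nrm (X i) (x i))) ^ n"
proof -
  interpret Y: normed_space K Y by (rule Y)
  define t where "t = 1 + (\<Sum>i=1..n. nrm (X i) (x i))"
  have nn: "0 \<le> nrm (X i) (x i)" if "i \<in> {1..n}" for i
    using normed_space.nrm_nonneg[OF X[OF that] tuples_carrier[OF x that]] .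
  have t: "t > 0" using nn by (auto simp: t_def intro!: add_pos_nonneg sum_nonneg)
  have le: "nrm (X i) (x i) \<le> t" if "i \<in> {1..n}" for i
  proof -
    have "nrm (X i) (x i) \<le> (\<Sum>i=1..n. nrm (X i) (x i))"
      using that nn by (intro member_le_sum) auto
    then show ?thesis by (simp add: t_def)
  qed
  define c where "c = complex_of_real (1 / t)"
  have c: "c \<in> K" by (simp add: c_def)
  have "nrm Y (T (\<lambda>i\<in>{1..n}. c \<odot>\<^bsub>X i\<^esub> x i)) \<le> C"
  proof (rule C)
    show "(\<lambda>i\<in>{1..n}. c \<odot>\<^bsub>X i\<^esub> x i) \<in> tuples n X"
      using normed_space.smult_in[OF X c tuples_carrier[OF x]] by (auto simp: tuples_def)
    fix i assume i: "i \<in> {1..n}"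
    then have "nrm (X i) (c \<odot>\<^bsub>X i\<^esub> x i) = nrm (X i) (x i) / t"
      using normed_space.nrm_smult[OF X[OF i] c tuples_carrier[OF x i]] t
      by (simp add: c_def norm_divide)
    then show "nrm (X i) ((\<lambda>i\<in>{1..n}. c \<odot>\<^bsub>X i\<^esub> x i) i) \<le> 1"
      using i le[OF i] t by simp
  qed
  also have "T (\<lambda>i\<in>{1..n}. c \<odot>\<^bsub>X i\<^esub> x i) = c ^ n \<odot>\<^bsub>Y\<^esub> T x"
    by (rule multilinear_scale[OF T Y X x c])
  finally have "cmod (c ^ n) * nrm Y (T x) \<le> C"
    using Y.nrm_smult[OF _ multilinear_carrier[OF T x], of "c ^ n"] Y.scalar_closed(5)[of "(1/t) ^ n"]
    by (simp add: c_def)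
  then have "nrm Y (T x) / t ^ n \<le> C"
    using t by (simp add: c_def norm_divide norm_power power_divide)
  then have "nrm Y (T x) \<le> C * t ^ n" using t by (simp add: pos_divide_le_eq)
  then show ?thesis unfolding t_def .
qed

lemma unit_values_nonempty:
  assumes X: "\<And>i. i \<in> {1..n} \<Longrightarrow> normed_space K (X i)"
  shows "unit_values n X Y A \<noteq> {}"
proof -
  have "\<zero>\<^bsub>X i\<^esub> \<in> carrier (X i) \<and> nrm (X i) \<zero>\<^bsub>X i\<^esub> = 0" if "i \<in> {1..n}" for i
  proof -
    interpret normed_space K "X i" by (rule X[OF that])
    show ?thesis by simp
  qed
  then have "(\<lambda>i\<in>{1..n}. \<zero>\<^bsub>X i\<^esub>) \<in> tuples n X \<and> (\<forall>i\<in>{1..n}. nrm (X i) ((\<lambda>i\<in>{1..n}. \<zero>\<^bsub>X i\<^esub>) i) \<le> 1)"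
    by (auto simp: tuples_def)
  then show ?thesis unfolding unit_values_def by blast
qed

lemma multilinear_norm_leI:
  assumes "\<And>i. i \<in> {1..n} \<Longrightarrow> normed_space K (X i)"
    and "\<And>x. \<lbrakk>x \<in> tuples n X; \<And>i. i \<in> {1..n} \<Longrightarrow> nrm (X i) (x i) \<le> 1\<rbrakk> \<Longrightarrow> nrm Y (A x) \<le> C"
  shows "multilinear_norm n X Y A \<le> C"
  unfolding multilinear_norm_def
  by (rule cSup_least[OF unit_values_nonempty[OF assms(1)]])
    (auto simp: unit_values_def intro: assms(2))

lemma
  assumes A: "bounded_multilinear K n X Y A"
  shows le_multilinear_norm: "\<lbrakk>x \<in> tuples n X; \<And>i. i \<in> {1..n} \<Longrightarrow> nrm (X i) (x i) \<le> 1\<rbrakk> \<Longrightarrow>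
      nrm Y (A x) \<le> multilinear_norm n X Y A"
    and multilinear_norm_nonneg: "\<lbrakk>normed_space K Y; \<And>i. i \<in> {1..n} \<Longrightarrow> normed_space K (X i)\<rbrakk> \<Longrightarrow>
      0 \<le> multilinear_norm n X Y A"
proof -
  have bdd: "bdd_above (unit_values n X Y A)" and ml: "multilinear K n X Y A"
    using A by (auto simp: bounded_multilinear_def)
  show "nrm Y (A x) \<le> multilinear_norm n X Y A"
    if "x \<in> tuples n X" "\<And>i. i \<in> {1..n} \<Longrightarrow> nrm (X i) (x i) \<le> 1"
    unfolding multilinear_norm_def using bdd that
    by (intro cSup_upper) (auto simp: unit_values_def)
  show "0 \<le> multilinear_norm n X Y A"
    if Y: "normed_space K Y" and X: "\<And>i. i \<in> {1..n} \<Longrightarrow> normed_space K (X i)"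
  proof -
    have "unit_values n X Y A \<noteq> {}" using X by (rule unit_values_nonempty)
    then obtain v where v: "v \<in> unit_values n X Y A" by blast
    then have "0 \<le> v"
      using normed_space.nrm_nonneg[OF Y multilinear_carrier[OF ml]] by (auto simp: unit_values_def)
    also have "v \<le> multilinear_norm n X Y A"
      unfolding multilinear_norm_def using v bdd by (rule cSup_upper)
    finally show ?thesis .
  qed
qed

text \<open>The part of a factorization that enters the ultraproduct. The inner product is a
  parameter because one is chosen at each index, and the bound 1 is the same for all
  indices.\<close>

definition unit_hilbert_operator ::
    "complex set \<Rightarrow> nat \<Rightarrow> (nat \<Rightarrow> 'a normed) \<Rightarrow> 'h normed \<Rightarrow> ('h \<Rightarrow> 'h \<Rightarrow> complex) \<Rightarrow>
     ((nat \<Rightarrow> 'a) \<Rightarrow> 'h) \<Rightarrow> bool" where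
  "unit_hilbert_operator K n X H ip A \<longleftrightarrow>
     normed_space K H \<and> inner_product_on K H ip \<and> multilinear K n X H A \<and>
     (\<forall>x\<in>tuples n X. (\<forall>i\<in>{1..n}. nrm (X i) (x i) \<le> 1) \<longrightarrow> nrm H (A x) \<le> 1)"

text \<open>
  Both the norm of \<open>A\<close> and the Lipschitz constant are absorbed here: \<open>A\<close> is rescaled to norm
  at most one, which is harmless for \<open>A = 0\<close> because then \<open>T = B \<circ> A\<close> is constant.
\<close>

lemma unit_hilbert_operator_if_gamma_less:
  fixes X :: "nat \<Rightarrow> 'a normed" and Y :: "'b normed"
  assumes X: "\<And>i. i \<in> {1..n} \<Longrightarrow> normed_space K (X i)" and Y: "normed_space K Y"
    and T: "\<And>x. x \<in> tuples n X \<Longrightarrow> T x \<in> carrier Y"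
    and less: "hilbert_gamma K n X Y T < ennreal r"
  shows "\<exists>(H :: ((nat \<Rightarrow> 'a) \<Rightarrow> complex) normed) ip A. unit_hilbert_operator K n X H ip A \<and>
    (\<forall>x\<in>tuples n X. \<forall>y\<in>tuples n X.
      nrm Y (T x \<ominus>\<^bsub>Y\<^esub> T y) \<le> r * nrm H (A x \<ominus>\<^bsub>H\<^esub> A y))"
proof -
  obtain H :: "((nat \<Rightarrow> 'a) \<Rightarrow> complex) normed" and M A B
    where F: "hilbert_factorization K n X Y T H M A B"
      and prod_less: "ennreal (multilinear_norm n X H A * Lip (submetric (nmetric H) M) (nmetric Y) B) < ennreal r"
    using less unfolding hilbert_gamma_def Inf_less_iff by auto
  obtain ip where H: "normed_space K H" and ip: "inner_product_on K H ip"
    using F unfolding hilbert_factorization_def hilbert_space_def banach_space_def by auto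
  have MH: "M \<subseteq> carrier H" and AM: "\<And>x. x \<in> tuples n X \<Longrightarrow> A x \<in> M" and A: "bounded_multilinear K n X H A"
    and BL: "Lipschitz_continuous_map (submetric (nmetric H) M) (nmetric Y) B"
    and TBA: "\<And>x. x \<in> tuples n X \<Longrightarrow> T x = B (A x)"
    using F unfolding hilbert_factorization_def by auto
  interpret H: normed_space K H by (rule H)
  interpret Y: normed_space K Y by (rule Y)
  have ml: "multilinear K n X H A" using A by (simp add: bounded_multilinear_def)
  note Ac = multilinear_carrier[OF ml]
  define a where "a = multilinear_norm n X H A"
  define l where "l = Lip (submetric (nmetric H) M) (nmetric Y) B"
  have a: "a \<ge> 0" unfolding a_def by (rule multilinear_norm_nonneg[OF A H X])
  have l: "l \<ge> 0" unfolding l_def by (rule Lip_nonneg[OF BL])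
  have al: "a * l \<le> r" using prod_less a l by (simp add: ennreal_less_iff flip: a_def l_def)
  have lip: "nrm Y (T x \<ominus>\<^bsub>Y\<^esub> T y) \<le> l * nrm H (A x \<ominus>\<^bsub>H\<^esub> A y)"
    if "x \<in> tuples n X" "y \<in> tuples n X" for x y
    using mdist_le_Lip[OF BL, of "A x" "A y"] that AM MH Ac T
    by (simp add: H.mdist_nmetric Y.mdist_nmetric TBA[symmetric] Int_absorb1 flip: l_def)
  \<comment> \<open>For \<open>a = 0\<close> division by zero makes \<open>c = 0\<close>, so
    \<open>A'\<close> is the zero operator and the unit bound still holds.\<close>
  define c where "c = complex_of_real (1 / a)"
  have c: "c \<in> K" by (simp add: c_def)
  define A' where "A' x = c \<odot>\<^bsub>H\<^esub> A x" for x
  have ml': "multilinear K n X H A'"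
    unfolding multilinear_def A'_def
    using c by (auto simp: Ac multilinear_add[OF ml] multilinear_smult[OF ml] tuples_upd
        H.scale_simps mult.commute)
  have unit: "nrm H (A x) \<le> a" if "x \<in> tuples n X" "\<And>i. i \<in> {1..n} \<Longrightarrow> nrm (X i) (x i) \<le> 1" for x
    unfolding a_def using le_multilinear_norm[OF A that] .
  have unit': "nrm H (A' x) \<le> 1" if "x \<in> tuples n X" "\<forall>i\<in>{1..n}. nrm (X i) (x i) \<le> 1" for x
  proof -
    have "nrm H (A' x) = nrm H (A x) / a"
      using H.nrm_smult[OF c Ac[OF that(1)]] a by (simp add: A'_def c_def norm_divide)
    then show ?thesis using unit[OF that(1)] that(2) a by (auto simp: divide_le_eq_1)
  qed
  have lip': "nrm Y (T x \<ominus>\<^bsub>Y\<^esub> T y) \<le> r * nrm H (A' x \<ominus>\<^bsub>H\<^esub> A' y)"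
    if xy: "x \<in> tuples n X" "y \<in> tuples n X" for x y
  proof -
    \<comment> \<open>For \<open>a = 0\<close> the operator \<open>A\<close> must vanish on all
      tuples and not just in the unit balls; \<open>multilinear_bound\<close> with constant 0 gives
      this.\<close>
    have eq: "nrm H (A x \<ominus>\<^bsub>H\<^esub> A y) = a * nrm H (A' x \<ominus>\<^bsub>H\<^esub> A' y)"
    proof (cases "a = 0")
      case True
      have "nrm H (A z) = 0" if z: "z \<in> tuples n X" for z
      proof -
        have "nrm H (A z) \<le> a * (1 + (\<Sum>i=1..n. nrm (X i) (z i))) ^ n"
          using ml H X unit z by (rule multilinear_bound)
        then show ?thesis using H.nrm_nonneg[OF Ac[OF z]] unfolding True by linarith
      qed
      then have "A x = \<zero>\<^bsub>H\<^esub>" "A y = \<zero>\<^bsub>H\<^esub>" using xy Ac by (simp_all add: H.nrm_eq_0_iff)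
      then show ?thesis using True by (simp add: H.M.minus_eq H.nrm_a_inv)
    next
      case False
      have "c \<odot>\<^bsub>H\<^esub> (A x \<ominus>\<^bsub>H\<^esub> A y) = A' x \<ominus>\<^bsub>H\<^esub> A' y"
        using c xy Ac H.scale_simps(3)[of c "-1" "A y"] H.scale_simps(3)[of "-1" c "A y"]
        by (simp add: A'_def H.M.minus_eq H.scale_simps flip: H.minus_one_smult)
      then have "nrm H (A' x \<ominus>\<^bsub>H\<^esub> A' y) = nrm H (A x \<ominus>\<^bsub>H\<^esub> A y) / a"
        using H.nrm_smult[OF c, of "A x \<ominus>\<^bsub>H\<^esub> A y"] xy Ac a by (simp add: c_def norm_divide)
      then show ?thesis using False by simp
    qed
    have "nrm Y (T x \<ominus>\<^bsub>Y\<^esub> T y) \<le> l * (a * nrm H (A' x \<ominus>\<^bsub>H\<^esub> A' y))"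
      using lip[OF xy] by (simp add: eq)
    also have "\<dots> = (a * l) * nrm H (A' x \<ominus>\<^bsub>H\<^esub> A' y)" by simp
    also have "\<dots> \<le> r * nrm H (A' x \<ominus>\<^bsub>H\<^esub> A' y)"
      using al multilinear_carrier[OF ml'] xy by (intro mult_right_mono) auto
    finally show ?thesis .
  qed
  show ?thesis
    unfolding unit_hilbert_operator_def using H ip ml' unit' lip'
    by (intro exI[of _ H] exI[of _ ip] exI[of _ A']) simp
qed


section \<open>Compressions\<close>

text \<open>The estimate is made for each factorization of \<open>T\<close> and then passes to the
  infimum; if there is none, the right-hand side is infinite.\<close>

lemma hilbert_gamma_compression_le:
  fixes X :: "nat \<Rightarrow> 'a normed" and Y :: "'b normed"
  assumes X: "\<And>i. i \<in> {1..n} \<Longrightarrow> normed_space K (X i)" and Y: "normed_space K Y"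
    and E: "\<And>i. i \<in> {1..n} \<Longrightarrow> submodule (E i) (scalar_ring K) (X i)"
    and L: "submodule L (scalar_ring K) Y" "closedin (mtopology_of (nmetric Y)) L"
  shows "hilbert_gamma K n (\<lambda>i. subspace_normed (X i) (E i)) (quotient_normed Y L)
      (restrict (quotient_proj Y L \<circ> T) (tuples n (\<lambda>i. subspace_normed (X i) (E i))))
    \<le> hilbert_gamma K n X Y T"
    (is "hilbert_gamma K n ?XE ?Q ?T \<le> _")
  unfolding hilbert_gamma_def[of K n X Y T]
proof (rule Inf_greatest)
  let ?q = "quotient_proj Y L"
  fix g assume "g \<in> {ennreal (multilinear_norm n X H A * Lip (submetric (nmetric H) M) (nmetric Y) B)
       |(H :: ((nat \<Rightarrow> 'a) \<Rightarrow> complex) normed) M A B. hilbert_factorization K n X Y T H M A B}"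
  then obtain H :: "((nat \<Rightarrow> 'a) \<Rightarrow> complex) normed" and M A B
    where g: "g = ennreal (multilinear_norm n X H A * Lip (submetric (nmetric H) M) (nmetric Y) B)"
      and F: "hilbert_factorization K n X Y T H M A B" by blast
  have hs: "hilbert_space K H" and H: "normed_space K H"
    using F unfolding hilbert_factorization_def hilbert_space_def banach_space_def by auto
  have MH: "M \<subseteq> carrier H" and AM: "A ` tuples n X \<subseteq> M" and A: "bounded_multilinear K n X H A"
    and BL: "Lipschitz_continuous_map (submetric (nmetric H) M) (nmetric Y) B"
    and TBA: "\<And>x. x \<in> tuples n X \<Longrightarrow> T x = B (A x)"
    using F unfolding hilbert_factorization_def by auto
  interpret H: normed_space K H by (rule H)
  interpret Y: normed_space K Y by (rule Y)
  interpret Q: normed_space K ?Q by (rule Y.normed_space_quotient[OF L])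
  have XE: "normed_space K (?XE i)" if "i \<in> {1..n}" for i
    using normed_space.normed_space_subspace[OF X[OF that] E[OF that]] .
  have EX: "E i \<subseteq> carrier (X i)" if "i \<in> {1..n}" for i
  proof -
    interpret normed_space K "X i" by (rule X[OF that])
    show ?thesis by (rule submoduleE(1)[OF E[OF that]])
  qed
  have tup: "x \<in> tuples n X" if "x \<in> tuples n ?XE" for x
    using that PiE_mono[of "{1..n}" E "\<lambda>i. carrier (X i)"] EX by (auto simp: tuples_def)
  have ml: "multilinear K n X H A" using A by (simp add: bounded_multilinear_def)
  have "multilinear K n ?XE H A"
    unfolding multilinear_def
    using EX by (auto simp: multilinear_carrier[OF ml] tup multilinear_add[OF ml]
        multilinear_smult[OF ml] subset_iff)
  moreover have "unit_values n ?XE H A \<subseteq> unit_values n X H A"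
    unfolding unit_values_def using tup by auto
  ultimately have A': "bounded_multilinear K n ?XE H A"
    using A by (auto simp: bounded_multilinear_def intro: bdd_above_mono)
  have ms: "mspace (submetric (nmetric H) M) = M" using MH by auto
  have BY: "B u \<in> carrier Y" if "u \<in> M" for u
    using BL that unfolding Lipschitz_continuous_map_def ms by auto
  let ?l = "Lip (submetric (nmetric H) M) (nmetric Y) B"
  have lip: "mdist (nmetric ?Q) ((?q \<circ> B) u) ((?q \<circ> B) v) \<le> ?l * mdist (nmetric H) u v"
    if uv: "u \<in> M" "v \<in> M" for u v
  proof -
    have neg: "?q (B u) \<ominus>\<^bsub>?Q\<^esub> ?q (B v) = ?q (B u \<ominus>\<^bsub>Y\<^esub> B v)"
      by (rule Y.quotient_proj_minus[OF L(1) BY BY L(2)]) (use uv in auto)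
    have "mdist (nmetric ?Q) ((?q \<circ> B) u) ((?q \<circ> B) v) = nrm ?Q (?q (B u \<ominus>\<^bsub>Y\<^esub> B v))"
      using uv BY by (simp add: Q.mdist_nmetric Y.quotient_carrier neg)
    also have "\<dots> \<le> nrm Y (B u \<ominus>\<^bsub>Y\<^esub> B v)"
      using uv BY by (intro Y.nrm_quotient_proj_le[OF L(1)]) auto
    also have "\<dots> = mdist (nmetric Y) (B u) (B v)" using uv BY by (simp add: Y.mdist_nmetric)
    also have "\<dots> \<le> ?l * mdist (nmetric H) u v" using mdist_le_Lip[OF BL] uv MH by auto
    finally show ?thesis .
  qed
  have BL': "Lipschitz_continuous_map (submetric (nmetric H) M) (nmetric ?Q) (?q \<circ> B)"
    unfolding Lipschitz_continuous_map_def ms mdist_submetric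
    using lip BY by (auto simp: Y.quotient_carrier)
  have "hilbert_factorization K n ?XE ?Q ?T H M A (?q \<circ> B)"
    unfolding hilbert_factorization_def using hs MH A' AM BL' by (auto simp: tup TBA)
  then have "hilbert_gamma K n ?XE ?Q ?T
      \<le> ennreal (multilinear_norm n ?XE H A * Lip (submetric (nmetric H) M) (nmetric ?Q) (?q \<circ> B))"
    by (rule hilbert_gamma_le)
  also have "\<dots> \<le> g"
    unfolding g
  proof (intro ennreal_leI mult_mono)
    show "multilinear_norm n ?XE H A \<le> multilinear_norm n X H A"
      by (rule multilinear_norm_leI[OF XE]) (auto intro!: le_multilinear_norm[OF A] tup)
    show "Lip (submetric (nmetric H) M) (nmetric ?Q) (?q \<circ> B) \<le> ?l"
      by (rule Lip_leI[OF Lip_nonneg[OF BL]]) (unfold ms mdist_submetric, rule lip)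
    show "0 \<le> multilinear_norm n X H A" by (rule multilinear_norm_nonneg[OF A H X])
    show "0 \<le> Lip (submetric (nmetric H) M) (nmetric ?Q) (?q \<circ> B)" by (rule Lip_nonneg[OF BL'])
  qed
  finally show "hilbert_gamma K n ?XE ?Q ?T \<le> g" .
qed


section \<open>Gluing the factorizations of the compressions\<close>

lemma tuples_lspan:
  assumes X: "\<And>i. i \<in> {1..n} \<Longrightarrow> normed_space K (X i)" and F: "F \<subseteq> tuples n X" and x: "x \<in> F"
  shows "x \<in> tuples n (\<lambda>i. subspace_normed (X i) (lspan K (X i) ((\<lambda>x. x i) ` F)))"
proof -
  have "x i \<in> lspan K (X i) ((\<lambda>x. x i) ` F)" if i: "i \<in> {1..n}" for i
  proof -
    have "(\<lambda>x. x i) ` F \<subseteq> carrier (X i)" using tuples_carrier[OF _ i] F by blast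
    then show ?thesis using normed_space.lspan_superset[OF X[OF i]] x by blast
  qed
  moreover have "x \<in> extensional {1..n}" using x F by (auto simp: tuples_def PiE_iff)
  ultimately show ?thesis by (auto simp: tuples_def PiE_iff)
qed

text \<open>The operator acts on all tuples of the spans, while the estimate for \<open>T\<close>
  itself is claimed on \<open>F\<close> only: \<open>L\<close> is chosen to preserve the norms of
  the finitely many differences of values on \<open>F\<close>.\<close>

lemma local_factorization:
  fixes X :: "nat \<Rightarrow> 'a normed" and Y :: "'b normed"
  assumes X: "\<And>i. i \<in> {1..n} \<Longrightarrow> normed_space K (X i)" and Y: "normed_space K Y"
    and T: "multilinear K n X Y T"
    and F: "finite F" "F \<subseteq> tuples n X"
    and r: "\<And>E L. \<lbrakk>\<And>i. i \<in> {1..n} \<Longrightarrow> fin_dim_subspace K (X i) (E i); fin_codim_subspace K Y L\<rbrakk> \<Longrightarrow>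
        hilbert_gamma K n (\<lambda>i. subspace_normed (X i) (E i)) (quotient_normed Y L)
          (restrict (quotient_proj Y L \<circ> T) (tuples n (\<lambda>i. subspace_normed (X i) (E i)))) < ennreal r"
  defines "XF \<equiv> \<lambda>i. subspace_normed (X i) (lspan K (X i) ((\<lambda>x. x i) ` F))"
  shows "\<exists>(H :: ((nat \<Rightarrow> 'a) \<Rightarrow> complex) normed) ip A. unit_hilbert_operator K n XF H ip A \<and>
    (\<forall>x\<in>F. \<forall>y\<in>F. nrm Y (T x \<ominus>\<^bsub>Y\<^esub> T y) \<le> r * nrm H (A x \<ominus>\<^bsub>H\<^esub> A y))"
proof -
  interpret Y: normed_space K Y by (rule Y)
  let ?E = "\<lambda>i. lspan K (X i) ((\<lambda>x. x i) ` F)"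
  have E: "fin_dim_subspace K (X i) (?E i)" if i: "i \<in> {1..n}" for i
    using F tuples_carrier[OF _ i]
    by (intro normed_space.fin_dim_subspace_lspan[OF X[OF i]]) auto
  have XF: "normed_space K (XF i)" if i: "i \<in> {1..n}" for i
    using normed_space.normed_space_subspace[OF X[OF i]] E[OF i]
    by (simp add: fin_dim_subspace_def XF_def)
  have EX: "?E i \<subseteq> carrier (X i)" if i: "i \<in> {1..n}" for i
  proof -
    interpret normed_space K "X i" by (rule X[OF i])
    show ?thesis using E[OF i] submoduleE(1) by (simp add: fin_dim_subspace_def)
  qed
  have tup: "x \<in> tuples n X" if "x \<in> tuples n XF" for x
    using that PiE_mono[of "{1..n}" ?E "\<lambda>i. carrier (X i)"] EX by (auto simp: tuples_def XF_def)
  have Tc: "T x \<in> carrier Y" if "x \<in> tuples n X" for x using multilinear_carrier[OF T that] .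
  define D where "D = (\<lambda>(x, y). T x \<ominus>\<^bsub>Y\<^esub> T y) ` (F \<times> F)"
  have "finite D" "D \<subseteq> carrier Y" using F Tc by (auto simp: D_def)
  then obtain L where L: "fin_codim_subspace K Y L"
    and D: "\<And>d. d \<in> D \<Longrightarrow> nrm Y d \<le> nrm (quotient_normed Y L) (quotient_proj Y L d)"
    using Y.norming_subspace by blast
  have Ls: "submodule L (scalar_ring K) Y" "closedin (mtopology_of (nmetric Y)) L"
    using L by (simp_all add: fin_codim_subspace_def)
  let ?Q = "quotient_normed Y L" and ?q = "quotient_proj Y L"
  have Q: "normed_space K ?Q" by (rule Y.normed_space_quotient[OF Ls])
  have QT: "restrict (?q \<circ> T) (tuples n XF) x \<in> carrier ?Q" if "x \<in> tuples n XF" for x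
    using that Tc[OF tup[OF that]] by (simp add: Y.quotient_carrier)
  have less: "hilbert_gamma K n XF ?Q (restrict (?q \<circ> T) (tuples n XF)) < ennreal r"
    using r[OF E L] by (simp add: XF_def)
  obtain H :: "((nat \<Rightarrow> 'a) \<Rightarrow> complex) normed" and ip A
    where A: "unit_hilbert_operator K n XF H ip A"
      and lip: "\<And>x y. \<lbrakk>x \<in> tuples n XF; y \<in> tuples n XF\<rbrakk> \<Longrightarrow>
        nrm ?Q (restrict (?q \<circ> T) (tuples n XF) x \<ominus>\<^bsub>?Q\<^esub> restrict (?q \<circ> T) (tuples n XF) y)
          \<le> r * nrm H (A x \<ominus>\<^bsub>H\<^esub> A y)"
    using unit_hilbert_operator_if_gamma_less[OF XF Q QT less] by metis
  have "nrm Y (T x \<ominus>\<^bsub>Y\<^esub> T y) \<le> r * nrm H (A x \<ominus>\<^bsub>H\<^esub> A y)" if xy: "x \<in> F" "y \<in> F" for x y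
  proof -
    have tXF: "x \<in> tuples n XF" "y \<in> tuples n XF"
      using tuples_lspan[OF X F(2)] xy by (auto simp: XF_def)
    have "nrm Y (T x \<ominus>\<^bsub>Y\<^esub> T y) \<le> nrm ?Q (?q (T x \<ominus>\<^bsub>Y\<^esub> T y))"
      using xy by (intro D) (auto simp: D_def)
    also have "?q (T x \<ominus>\<^bsub>Y\<^esub> T y) = ?q (T x) \<ominus>\<^bsub>?Q\<^esub> ?q (T y)"
      using xy F Tc by (intro Y.quotient_proj_minus[OF Ls(1) _ _ Ls(2), symmetric]) auto
    also have "nrm ?Q \<dots> \<le> r * nrm H (A x \<ominus>\<^bsub>H\<^esub> A y)" using lip[OF tXF] tXF by simp
    finally show ?thesis .
  qed
  then show ?thesis using A by blast
qed

lemma hilbert_factorization_glue: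
  fixes X :: "nat \<Rightarrow> 'a normed" and Y :: "'b normed"
  assumes X: "\<And>i. i \<in> {1..n} \<Longrightarrow> normed_space K (X i)" and Y: "normed_space K Y"
    and T: "multilinear K n X Y T" and r: "r \<ge> 0"
    and gamma: "\<And>E L. \<lbrakk>\<And>i. i \<in> {1..n} \<Longrightarrow> fin_dim_subspace K (X i) (E i); fin_codim_subspace K Y L\<rbrakk> \<Longrightarrow>
        hilbert_gamma K n (\<lambda>i. subspace_normed (X i) (E i)) (quotient_normed Y L)
          (restrict (quotient_proj Y L \<circ> T) (tuples n (\<lambda>i. subspace_normed (X i) (E i)))) \<le> ennreal r"
  shows "factors_through_hilbert K n X Y T" and "hilbert_gamma K n X Y T \<le> ennreal r"
proof -
  interpret Y: normed_space K Y by (rule Y)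
  \<comment> \<open>The index type contains all sets of tuples; replacing unsuitable ones by {}
    gives every index a local factorization.\<close>
  define G where "G F = (if finite F \<and> F \<subseteq> tuples n X then F else {})" for F
  define XF where "XF F = (\<lambda>i. subspace_normed (X i) (lspan K (X i) ((\<lambda>x. x i) ` G F)))" for F
  have Gfin: "finite (G F)" and GX: "G F \<subseteq> tuples n X" for F by (auto simp: G_def)
  let ?r = "\<lambda>m. r + inverse (real (Suc m))"
  have "\<exists>(H :: ((nat \<Rightarrow> 'a) \<Rightarrow> complex) normed) ip A. unit_hilbert_operator K n (XF (fst j)) H ip A \<and>
      (\<forall>x\<in>G (fst j). \<forall>y\<in>G (fst j).
        nrm Y (T x \<ominus>\<^bsub>Y\<^esub> T y) \<le> ?r (snd j) * nrm H (A x \<ominus>\<^bsub>H\<^esub> A y))"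
    for j :: "(nat \<Rightarrow> 'a) set \<times> nat"
    unfolding XF_def
  proof (rule local_factorization[OF X Y T Gfin GX])
    fix E L assume "\<And>i. i \<in> {1..n} \<Longrightarrow> fin_dim_subspace K (X i) (E i)" and "fin_codim_subspace K Y L"
    then have "hilbert_gamma K n (\<lambda>i. subspace_normed (X i) (E i)) (quotient_normed Y L)
          (restrict (quotient_proj Y L \<circ> T) (tuples n (\<lambda>i. subspace_normed (X i) (E i)))) \<le> ennreal r"
      by (rule gamma)
    also have "ennreal r < ennreal (?r (snd j))" using r by (intro ennreal_lessI add_nonneg_pos) auto
    finally show "hilbert_gamma K n (\<lambda>i. subspace_normed (X i) (E i)) (quotient_normed Y L)
          (restrict (quotient_proj Y L \<circ> T) (tuples n (\<lambda>i. subspace_normed (X i) (E i))))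
        < ennreal (?r (snd j))" .
  qed
  then obtain H :: "(nat \<Rightarrow> 'a) set \<times> nat \<Rightarrow> ((nat \<Rightarrow> 'a) \<Rightarrow> complex) normed" and ip A
    where op: "\<And>j. unit_hilbert_operator K n (XF (fst j)) (H j) (ip j) (A j)"
      and lip: "\<And>j x y. \<lbrakk>x \<in> G (fst j); y \<in> G (fst j)\<rbrakk> \<Longrightarrow>
        nrm Y (T x \<ominus>\<^bsub>Y\<^esub> T y) \<le> ?r (snd j) * nrm (H j) (A j x \<ominus>\<^bsub>H j\<^esub> A j y)"
    by metis
  have H: "normed_space K (H j)" and ip: "inner_product_on K (H j) (ip j)"
    and A: "multilinear K n (XF (fst j)) (H j) (A j)" for j
    using op[of j] by (auto simp: unit_hilbert_operator_def)
  have unit: "nrm (H j) (A j x) \<le> 1"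
    if "x \<in> tuples n (XF (fst j))" "\<And>i. i \<in> {1..n} \<Longrightarrow> nrm (X i) (x i) \<le> 1" for j x
    using op[of j] that by (simp add: unit_hilbert_operator_def XF_def)

  \<comment> \<open>Along this filter \<open>F\<close> eventually contains any given finite set of
    tuples while \<open>m\<close> tends to infinity independently; \<open>snd\<close> serves as the
    depth of the ultraproduct.\<close>
  define F0 where "F0 = finite_subsets_at_top (tuples n X) \<times>\<^sub>F sequentially"
  have "F0 \<noteq> bot" by (simp add: F0_def prod_filter_eq_bot)
  then obtain U where U: "U \<le> F0" "ultrafilter U" using ultrafilter_exists by blast
  have snd_U: "filterlim snd sequentially U"
    using filterlim_snd U(1) unfolding F0_def by (rule filterlim_mono[OF _ order_refl])
  have fst_U: "filterlim fst (finite_subsets_at_top (tuples n X)) U"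
    using filterlim_fst U(1) unfolding F0_def by (rule filterlim_mono[OF _ order_refl])
  interpret ultraproduct K U H ip snd
    by (intro ultraproduct.intro U(2) H ip snd_U)

  have ev: "\<forall>\<^sub>F j in U. x \<in> G (fst j)" if "x \<in> tuples n X" for x
  proof (rule eventually_compose_filterlim[OF _ fst_U])
    show "\<forall>\<^sub>F F in finite_subsets_at_top (tuples n X). x \<in> G F"
      unfolding eventually_finite_subsets_at_top using that by (intro exI[of _ "{x}"]) (auto simp: G_def)
  qed
  have in_XF: "x \<in> tuples n (XF (fst j))" if "x \<in> G (fst j)" for x j
    using tuples_lspan[OF X GX that] by (simp add: XF_def)
  have XFn: "normed_space K (XF F i)" if i: "i \<in> {1..n}" for F i
  proof -
    have "(\<lambda>x. x i) ` G F \<subseteq> carrier (X i)" using tuples_carrier[OF _ i] GX by blast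
    then show ?thesis
      unfolding XF_def using normed_space.submodule_lspan normed_space.normed_space_subspace X[OF i]
      by blast
  qed

  \<comment> \<open>Extension by zero outside the spans makes the family total; for a fixed tuple it
    takes effect only at a negligible set of indices.\<close>
  define a where "a x j = (if x \<in> tuples n (XF (fst j)) then A j x else \<zero>\<^bsub>H j\<^esub>)" for x j
  have a_eq: "a x j = A j x" if "x \<in> G (fst j)" for x j using in_XF[OF that] by (simp add: a_def)
  have ac: "a x j \<in> carrier (H j)" for x j
    using multilinear_carrier[OF A] by (simp add: a_def)
  have afam: "a x \<in> fam" if x: "x \<in> tuples n X" for x
  proof -
    \<comment> \<open>The bound is free of \<open>j\<close>: every \<open>A j\<close> has norm at
      most one, and the spans carry the norms of the \<open>X i\<close>.\<close>
    have "nrm (H j) (a x j) \<le> (1 + (\<Sum>i=1..n. nrm (X i) (x i))) ^ n" for j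
    proof (cases "x \<in> tuples n (XF (fst j))")
      case True
      have "nrm (H j) (A j x) \<le> 1 * (1 + (\<Sum>i=1..n. nrm (XF (fst j) i) (x i))) ^ n"
        using A H XFn _ True by (rule multilinear_bound) (auto simp: XF_def intro!: unit)
      then show ?thesis using True by (simp add: a_def XF_def)
    next
      case False
      have "0 \<le> (\<Sum>i=1..n. nrm (X i) (x i))"
        using normed_space.nrm_nonneg[OF X tuples_carrier[OF x]] by (intro sum_nonneg) auto
      then show ?thesis using False by (simp add: a_def)
    qed
    then show ?thesis using ac by (auto simp: fam_def)
  qed

  obtain Hu :: "(((nat \<Rightarrow> 'a) set \<times> nat \<Rightarrow> (nat \<Rightarrow> 'a) \<Rightarrow> complex) \<Rightarrow> complex) normed" and \<phi>
  where hs: "hilbert_space K Hu"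
    and \<phi>c: "\<And>u. u \<in> fam \<Longrightarrow> \<phi> u \<in> carrier Hu"
    and \<phi>add: "\<And>u v w. \<lbrakk>u \<in> fam; v \<in> fam; w \<in> fam; \<forall>\<^sub>F j in U. w j = u j \<oplus>\<^bsub>H j\<^esub> v j\<rbrakk> \<Longrightarrow>
        \<phi> w = \<phi> u \<oplus>\<^bsub>Hu\<^esub> \<phi> v"
    and \<phi>smult: "\<And>c u w. \<lbrakk>c \<in> K; u \<in> fam; w \<in> fam; \<forall>\<^sub>F j in U. w j = c \<odot>\<^bsub>H j\<^esub> u j\<rbrakk> \<Longrightarrow>
        \<phi> w = c \<odot>\<^bsub>Hu\<^esub> \<phi> u"
    and \<phi>nrm: "\<And>u. u \<in> fam \<Longrightarrow> ((\<lambda>j. nrm (H j) (u j)) \<longlongrightarrow> nrm Hu (\<phi> u)) U"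
    and \<phi>diff: "\<And>u v. \<lbrakk>u \<in> fam; v \<in> fam\<rbrakk> \<Longrightarrow>
        ((\<lambda>j. nrm (H j) (u j \<ominus>\<^bsub>H j\<^esub> v j)) \<longlongrightarrow> nrm Hu (\<phi> u \<ominus>\<^bsub>Hu\<^esub> \<phi> v)) U"
    using ultraproduct_hilbert_space by blast
  interpret Hu: normed_space K Hu using hs by (simp add: hilbert_space_def banach_space_def)
  define A' where "A' x = \<phi> (a x)" for x
  have A'c: "A' x \<in> carrier Hu" if "x \<in> tuples n X" for x
    using \<phi>c[OF afam[OF that]] by (simp add: A'_def)
  have Xin: "u \<oplus>\<^bsub>X i\<^esub> v \<in> carrier (X i)" "c \<odot>\<^bsub>X i\<^esub> u \<in> carrier (X i)"
    if "i \<in> {1..n}" "u \<in> carrier (X i)" "v \<in> carrier (X i)" "c \<in> K" for i u v c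
  proof -
    interpret normed_space K "X i" by (rule X[OF that(1)])
    show "u \<oplus>\<^bsub>X i\<^esub> v \<in> carrier (X i)" "c \<odot>\<^bsub>X i\<^esub> u \<in> carrier (X i)" using that by auto
  qed
  have slot: "u \<in> carrier (XF (fst j) i)" if "x(i := u) \<in> tuples n (XF (fst j))" "i \<in> {1..n}" for x u i j
    using tuples_carrier[OF that] by simp
  have ml: "multilinear K n X Hu A'"
    unfolding multilinear_def
  proof (intro conjI ballI Pi_I)
    fix x i u v
    assume x: "x \<in> tuples n X" and i: "i \<in> {1..n}" and u: "u \<in> carrier (X i)" and v: "v \<in> carrier (X i)"
    note upd = tuples_upd[OF x i]
    \<comment> \<open>Almost every index has all three tuples in its finite set; there
      \<open>a\<close> agrees with \<open>A j\<close>, and multilinearity on the spans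
      applies.\<close>
    have "\<forall>\<^sub>F j in U. a (x(i := u \<oplus>\<^bsub>X i\<^esub> v)) j = a (x(i := u)) j \<oplus>\<^bsub>H j\<^esub> a (x(i := v)) j"
      using ev[OF upd[OF u]] ev[OF upd[OF v]] ev[OF upd[OF Xin(1)[OF i u v Hu.scalar_closed(1)]]]
    proof eventually_elim
      case (elim j)
      have "A j ((x(i := u))(i := u \<oplus>\<^bsub>XF (fst j) i\<^esub> v))
          = A j ((x(i := u))(i := u)) \<oplus>\<^bsub>H j\<^esub> A j ((x(i := u))(i := v))"
        using in_XF elim i by (intro multilinear_add[OF A] slot[of x]) auto
      then show ?case using elim by (simp add: a_eq XF_def)
    qed
    then show "A' (x(i := u \<oplus>\<^bsub>X i\<^esub> v)) = A' (x(i := u)) \<oplus>\<^bsub>Hu\<^esub> A' (x(i := v))"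
      unfolding A'_def using Xin(1)[OF i u v Hu.scalar_closed(1)] u v by (intro \<phi>add afam upd)
  next
    fix x i c u
    assume x: "x \<in> tuples n X" and i: "i \<in> {1..n}" and c: "c \<in> K" and u: "u \<in> carrier (X i)"
    note upd = tuples_upd[OF x i]
    have "\<forall>\<^sub>F j in U. a (x(i := c \<odot>\<^bsub>X i\<^esub> u)) j = c \<odot>\<^bsub>H j\<^esub> a (x(i := u)) j"
      using ev[OF upd[OF u]] ev[OF upd[OF Xin(2)[OF i u u c]]]
    proof eventually_elim
      case (elim j)
      have "A j ((x(i := u))(i := c \<odot>\<^bsub>XF (fst j) i\<^esub> u)) = c \<odot>\<^bsub>H j\<^esub> A j ((x(i := u))(i := u))"
        using in_XF elim i c by (intro multilinear_smult[OF A] slot[of x]) auto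
      then show ?case using elim by (simp add: a_eq XF_def)
    qed
    then show "A' (x(i := c \<odot>\<^bsub>X i\<^esub> u)) = c \<odot>\<^bsub>Hu\<^esub> A' (x(i := u))"
      unfolding A'_def using Xin(2)[OF i u u c] u c by (intro \<phi>smult afam upd)
  qed (rule A'c)
  have unit': "nrm Hu (A' x) \<le> 1"
    if x: "x \<in> tuples n X" and le: "\<And>i. i \<in> {1..n} \<Longrightarrow> nrm (X i) (x i) \<le> 1" for x
    unfolding A'_def
  proof (rule tendsto_upperbound[OF \<phi>nrm[OF afam[OF x]] _ nontrivial])
    have "nrm (H j) (a x j) \<le> 1" for j using unit[OF _ le] by (simp add: a_def)
    then show "\<forall>\<^sub>F j in U. nrm (H j) (a x j) \<le> 1" by simp
  qed
  have lip': "nrm Y (T x \<ominus>\<^bsub>Y\<^esub> T y) \<le> r * nrm Hu (A' x \<ominus>\<^bsub>Hu\<^esub> A' y)"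
    if x: "x \<in> tuples n X" and y: "y \<in> tuples n X" for x y
  proof -
    have "((\<lambda>j. ?r (snd j)) \<longlongrightarrow> r + 0) U"
      by (intro tendsto_add tendsto_const filterlim_compose[OF LIMSEQ_inverse_real_of_nat snd_U])
    then have lim: "((\<lambda>j. ?r (snd j) * nrm (H j) (a x j \<ominus>\<^bsub>H j\<^esub> a y j)) \<longlongrightarrow>
        (r + 0) * nrm Hu (A' x \<ominus>\<^bsub>Hu\<^esub> A' y)) U"
      unfolding A'_def by (intro tendsto_mult \<phi>diff afam x y)
    have "\<forall>\<^sub>F j in U. nrm Y (T x \<ominus>\<^bsub>Y\<^esub> T y) \<le> ?r (snd j) * nrm (H j) (a x j \<ominus>\<^bsub>H j\<^esub> a y j)"
      using ev[OF x] ev[OF y] by eventually_elim (simp only: lip a_eq)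
    from tendsto_lowerbound[OF lim this nontrivial] show ?thesis by simp
  qed

  define M where "M = A' ` tuples n X"
  \<comment> \<open>The chosen preimage is immaterial: if \<open>A' x = A' y\<close>, then
    \<open>lip'\<close> bounds the distance of \<open>T x\<close> and \<open>T y\<close> by r *
    0.\<close>
  define B where "B h = T (SOME x. x \<in> tuples n X \<and> A' x = h)" for h
  have BA: "B (A' x) = T x" if x: "x \<in> tuples n X" for x
  proof -
    define y where "y = (SOME y. y \<in> tuples n X \<and> A' y = A' x)"
    have y: "y \<in> tuples n X" "A' y = A' x"
      using someI[of "\<lambda>y. y \<in> tuples n X \<and> A' y = A' x", OF conjI[OF x refl]] by (auto simp: y_def)
    have "nrm Hu (A' y \<ominus>\<^bsub>Hu\<^esub> A' x) = 0"
      using A'c[OF x] by (simp add: y Hu.M.minus_eq Hu.M.r_neg)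
    then have "nrm Y (T y \<ominus>\<^bsub>Y\<^esub> T x) \<le> 0" using lip'[OF y(1) x] by simp
    then have "T y \<ominus>\<^bsub>Y\<^esub> T x = \<zero>\<^bsub>Y\<^esub>"
      using multilinear_carrier[OF T] x y by (subst Y.nrm_eq_0_iff[symmetric]) (auto intro: antisym)
    then have "T y = T x" using multilinear_carrier[OF T] x y by (simp add: Y.minus_eq_0_iff)
    then show ?thesis by (simp add: B_def y_def)
  qed
  have ms: "mspace (submetric (nmetric Hu) M) = M" using A'c by (auto simp: M_def)
  have Blip: "mdist (nmetric Y) (B u) (B v) \<le> r * mdist (submetric (nmetric Hu) M) u v"
    if uv: "u \<in> M" "v \<in> M" for u v
    using uv lip' multilinear_carrier[OF T] A'c
    by (auto simp: M_def BA Y.mdist_nmetric Hu.mdist_nmetric)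
  have BL: "Lipschitz_continuous_map (submetric (nmetric Hu) M) (nmetric Y) B"
    unfolding Lipschitz_continuous_map_def ms
  proof (intro conjI exI ballI)
    show "B \<in> M \<rightarrow> mspace (nmetric Y)" using multilinear_carrier[OF T] by (auto simp: M_def BA)
  qed (rule Blip)
  have A'b: "bounded_multilinear K n X Hu A'"
    unfolding bounded_multilinear_def
    using ml unit' by (auto simp: unit_values_def intro!: bdd_aboveI[of _ 1])
  have fac: "hilbert_factorization K n X Y T Hu M A' B"
    unfolding hilbert_factorization_def using hs A'c A'b BL by (auto simp: M_def BA)
  \<comment> \<open>\<open>Hu\<close> lives over a larger type than the definition of \<Gamma>
    quantifies over; the transfer to the fixed type does not increase the constant.\<close>
  then show "factors_through_hilbert K n X Y T" by (rule factors_through_hilbertI)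
  have "multilinear_norm n X Hu A' * Lip (submetric (nmetric Hu) M) (nmetric Y) B \<le> 1 * r"
  proof (rule mult_mono)
    show "multilinear_norm n X Hu A' \<le> 1" using X unit' by (rule multilinear_norm_leI)
    show "Lip (submetric (nmetric Hu) M) (nmetric Y) B \<le> r"
      using r by (rule Lip_leI) (unfold ms, rule Blip)
    show "0 \<le> Lip (submetric (nmetric Hu) M) (nmetric Y) B" by (rule Lip_nonneg[OF BL])
  qed simp
  then show "hilbert_gamma K n X Y T \<le> ennreal r"
    using hilbert_gamma_le[OF fac] by (auto intro: order_trans ennreal_leI)
qed

theorem theorem3p2:
  fixes K :: "complex set" and n :: nat
    and X :: "nat \<Rightarrow> 'a normed" and Y :: "'b normed" and T :: "(nat \<Rightarrow> 'a) \<Rightarrow> 'b"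
    and s :: ennreal
  assumes "K = \<real> \<or> K = UNIV" and "n \<ge> 1"
    and "\<And>i. i \<in> {1..n} \<Longrightarrow> banach_space K (X i)"
    and "banach_space K Y"
    and "multilinear K n X Y T"
    and "s = (SUP (E, L) \<in> {(E, L). (\<forall>i\<in>{1..n}. fin_dim_subspace K (X i) (E i)) \<and>
                                    fin_codim_subspace K Y L}.
               hilbert_gamma K n (\<lambda>i. subspace_normed (X i) (E i)) (quotient_normed Y L)
                 (restrict (quotient_proj Y L \<circ> T) (tuples n (\<lambda>i. subspace_normed (X i) (E i)))))"
  shows "(factors_through_hilbert K n X Y T \<longleftrightarrow> s < \<infinity>) \<and>
         (factors_through_hilbert K n X Y T \<longrightarrow> hilbert_gamma K n X Y T = s)"
proof -
  have X: "normed_space K (X i)" if "i \<in> {1..n}" for i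
    using assms(3)[OF that] by (simp add: banach_space_def)
  have Y: "normed_space K Y" using assms(4) by (simp add: banach_space_def)
  let ?g = "\<lambda>E L. hilbert_gamma K n (\<lambda>i. subspace_normed (X i) (E i)) (quotient_normed Y L)
     (restrict (quotient_proj Y L \<circ> T) (tuples n (\<lambda>i. subspace_normed (X i) (E i))))"
  have le: "s \<le> hilbert_gamma K n X Y T"
    unfolding assms(6)
  proof (rule SUP_least, clarify)
    fix E L assume E: "\<forall>i\<in>{1..n}. fin_dim_subspace K (X i) (E i)" and L: "fin_codim_subspace K Y L"
    show "?g E L \<le> hilbert_gamma K n X Y T"
    proof (rule hilbert_gamma_compression_le[OF X Y])
      show "submodule (E i) (scalar_ring K) (X i)" if "i \<in> {1..n}" for i
        using E that by (simp add: fin_dim_subspace_def)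
    qed (use L in \<open>simp_all add: fin_codim_subspace_def\<close>)
  qed
  have ge: "factors_through_hilbert K n X Y T \<and> hilbert_gamma K n X Y T \<le> s" if fin: "s < \<infinity>"
  proof -
    obtain r where r: "s = ennreal r" "r \<ge> 0" using fin by (cases s) auto
    have "?g E L \<le> ennreal r"
      if "\<And>i. i \<in> {1..n} \<Longrightarrow> fin_dim_subspace K (X i) (E i)" "fin_codim_subspace K Y L" for E L
      unfolding r(1)[symmetric] assms(6) using that by (intro SUP_upper2[of "(E, L)"]) auto
    from hilbert_factorization_glue[OF X Y assms(5) r(2) this] r show ?thesis by simp
  qed
  \<comment> \<open>The constant of a single factorization is a real number and bounds \<Gamma>,
    hence also \<open>s\<close>.\<close>
  have "s < \<infinity>" if "factors_through_hilbert K n X Y T"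
  proof -
    from that obtain H :: "((nat \<Rightarrow> 'a) \<Rightarrow> complex) normed" and M A B
      where "hilbert_factorization K n X Y T H M A B"
      unfolding factors_through_hilbert_def by blast
    from order_trans[OF le hilbert_gamma_le[OF this]] show ?thesis
      by (rule le_less_trans) simp
  qed
  then show ?thesis using le ge by (blast intro: antisym)
qed

end
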